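(* Let $N\ge 2$, let $\mu$ be a nontrivial Radon measure in $\mathbf{R}^N$ with $\operatorname{supp}\mu\subset B(0,R)$ for some $R>0$, let $p>1$, and assume that $G*\mu\in L^q(\mathbf{R}^N)$ for some real number $q>\max\{p,\frac{N(p-1)}{2}\}$. Then there exists $\kappa^*\in(0,\infty)$ with the following properties: (i) If $0<\kappa<\kappa^*$, then problem $(P_\kappa)$ possesses a minimal $(C_0+L^q_{\rm c})$-solution $u^\kappa$. Furthermore, $u^\kappa(x)=O(G(x))$ as $|x|\to\infty$. (ii) If $\kappa>\kappa^*$, then problem $(P_\kappa)$ possesses no $(C_0+L^q_{\rm c})$-solutions.
   Context: Radon measures are nonnegative. $B(x,r)$ is the open ball of radius $r$ centered at $x$ in $\mathbf{R}^N$. $C_0(\mathbf{R}^N)$ is the set of continuous functions on $\mathbf{R}^N$ tending to $0$ as $|x|\to\infty$; $L^q_{\rm c}(\mathbf{R}^N)$ is the set of $f\in L^q(\mathbf{R}^N)$ with compact support. $G(x):=(2\pi)^{-N/2}|x|^{-(N-2)/2}K_{(N-2)/2}(|x|)$, $x\ne0$, is the fundamental solution of $-\Delta v+v=0$ in $\mathbf{R}^N$, where $K_{(N-2)/2}$ is the modified Bessel function (of the second kind) of order $(N-2)/2$; $[G*\mu](x)=\int_{\mathbf{R}^N}G(x-y)\,d\mu(y)$. Functions equal almost everywhere are identified. For $\kappa>0$, $(P_\kappa)$ is the problem: $-\Delta u+u=u^p+\kappa\mu$ in $\mathbf{R}^N$, $u>0$ in $\mathbf{R}^N$, $u(x)\to0$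 as $|x|\to\infty$. A $(C_0+L^q_{\rm c})$-solution of $(P_\kappa)$ is a function $u\in C_0(\mathbf{R}^N)+L^q_{\rm c}(\mathbf{R}^N)$ with $u(x)=[G*u^p](x)+\kappa[G*\mu](x)>0$ for almost all $x\in\mathbf{R}^N$. A minimal $(C_0+L^q_{\rm c})$-solution is a $(C_0+L^q_{\rm c})$-solution $u$ such that $u(x)\le v(x)$ for almost all $x$ for every $(C_0+L^q_{\rm c})$-solution $v$ of $(P_\kappa)$. *)

theory Defs
  imports "HOL-Analysis.Analysis" "HOL-Library.Landau_Symbols"
begin

text \<open>
  Modified Bessel function of the second kind of order \<open>\<nu>\<close>, for arguments \<open>x > 0\<close>, by the
  classical integral \<open>K\<^sub>\<nu>(x) = \<integral>\<^sub>0\<^sup>\<infinity> exp (- x cosh t) cosh (\<nu> t) dt\<close>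
  (absolutely convergent for \<open>x > 0\<close>).
\<close>

definition bessel_K :: "real \<Rightarrow> real \<Rightarrow> real" where
  "bessel_K \<nu> x =
     set_lebesgue_integral lborel {0..} (\<lambda>t. exp (- x * cosh t) * cosh (\<nu> * t))"

text \<open>
  Fundamental solution of \<open>- \<Delta>v + v = 0\<close>. It is meaningful for \<open>x \<noteq> 0\<close> only; its value at the
  origin affects the potentials below only on a Lebesgue null set (the atoms of the measure).
\<close>

definition fund_sol :: "'a::euclidean_space \<Rightarrow> real" where
  "fund_sol x = (2 * pi) powr (- (real DIM('a) / 2))
     * norm x powr (- ((real DIM('a) - 2) / 2))
     * bessel_K ((real DIM('a) - 2) / 2) (norm x)"

text \<open>
  The potentials \<open>G * \<mu>\<close> and \<open>G * f\<close> (for \<open>f \<ge> 0\<close>) take values in \<open>[0, \<infinity>]\<close>, so that a divergent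
  integral is \<open>\<infinity>\<close>, not a default value.
\<close>

definition potential :: "'a::euclidean_space measure \<Rightarrow> 'a \<Rightarrow> ennreal" where
  "potential \<mu> x = (\<integral>\<^sup>+ y. ennreal (fund_sol (x - y)) \<partial>\<mu>)"

definition potential_fun :: "('a::euclidean_space \<Rightarrow> real) \<Rightarrow> 'a \<Rightarrow> ennreal" where
  "potential_fun f x = (\<integral>\<^sup>+ y. ennreal (fund_sol (x - y) * f y) \<partial>lebesgue)"

text \<open>
  Borel measures on a Euclidean space that are finite on compact sets; inner and outer
  regularity are then automatic.
\<close>

definition radon_measure :: "'a::euclidean_space measure \<Rightarrow> bool" where
  "radon_measure \<mu> \<longleftrightarrow> sets \<mu> = sets borel \<and> (\<forall>K. compact K \<longrightarrow> emeasure \<mu> K < \<infinity>)"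

definition measure_support :: "'a::euclidean_space measure \<Rightarrow> 'a set" where
  "measure_support \<mu> = {x. \<forall>r>0. emeasure \<mu> (ball x r) > 0}"

definition C0_space :: "('a::euclidean_space \<Rightarrow> real) set" where
  "C0_space = {f. continuous_on UNIV f \<and> (f \<longlongrightarrow> 0) at_infinity}"

text \<open>
  Elements of \<open>L\<^sup>q\<close> are represented by Lebesgue measurable functions. All notions from here on are
  invariant under changes of the functions on Lebesgue null sets; in particular compact support
  is understood up to null sets.
\<close>

definition Lq_space :: "real \<Rightarrow> ('a::euclidean_space \<Rightarrow> real) set" where
  "Lq_space q = {f. f \<in> borel_measurable lebesgue \<and> integrable lebesgue (\<lambda>x. \<bar>f x\<bar> powr q)}"

definition Lqc_space :: "real \<Rightarrow> ('a::euclidean_space \<Rightarrow> real) set" where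
  "Lqc_space q = {f \<in> Lq_space q. \<exists>K. compact K \<and> (AE x in lebesgue. x \<notin> K \<longrightarrow> f x = 0)}"

definition C0_plus_Lqc :: "real \<Rightarrow> ('a::euclidean_space \<Rightarrow> real) set" where
  "C0_plus_Lqc q =
     {u. \<exists>f\<in>C0_space. \<exists>g\<in>Lqc_space q. AE x in lebesgue. u x = f x + g x}"

definition ennreal_in_Lq :: "real \<Rightarrow> ('a::euclidean_space \<Rightarrow> ennreal) \<Rightarrow> bool" where
  "ennreal_in_Lq q h \<longleftrightarrow>
     (AE x in lebesgue. h x < \<infinity>) \<and> (\<lambda>x. enn2real (h x)) \<in> Lq_space q"

text \<open>
  \<open>(C\<^sub>0 + L\<^sup>q\<^sub>c)\<close>-solutions of \<open>- \<Delta>u + u = u\<^sup>p + \<kappa>\<mu>\<close>, \<open>u > 0\<close>, \<open>u(x) \<rightarrow> 0\<close> as \<open>|x| \<rightarrow> \<infinity>\<close>.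
\<close>

definition is_solution ::
    "real \<Rightarrow> real \<Rightarrow> real \<Rightarrow> 'a::euclidean_space measure \<Rightarrow> ('a \<Rightarrow> real) \<Rightarrow> bool" where
  "is_solution p q \<kappa> \<mu> u \<longleftrightarrow>
     u \<in> C0_plus_Lqc q \<and>
     (AE x in lebesgue.
        ennreal (u x) = potential_fun (\<lambda>y. u y powr p) x + ennreal \<kappa> * potential \<mu> x
        \<and> u x > 0)"

definition is_minimal_solution ::
    "real \<Rightarrow> real \<Rightarrow> real \<Rightarrow> 'a::euclidean_space measure \<Rightarrow> ('a \<Rightarrow> real) \<Rightarrow> bool" where
  "is_minimal_solution p q \<kappa> \<mu> u \<longleftrightarrow>
     is_solution p q \<kappa> \<mu> u \<and>
     (\<forall>v. is_solution p q \<kappa> \<mu> v \<longrightarrow> (AE x in lebesgue. u x \<le> v x))"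

text \<open>
  \<open>u(x) = O(g(x))\<close> as \<open>|x| \<rightarrow> \<infinity>\<close> for a function \<open>u\<close> that is determined up to null sets:
  some representative of \<open>u\<close> has this property.
\<close>

definition ae_bigo_at_infinity ::
    "('a::euclidean_space \<Rightarrow> real) \<Rightarrow> ('a \<Rightarrow> real) \<Rightarrow> bool" where
  "ae_bigo_at_infinity u g \<longleftrightarrow>
     (\<exists>w. (AE x in lebesgue. w x = u x) \<and> w \<in> O[at_infinity](g))"

end

theory Submission
  imports Defs
begin

text \<open>
  Write \<open>h = G * \<mu>\<close> and \<open>k(x) = exp \<bar>x\<bar> G(x)\<close>. The function \<open>k\<close> is radially decreasing and \<open>k(x) \<le> C k(2 x)\<close>,
  which gives the three-point inequality \<open>G(x - z) G(z - y) \<le> C G(x - y) (k(x - z) + k(z - y))\<close>. Since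
  \<open>h\<^sup>p\<^sup>-\<^sup>1\<close> lies in \<open>L\<^sup>\<sigma>\<close> for some \<open>\<sigma> > N / 2\<close> and \<open>k\<close> is locally in the dual space, it follows that
  \<open>G * h\<^sup>p \<le> D h\<close>, so \<open>2 \<kappa> h\<close> is a supersolution for small \<open>\<kappa>\<close>. Monotone iteration from \<open>0\<close> yields the
  minimal solution below any supersolution that is locally in \<open>L\<^sup>q\<close> and vanishes at infinity, in particular
  below any solution for a larger \<open>\<kappa>\<close>. Solutions for large \<open>\<kappa>\<close> are excluded by comparing
  \<open>u \<ge> c \<integral>\<^sub>B u\<^sup>p\<close> and \<open>u \<ge> c \<kappa>\<close> on the unit ball \<open>B\<close>. The decay \<open>u = O(G)\<close> is obtained in two steps: first
  \<open>u = O(exp (- \<theta> \<bar>x\<bar>))\<close> with \<open>\<theta> < 1 < p \<theta>\<close>, because \<open>u\<^sup>p\<^sup>-\<^sup>1\<close> is small far out, and then the three-point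
  inequality with the weight \<open>exp (- \<delta> \<bar>x\<bar>)\<close>.
\<close>

section \<open>The kernel\<close>

text \<open>Three features shape the argument. (a) \<open>G\<close> is not comparable at
  \<open>x\<close> and \<open>2 x\<close>; once exp (- |x|) is divided out only powers remain (a
  logarithm at 0 if N = 2), and the triangle inequality restores the exponential. (b)
  \<open>h\<close> may be infinite somewhere and u^p is only locally integrable, so the iteration
  runs in [0, \<infinity>], where it converges without any existence result; finiteness, local
  integrability and vanishing at infinity are inherited afterwards from the supersolution by mere
  comparison, and continuity far out comes last, from the decay. (c) With \<sigma> = q / (p - 1), q
  > N (p - 1) / 2 says that the dual exponent s of \<sigma> satisfies s (N - 2) < N; the strictness
  pays for an arbitrarily small loss in the power bound at 0, a loss that lets N = 2 be treated like
  N > 2. The decay needs two steps because comparison with exp (- \<theta> |x|) costs the integral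
  of G exp (\<theta> |x|), which is finite for \<theta> < 1 but not for \<theta> = 1. As p > 1, some
  \<theta> < 1 still has p \<theta> > 1. The threshold is the supremum of all \<kappa> > 0 that
  admit a solution.\<close>

definition bessel_integrand :: "real \<Rightarrow> real \<Rightarrow> real \<Rightarrow> real" where
  "bessel_integrand \<nu> r t = indicator {0..} t * (exp (- r * cosh t) * cosh (\<nu> * t))"

section \<open>Integral estimates for the modified Bessel function\<close>

lemma bessel_integrand_nonneg: "bessel_integrand \<nu> r t \<ge> 0"
  by (simp add: bessel_integrand_def)

lemma bessel_integrand_measurable [measurable]:
  "(\<lambda>t. bessel_integrand \<nu> r t) \<in> borel_measurable borel"
  unfolding bessel_integrand_def cosh_def by measurable

lemma bessel_K_eq: "bessel_K \<nu> r = (\<integral>t. bessel_integrand \<nu> r t \<partial>lborel)"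
  unfolding bessel_K_def bessel_integrand_def set_lebesgue_integral_def by simp

text \<open>This is \<open>x / a \<le> exp (x / a)\<close> raised to the power \<open>a\<close>. It
  trades exponential decay for a power of any order, both to bound the Bessel function near 0 and to
  absorb polynomial factors.\<close>

lemma exp_minus_le_powr:
  fixes a x :: real
  assumes "a > 0" "x > 0"
  shows "exp (- x) \<le> a powr a * x powr (- a)"
proof -
  have "x / a \<le> exp (x / a)"
    using exp_ge_add_one_self[of "x / a"] by linarith
  then have "(x / a) powr a \<le> exp (x / a) powr a"
    using assms by (intro powr_mono2) auto
  also have "\<dots> = exp x"
    using assms by (simp add: exp_powr_real)
  finally have "(x / a) powr a \<le> exp x" .
  then have "exp (- x) \<le> inverse ((x / a) powr a)"
    using assms by (simp add: exp_minus le_imp_inverse_le)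
  also have "\<dots> = a powr a * x powr (- a)"
    using assms by (simp add: powr_divide powr_minus field_simps)
  finally show ?thesis .
qed

lemma cosh_le_exp: "x \<ge> 0 \<Longrightarrow> cosh x \<le> exp (x::real)"
  by (simp add: cosh_def)

text \<open>From \<open>cosh t \<ge> exp t / 2\<close> the integrand decays doubly exponentially in
  \<open>t\<close>; giving this up for the power \<open>a\<close> leaves exp (- a t), which beats
  \<open>cosh (\<nu> * t)\<close> as soon as \<open>a > \<nu>\<close>.\<close>

lemma bessel_integrand_le:
  assumes "a > 0" "r > 0" "\<nu> \<ge> 0"
  shows "bessel_integrand \<nu> r t \<le> a powr a * (r / 2) powr (- a) * (indicator {0..} t * exp (- (a - \<nu>) * t))"
proof (cases "t \<ge> 0")
  case True
  have "r / 2 * exp t \<le> r * cosh t"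
    using \<open>r > 0\<close> by (simp add: cosh_def field_simps)
  then have "exp (- r * cosh t) \<le> exp (- (r / 2 * exp t))"
    by simp
  also have "\<dots> \<le> a powr a * (r / 2 * exp t) powr (- a)"
    using assms by (intro exp_minus_le_powr) auto
  also have "(r / 2 * exp t) powr (- a) = (r / 2) powr (- a) * exp (- a * t)"
    using powr_mult[of "r / 2" "exp t" "- a"] assms by (simp add: exp_powr_real mult.commute)
  finally have "exp (- r * cosh t) \<le> a powr a * ((r / 2) powr (- a) * exp (- a * t))" .
  moreover have "cosh (\<nu> * t) \<le> exp (\<nu> * t)"
    using True assms by (intro cosh_le_exp) simp
  ultimately have "exp (- r * cosh t) * cosh (\<nu> * t) \<le>
      a powr a * ((r / 2) powr (- a) * exp (- a * t)) * exp (\<nu> * t)"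
    by (intro mult_mono) auto
  moreover have "exp (- (a - \<nu>) * t) = exp (- a * t) * exp (\<nu> * t)"
    by (simp add: algebra_simps flip: exp_add)
  ultimately show ?thesis
    using True by (simp add: bessel_integrand_def mult_ac)
qed (simp add: bessel_integrand_def)

lemma integral_exp_minus_Ici:
  assumes "c > 0"
  shows "integrable lborel (\<lambda>t. indicator {0..} t * exp (- c * t) :: real)"
    and "(\<integral>t. indicator {0..} t * exp (- c * t) \<partial>lborel) = (1 / c :: real)"
proof -
  let ?f = "\<lambda>t. indicator {0..} t * exp (- c * t) :: real"
  have "((\<lambda>t. exp (- c * t)) has_integral exp (- c * 0) / c) {0..}"
    by (rule has_integral_exp_minus_to_infinity[OF assms])
  then have "((\<lambda>t. if t \<in> {0..} then exp (- c * t) else 0) has_integral 1 / c) UNIV"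
    by (subst has_integral_restrict_UNIV) simp
  moreover have "(\<lambda>t. if t \<in> {0..} then exp (- c * t) else 0) = ?f"
    by (auto simp: indicator_def)
  ultimately have "(?f has_integral 1 / c) UNIV"
    by simp
  then have "(\<integral>\<^sup>+t. ennreal (?f t) \<partial>lborel) = ennreal (1 / c)"
    by (intro nn_integral_has_integral_lborel) auto
  then show "integrable lborel ?f" "(\<integral>t. ?f t \<partial>lborel) = 1 / c"
    using assms by (auto intro!: integrableI_nonneg simp: integral_eq_nn_integral)
qed

lemma bessel_integrand_integrable:
  assumes "r > 0" "\<nu> \<ge> 0"
  shows "integrable lborel (bessel_integrand \<nu> r)"
proof (rule Bochner_Integration.integrable_bound)
  define a where "a = \<nu> + 1"
  show "integrable lborel (\<lambda>t. a powr a * (r / 2) powr (- a) * (indicator {0..} t * exp (- 1 * t)) :: real)"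
    by (intro integrable_mult_right integral_exp_minus_Ici(1)) simp
  show "AE t in lborel. norm (bessel_integrand \<nu> r t) \<le>
      norm (a powr a * (r / 2) powr (- a) * (indicator {0..} t * exp (- 1 * t)) :: real)"
    using bessel_integrand_le[of a r \<nu>] bessel_integrand_nonneg[of \<nu> r] assms
    by (auto simp: a_def)
qed (simp add: bessel_integrand_measurable)

lemma nn_integral_bessel:
  assumes "r > 0" "\<nu> \<ge> 0"
  shows "(\<integral>\<^sup>+t. ennreal (bessel_integrand \<nu> r t) \<partial>lborel) = ennreal (bessel_K \<nu> r)"
  unfolding bessel_K_eq
  by (rule nn_integral_eq_integral[OF bessel_integrand_integrable[OF assms]])
    (simp add: bessel_integrand_nonneg)

text \<open>The true singularity is of order \<open>\<nu>\<close> for \<open>\<nu> > 0\<close> and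
  logarithmic for \<open>\<nu> = 0\<close>. An exponent \<open>a\<close> strictly above
  \<open>\<nu>\<close> covers both cases at once.\<close>

lemma bessel_K_le_powr:
  assumes "r > 0" "\<nu> \<ge> 0" "a > \<nu>"
  shows "bessel_K \<nu> r \<le> (a powr a * 2 powr a / (a - \<nu>)) * r powr (- a)"
proof -
  have "bessel_K \<nu> r \<le> (\<integral>t. a powr a * (r / 2) powr (- a) * (indicator {0..} t * exp (- (a - \<nu>) * t)) \<partial>lborel)"
    unfolding bessel_K_eq using assms
    by (intro integral_mono bessel_integrand_integrable integrable_mult_right
        integral_exp_minus_Ici(1) bessel_integrand_le) auto
  also have "\<dots> = a powr a * (r / 2) powr (- a) * (1 / (a - \<nu>))"
    using assms by (subst integral_mult_right_zero, subst integral_exp_minus_Ici(2)) auto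
  also have "\<dots> = (a powr a * 2 powr a / (a - \<nu>)) * r powr (- a)"
    using assms by (simp add: powr_divide powr_minus field_simps)
  finally show ?thesis .
qed

text \<open>Only the range \<open>0 \<le> t \<le> s\<close> of the integral is kept. For small
  \<open>s\<close> the rate \<open>cosh s\<close> is as close to 1 as desired.\<close>

lemma bessel_K_ge_exp:
  assumes "r > 0" "\<nu> \<ge> 0" "s > 0"
  shows "s * exp (- r * cosh s) \<le> bessel_K \<nu> r"
proof -
  have "(\<integral>t. indicator {0..s} t * exp (- r * cosh s) \<partial>lborel) \<le> bessel_K \<nu> r"
    unfolding bessel_K_eq
  proof (intro integral_mono bessel_integrand_integrable assms)
    show "integrable lborel (\<lambda>t. indicator {0..s} t * exp (- r * cosh s) :: real)"
      by (intro integrable_mult_left integrable_real_indicator) (auto simp: emeasure_lborel_Icc_eq)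
    show "indicator {0..s} t * exp (- r * cosh s) \<le> bessel_integrand \<nu> r t" for t
    proof (cases "0 \<le> t \<and> t \<le> s")
      case True
      have "exp (- r * cosh s) * 1 \<le> exp (- r * cosh t) * cosh (\<nu> * t)"
        using True assms cosh_real_nonneg_le_iff[of t s] cosh_real_ge_1 by (intro mult_mono) auto
      then show ?thesis
        using True by (simp add: bessel_integrand_def)
    qed (auto simp: bessel_integrand_nonneg)
  qed
  then show ?thesis
    using assms by simp
qed

lemma bessel_K_pos: "r > 0 \<Longrightarrow> \<nu> \<ge> 0 \<Longrightarrow> bessel_K \<nu> r > 0"
  using bessel_K_ge_exp[of r \<nu> 1] by (smt (verit) exp_gt_zero)

text \<open>The factor exp r turns the exponent into \<open>- r * (cosh t - 1)\<close>, which
  decreases in \<open>r\<close> since \<open>cosh t \<ge> 1\<close>.\<close>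

lemma exp_bessel_K_antimono:
  assumes "0 < r" "r \<le> s" "\<nu> \<ge> 0"
  shows "exp s * bessel_K \<nu> s \<le> exp r * bessel_K \<nu> r"
proof -
  have "exp s * bessel_integrand \<nu> s t \<le> exp r * bessel_integrand \<nu> r t" for t
  proof (cases "t \<ge> 0")
    case True
    have "0 \<le> (s - r) * (cosh t - 1)"
      using assms by (intro mult_nonneg_nonneg) (auto simp: cosh_real_ge_1)
    then have "s - s * cosh t \<le> r - r * cosh t"
      by (simp add: algebra_simps)
    then have "exp s * exp (- s * cosh t) \<le> exp r * exp (- r * cosh t)"
      by (simp flip: exp_add)
    then have "exp s * exp (- s * cosh t) * cosh (\<nu> * t) \<le> exp r * exp (- r * cosh t) * cosh (\<nu> * t)"
      by (rule mult_right_mono) simp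
    then show ?thesis
      using True by (simp add: bessel_integrand_def mult.assoc)
  qed (simp add: bessel_integrand_def)
  then show ?thesis
    unfolding bessel_K_eq using assms
    by (subst (1 2) integral_mult_right_zero[symmetric], intro integral_mono)
      (auto intro!: bessel_integrand_integrable)
qed

text \<open>
  For \<open>t \<le> b\<close> substitute \<open>t = 2 t'\<close>, for \<open>t \<ge> b\<close> substitute \<open>t = t' + b\<close>, where \<open>cosh b \<ge> 2\<close>.
\<close>

lemma exp_bessel_K_doubling:
  assumes "\<nu> \<ge> 0"
  shows "\<exists>C\<ge>1. \<forall>r>0. exp r * bessel_K \<nu> r \<le> C * (exp (2 * r) * bessel_K \<nu> (2 * r))"
proof -
  \<comment> \<open>Here cosh b = 17 / 8. The value 2 is what the shifted part needs:
    \<open>cosh (b + t) \<ge> cosh b * cosh t\<close>.\<close>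
  define b :: real where "b = ln 4"
  have b: "b > 0" "cosh b \<ge> 2"
    by (auto simp: b_def cosh_def exp_minus)
  \<comment> \<open>The first summand belongs to \<open>t \<le> b\<close>, its 2 being the Jacobian
    of the dilation; the second belongs to the translation by \<open>b\<close>.\<close>
  define C where "C = 2 * exp (\<nu> * b) + exp (\<nu> * b)"
  have "C \<ge> 1"
    using b assms one_le_exp_iff[of "\<nu> * b"] mult_nonneg_nonneg[of \<nu> b]
    unfolding C_def by linarith
  have main: "exp r * bessel_K \<nu> r \<le> C * (exp (2 * r) * bessel_K \<nu> (2 * r))" if "r > 0" for r
  proof -
    let ?f = "\<lambda>t. exp r * bessel_integrand \<nu> r t"
    let ?g = "\<lambda>t. exp (2 * r) * bessel_integrand \<nu> (2 * r) t"
    let ?G = "exp (2 * r) * bessel_K \<nu> (2 * r)"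
    have small: "indicator {..b} (2 * t) * ?f (2 * t) \<le> exp (\<nu> * b) * ?g t" for t
    proof (cases "0 \<le> t \<and> 2 * t \<le> b")
      case True
      \<comment> \<open>With the exponential factors included, the exponents to compare are
        \<open>- r * (cosh (2 * t) - 1)\<close> and \<open>- 2 * r * (cosh t - 1)\<close>.\<close>
      have c1: "cosh (2 * t) - 1 \<ge> 2 * (cosh t - 1)"
      proof -
        have "cosh (2 * t) - 1 - 2 * (cosh t - 1) = 2 * cosh t * (cosh t - 1)"
          using cosh_double_cosh[of t] by (simp add: power2_eq_square algebra_simps)
        also have "\<dots> \<ge> 0"
          by (simp add: cosh_real_ge_1)
        finally show ?thesis by simp
      qed
      have "r + - r * cosh (2 * t) \<le> 2 * r + - (2 * r) * cosh t"
        using mult_left_mono[OF c1, of r] \<open>r > 0\<close> by (simp add: algebra_simps)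
      then have "exp r * exp (- r * cosh (2 * t)) \<le> exp (2 * r) * exp (- (2 * r) * cosh t)"
        unfolding exp_add[symmetric] exp_le_cancel_iff .
      moreover have "cosh (\<nu> * (2 * t)) \<le> exp (\<nu> * b)"
        using True assms mult_left_mono[of "2 * t" b \<nu>]
        by (intro order_trans[OF cosh_le_exp]) auto
      then have "cosh (\<nu> * (2 * t)) \<le> exp (\<nu> * b) * cosh (\<nu> * t)"
        using mult_left_mono[OF cosh_real_ge_1[of "\<nu> * t"] exp_ge_zero[of "\<nu> * b"]] by linarith
      ultimately have "exp r * exp (- r * cosh (2 * t)) * cosh (\<nu> * (2 * t)) \<le>
          exp (2 * r) * exp (- (2 * r) * cosh t) * (exp (\<nu> * b) * cosh (\<nu> * t))"
        by (rule mult_mono) auto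
      then show ?thesis
        using True by (simp add: bessel_integrand_def algebra_simps)
    next
      case False
      then have z: "indicator {..b} (2 * t) * ?f (2 * t) = 0"
        by (auto simp: bessel_integrand_def indicator_def)
      show ?thesis
        unfolding z by (simp add: bessel_integrand_nonneg)
    qed
    have large: "indicator {b..} (b + t) * ?f (b + t) \<le> exp (\<nu> * b) * ?g t" for t
    proof (cases "0 \<le> t")
      case True
      have c1: "cosh (b + t) \<ge> 2 * cosh t - 1"
      proof -
        have "0 \<le> sinh b * sinh t"
          using True b by simp
        moreover have "2 * cosh t \<le> cosh b * cosh t"
          using b by (intro mult_right_mono) auto
        ultimately show ?thesis
          unfolding cosh_add by linarith
      qed
      have "r + - r * cosh (b + t) \<le> 2 * r + - (2 * r) * cosh t"
        using mult_left_mono[OF c1, of r] \<open>r > 0\<close> by (simp add: algebra_simps)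
      then have "exp r * exp (- r * cosh (b + t)) \<le> exp (2 * r) * exp (- (2 * r) * cosh t)"
        unfolding exp_add[symmetric] exp_le_cancel_iff .
      moreover have "cosh (\<nu> * (b + t)) \<le> exp (\<nu> * b) * cosh (\<nu> * t)"
      proof -
        have "0 \<le> \<nu> * b" using assms b by simp
        then have "exp (- (\<nu> * b)) * exp (- (\<nu> * t)) \<le> exp (\<nu> * b) * exp (- (\<nu> * t))"
          by (intro mult_right_mono) auto
        moreover have "cosh (\<nu> * (b + t)) = (exp (\<nu> * b) * exp (\<nu> * t) + exp (- (\<nu> * b)) * exp (- (\<nu> * t))) / 2"
          by (simp add: cosh_def distrib_left flip: exp_add)
        ultimately show ?thesis
          by (simp add: cosh_def distrib_left)
      qed
      ultimately have "exp r * exp (- r * cosh (b + t)) * cosh (\<nu> * (b + t)) \<le>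
          exp (2 * r) * exp (- (2 * r) * cosh t) * (exp (\<nu> * b) * cosh (\<nu> * t))"
        by (rule mult_mono) auto
      then show ?thesis
        using True b by (simp add: bessel_integrand_def algebra_simps)
    next
      case False
      then show ?thesis
        by (auto simp: bessel_integrand_def indicator_def)
    qed
    have fin: "(\<integral>\<^sup>+t. ennreal (c * (exp s * bessel_integrand \<nu> s t)) \<partial>lborel) = ennreal (c * (exp s * bessel_K \<nu> s))"
      if "c \<ge> 0" "s > 0" for c s
    proof -
      have "(\<integral>\<^sup>+t. ennreal (c * (exp s * bessel_integrand \<nu> s t)) \<partial>lborel) =
        (\<integral>\<^sup>+t. ennreal (c * exp s) * ennreal (bessel_integrand \<nu> s t) \<partial>lborel)"
        using \<open>c \<ge> 0\<close> by (intro nn_integral_cong, subst ennreal_mult[symmetric]) (auto simp: bessel_integrand_nonneg mult.assoc)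
      also have "\<dots> = ennreal (c * exp s) * ennreal (bessel_K \<nu> s)"
        using that assms by (simp add: nn_integral_cmult nn_integral_bessel)
      also have "\<dots> = ennreal (c * (exp s * bessel_K \<nu> s))"
        using \<open>c \<ge> 0\<close> that assms bessel_K_pos[of s \<nu>] by (subst ennreal_mult[symmetric]) (auto simp: mult.assoc)
      finally show ?thesis .
    qed
    have "ennreal (exp r * bessel_K \<nu> r) = (\<integral>\<^sup>+t. ennreal (?f t) \<partial>lborel)"
      using fin[of 1 r] \<open>r > 0\<close> by simp
    also have "\<dots> \<le> (\<integral>\<^sup>+t. ennreal (indicator {..b} t * ?f t) + ennreal (indicator {b..} t * ?f t) \<partial>lborel)"
      by (intro nn_integral_mono) (auto simp: indicator_def bessel_integrand_nonneg)
    also have "\<dots> = (\<integral>\<^sup>+t. ennreal (indicator {..b} t * ?f t) \<partial>lborel) + (\<integral>\<^sup>+t. ennreal (indicator {b..} t * ?f t) \<partial>lborel)"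
      by (intro nn_integral_add) auto
    also have "(\<integral>\<^sup>+t. ennreal (indicator {..b} t * ?f t) \<partial>lborel) = 2 * (\<integral>\<^sup>+t. ennreal (indicator {..b} (2 * t) * ?f (2 * t)) \<partial>lborel)"
      by (subst nn_integral_real_affine[where c = 2 and t = 0]) auto
    also have "(\<integral>\<^sup>+t. ennreal (indicator {..b} (2 * t) * ?f (2 * t)) \<partial>lborel) \<le> (\<integral>\<^sup>+t. ennreal (exp (\<nu> * b) * ?g t) \<partial>lborel)"
      by (intro nn_integral_mono ennreal_leI small)
    also have "\<dots> = ennreal (exp (\<nu> * b) * ?G)"
      using \<open>r > 0\<close> by (intro fin) auto
    also have "(\<integral>\<^sup>+t. ennreal (indicator {b..} t * ?f t) \<partial>lborel) = (\<integral>\<^sup>+t. ennreal (indicator {b..} (b + t) * ?f (b + t)) \<partial>lborel)"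
      by (subst nn_integral_real_affine[where c = 1 and t = b]) auto
    also have "\<dots> \<le> (\<integral>\<^sup>+t. ennreal (exp (\<nu> * b) * ?g t) \<partial>lborel)"
      by (intro nn_integral_mono ennreal_leI large)
    also have "\<dots> = ennreal (exp (\<nu> * b) * ?G)"
      using \<open>r > 0\<close> by (intro fin) auto
    also have "2 * ennreal (exp (\<nu> * b) * ?G) + ennreal (exp (\<nu> * b) * ?G) = ennreal (C * ?G)"
    proof -
      have "?G \<ge> 0"
        using bessel_K_pos[of "2 * r" \<nu>] \<open>r > 0\<close> assms by simp
      then have "ennreal 2 * ennreal (exp (\<nu> * b) * ?G) + ennreal (exp (\<nu> * b) * ?G) =
          ennreal (2 * (exp (\<nu> * b) * ?G) + exp (\<nu> * b) * ?G)"
        by (subst ennreal_mult[symmetric], simp, simp, subst ennreal_plus[symmetric]) auto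
      then show ?thesis
        by (simp add: C_def algebra_simps)
    qed
    finally have "ennreal (exp r * bessel_K \<nu> r) \<le> ennreal (C * ?G)"
      by (simp add: add_mono mult_left_mono)
    moreover have "C * ?G \<ge> 0"
      using bessel_K_pos[of "2 * r" \<nu>] \<open>r > 0\<close> assms \<open>C \<ge> 1\<close> by simp
    ultimately show ?thesis
      by (simp add: ennreal_le_iff)
  qed
  show ?thesis
    using main \<open>C \<ge> 1\<close> by blast
qed

text \<open>Dominated convergence: the integrand decreases in the argument, so near \<open>r\<close>
  it stays below its value at \<open>r / 2\<close>.\<close>

lemma bessel_K_continuous:
  assumes "\<nu> \<ge> 0"
  shows "continuous_on {0<..} (bessel_K \<nu>)"
proof (rule continuous_on_sequentiallyI)
  fix X :: "nat \<Rightarrow> real" and r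
  assume X: "\<forall>n. X n \<in> {0<..}" "r \<in> {0<..}" "X \<longlonglongrightarrow> r"
  then have "eventually (\<lambda>n. X n > r / 2) sequentially"
    by (intro order_tendstoD) auto
  then obtain N where N: "\<And>n. n \<ge> N \<Longrightarrow> X n > r / 2"
    by (auto simp: eventually_sequentially)
  have "(\<lambda>n. \<integral>t. bessel_integrand \<nu> (X (n + N)) t \<partial>lborel) \<longlonglongrightarrow> (\<integral>t. bessel_integrand \<nu> r t \<partial>lborel)"
  proof (rule integral_dominated_convergence[where w = "bessel_integrand \<nu> (r / 2)"])
    show "integrable lborel (bessel_integrand \<nu> (r / 2))"
      using X assms by (intro bessel_integrand_integrable) auto
    have "(\<lambda>n. bessel_integrand \<nu> (X (n + N)) t) \<longlonglongrightarrow> bessel_integrand \<nu> r t" for t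
      unfolding bessel_integrand_def
      by (intro tendsto_intros LIMSEQ_ignore_initial_segment X)
    then show "AE t in lborel. (\<lambda>n. bessel_integrand \<nu> (X (n + N)) t) \<longlonglongrightarrow> bessel_integrand \<nu> r t"
      by simp
    have "norm (bessel_integrand \<nu> (X (n + N)) t) \<le> bessel_integrand \<nu> (r / 2) t" for n t
      using N[of "n + N"] by (simp add: bessel_integrand_nonneg) (simp add: bessel_integrand_def indicator_def mult_right_mono)
    then show "AE t in lborel. norm (bessel_integrand \<nu> (X (n + N)) t) \<le> bessel_integrand \<nu> (r / 2) t" for n
      by simp
  qed (auto simp: bessel_integrand_measurable)
  then show "(\<lambda>n. bessel_K \<nu> (X n)) \<longlonglongrightarrow> bessel_K \<nu> r"
    unfolding bessel_K_eq[symmetric] by (rule LIMSEQ_offset)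
qed

section \<open>Pointwise estimates for the fundamental solution\<close>

lemma fund_sol_0 [simp]: "fund_sol 0 = 0"
  \<comment> \<open>A default value: \<open>0 powr a = 0\<close> for every \<open>a\<close>, also
    for the exponent 0 that occurs when N = 2.\<close>
  by (simp add: fund_sol_def)

lemma fund_sol_minus_commute: "fund_sol (x - y) = fund_sol (y - x)"
  by (simp add: fund_sol_def norm_minus_commute)

lemma fund_sol_pos:
  fixes x :: "'a::euclidean_space"
  assumes "DIM('a) \<ge> 2" "x \<noteq> 0"
  shows "fund_sol x > 0"
  using assms by (auto simp: fund_sol_def intro!: mult_pos_pos bessel_K_pos)

lemma fund_sol_nonneg:
  fixes x :: "'a::euclidean_space"
  assumes "DIM('a) \<ge> 2"
  shows "fund_sol x \<ge> 0"
  using fund_sol_pos[OF assms, of x] by (cases "x = 0") auto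

lemma continuous_on_fund_sol:
  assumes "DIM('a::euclidean_space) \<ge> 2"
  shows "continuous_on (- {0::'a}) fund_sol"
  unfolding fund_sol_def using assms
  by (intro continuous_intros continuous_on_compose2[OF bessel_K_continuous]) auto

lemma fund_sol_measurable:
  assumes "DIM('a::euclidean_space) \<ge> 2"
  shows "(fund_sol :: 'a \<Rightarrow> real) \<in> borel_measurable borel"
proof -
  have "(\<lambda>x::'a. indicator (- {0}) x *\<^sub>R fund_sol x) \<in> borel_measurable borel"
    using continuous_on_fund_sol[OF assms]
    by (intro borel_measurable_continuous_on_indicator) auto
  moreover have "(\<lambda>x::'a. indicator (- {0}) x *\<^sub>R fund_sol x) = fund_sol"
    by (rule ext) (auto simp: indicator_def)
  ultimately show ?thesis
    by simp
qed

text \<open>The function \<open>k\<close> of the overview.\<close>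

definition fund_sol_exp :: "'a::euclidean_space \<Rightarrow> real" where
  "fund_sol_exp x = exp (norm x) * fund_sol x"

lemma fund_sol_exp_nonneg:
  fixes x :: "'a::euclidean_space"
  assumes "DIM('a) \<ge> 2"
  shows "fund_sol_exp x \<ge> 0"
  using fund_sol_nonneg[OF assms, of x] by (simp add: fund_sol_exp_def)

lemma fund_sol_exp_measurable:
  assumes "DIM('a::euclidean_space) \<ge> 2"
  shows "(fund_sol_exp :: 'a \<Rightarrow> real) \<in> borel_measurable borel"
  using fund_sol_measurable[OF assms] unfolding fund_sol_exp_def by measurable

lemma fund_sol_eq: "fund_sol x = exp (- norm x) * fund_sol_exp x"
  by (simp add: fund_sol_exp_def exp_minus)

lemma fund_sol_exp_antimono:
  fixes x y :: "'a::euclidean_space"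
  assumes "DIM('a) \<ge> 2" "x \<noteq> 0" "norm x \<le> norm y"
  shows "fund_sol_exp y \<le> fund_sol_exp x"
proof -
  let ?\<nu> = "(real DIM('a) - 2) / 2"
  have "norm y powr (- ?\<nu>) * (exp (norm y) * bessel_K ?\<nu> (norm y)) \<le>
      norm x powr (- ?\<nu>) * (exp (norm x) * bessel_K ?\<nu> (norm x))"
  proof (rule mult_mono)
    show "exp (norm y) * bessel_K ?\<nu> (norm y) \<le> exp (norm x) * bessel_K ?\<nu> (norm x)"
      using assms by (intro exp_bessel_K_antimono) auto
    have "y \<noteq> 0" using assms by auto
    then show "0 \<le> exp (norm y) * bessel_K ?\<nu> (norm y)"
      using bessel_K_pos[of "norm y" ?\<nu>] assms by simp
    show "norm y powr (- ?\<nu>) \<le> norm x powr (- ?\<nu>)"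
      using assms by (intro powr_mono2') auto
  qed (use assms in auto)
  then have "(2 * pi) powr (- (real DIM('a) / 2)) * (norm y powr (- ?\<nu>) * (exp (norm y) * bessel_K ?\<nu> (norm y))) \<le>
      (2 * pi) powr (- (real DIM('a) / 2)) * (norm x powr (- ?\<nu>) * (exp (norm x) * bessel_K ?\<nu> (norm x)))"
    by (rule mult_left_mono) simp
  then show ?thesis
    by (simp add: fund_sol_exp_def fund_sol_def mult_ac)
qed

lemma fund_sol_exp_comparable:
  assumes "DIM('a::euclidean_space) \<ge> 2"
  shows "\<exists>C\<ge>1. \<forall>(x::'a) (y::'a). y \<noteq> 0 \<longrightarrow> norm y \<le> 2 * norm x \<longrightarrow> fund_sol_exp x \<le> C * fund_sol_exp y"
proof -
  let ?\<nu> = "(real DIM('a) - 2) / 2"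
  have "?\<nu> \<ge> 0" using assms by simp
  then obtain C where C: "C \<ge> 1"
    "\<And>r. r > 0 \<Longrightarrow> exp r * bessel_K ?\<nu> r \<le> C * (exp (2 * r) * bessel_K ?\<nu> (2 * r))"
    using exp_bessel_K_doubling[of ?\<nu>] by blast
  define D where "D = 2 powr ?\<nu> * C"
  have "D \<ge> 1"
    using C(1) \<open>?\<nu> \<ge> 0\<close> mult_mono[of 1 "2 powr ?\<nu>" 1 C] by (simp add: D_def ge_one_powr_ge_zero)
  moreover have "fund_sol_exp x \<le> D * fund_sol_exp y"
    if "y \<noteq> 0" "norm y \<le> 2 * norm x" for x y :: 'a
  proof -
    \<comment> \<open>Monotonicity leads from \<open>x\<close> to the point \<open>y / 2\<close>,
      which is not longer than \<open>x\<close>; one doubling leads from there to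
      \<open>y\<close>.\<close>
    define z where "z = y /\<^sub>R 2"
    have z: "z \<noteq> 0" "norm y = 2 * norm z"
      using that by (auto simp: z_def)
    have "fund_sol_exp x \<le> fund_sol_exp z"
      using that z assms by (intro fund_sol_exp_antimono) auto
    also have "\<dots> = (2 * pi) powr (- (real DIM('a) / 2)) * norm z powr (- ?\<nu>) * (exp (norm z) * bessel_K ?\<nu> (norm z))"
      by (simp add: fund_sol_exp_def fund_sol_def)
    also have "\<dots> \<le> (2 * pi) powr (- (real DIM('a) / 2)) * norm z powr (- ?\<nu>) *
        (C * (exp (norm y) * bessel_K ?\<nu> (norm y)))"
      using C(2)[of "norm z"] z by (intro mult_left_mono) auto
    also have "norm z powr (- ?\<nu>) = 2 powr ?\<nu> * norm y powr (- ?\<nu>)"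
      using z by (simp add: powr_mult powr_minus)
    finally show ?thesis
      by (simp add: fund_sol_exp_def fund_sol_def D_def mult_ac)
  qed
  ultimately show ?thesis by blast
qed

lemma fund_sol_exp_le_powr:
  assumes "DIM('a::euclidean_space) \<ge> 2" "b > real DIM('a) - 2"
  shows "\<exists>C\<ge>0. \<forall>x :: 'a. norm x \<le> 1 \<longrightarrow> fund_sol_exp x \<le> C * norm x powr (- b)"
proof -
  let ?\<nu> = "(real DIM('a) - 2) / 2"
  \<comment> \<open>The power \<open>- ?\<nu>\<close> is already in the definition of
    \<open>fund_sol\<close>, so the Bessel factor has to supply the rest; \<open>a > ?\<nu>\<close>
    is the same as b > N - 2.\<close>
  define a where "a = b - ?\<nu>"
  define c where "c = (2 * pi) powr (- (real DIM('a) / 2))"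
  define D where "D = a powr a * 2 powr a / (a - ?\<nu>)"
  have "?\<nu> \<ge> 0" "a > ?\<nu>" using assms by (auto simp: a_def field_simps)
  then have "D \<ge> 0" by (simp add: D_def)
  show ?thesis
  proof (intro exI[of _ "c * (exp 1 * D)"] conjI allI impI)
    show "0 \<le> c * (exp 1 * D)"
      using \<open>D \<ge> 0\<close> by (simp add: c_def)
    fix x :: 'a assume "norm x \<le> 1"
    show "fund_sol_exp x \<le> c * (exp 1 * D) * norm x powr - b"
    proof (cases "x = 0")
      case False
      have "bessel_K ?\<nu> (norm x) \<le> D * norm x powr (- a)"
        unfolding D_def using False \<open>?\<nu> \<ge> 0\<close> \<open>a > ?\<nu>\<close> by (intro bessel_K_le_powr) auto
      then have "exp (norm x) * bessel_K ?\<nu> (norm x) \<le> exp 1 * (D * norm x powr (- a))"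
        using \<open>norm x \<le> 1\<close> bessel_K_pos[of "norm x" ?\<nu>] False \<open>?\<nu> \<ge> 0\<close> by (intro mult_mono) auto
      then have "c * norm x powr (- ?\<nu>) * (exp (norm x) * bessel_K ?\<nu> (norm x)) \<le>
          c * norm x powr (- ?\<nu>) * (exp 1 * (D * norm x powr (- a)))"
        by (intro mult_left_mono) (auto simp: c_def)
      also have "\<dots> = c * (exp 1 * D) * (norm x powr (- ?\<nu>) * norm x powr (- a))"
        by (simp add: mult_ac)
      also have "norm x powr (- ?\<nu>) * norm x powr (- a) = norm x powr (- b)"
        by (simp add: a_def flip: powr_add)
      finally show ?thesis
        by (simp add: fund_sol_exp_def fund_sol_def c_def mult_ac)
    qed (simp add: fund_sol_exp_def)
  qed
qed

lemma fund_sol_exp_bounded: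
  assumes "DIM('a::euclidean_space) \<ge> 2"
  shows "\<exists>C\<ge>0. \<forall>x :: 'a. norm x \<ge> 1 \<longrightarrow> fund_sol_exp x \<le> C"
proof -
  obtain e :: 'a where e: "e \<in> Basis" using nonempty_Basis by blast
  have "fund_sol_exp x \<le> fund_sol_exp e" if "norm x \<ge> 1" for x :: 'a
    using e that assms by (intro fund_sol_exp_antimono) auto
  moreover have "fund_sol_exp e \<ge> 0"
    by (rule fund_sol_exp_nonneg[OF assms])
  ultimately show ?thesis by blast
qed

text \<open>Half of \<open>\<eta>\<close> is spent on the rate in the lower bound for the Bessel
  function, the other half on absorbing the power of \<open>norm x\<close>.\<close>

lemma fund_sol_ge_exp:
  assumes "DIM('a::euclidean_space) \<ge> 2" "\<eta> > 0"
  shows "\<exists>c>0. \<forall>x :: 'a. norm x \<ge> 1 \<longrightarrow> fund_sol x \<ge> c * exp (- (1 + \<eta>) * norm x)"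
proof -
  let ?\<nu> = "(real DIM('a) - 2) / 2"
  have nu: "?\<nu> \<ge> 0" using assms by simp
  define s where "s = arcosh (1 + \<eta> / 2)"
  have s: "s > 0" "cosh s = 1 + \<eta> / 2"
    using assms by (auto simp: s_def arcosh_real_gt_1_iff cosh_arcosh_real)
  \<comment> \<open>Any positive exponent not below \<open>?\<nu>\<close> would do;
    \<open>?\<nu>\<close> itself is 0 when N = 2.\<close>
  define a where "a = ?\<nu> + 1"
  define A where "A = a powr a * (\<eta> / 2) powr (- a)"
  define c where "c = (2 * pi) powr (- (real DIM('a) / 2)) * s / A"
  have "a > 0" using nu unfolding a_def by linarith
  then have "A > 0" using assms by (simp add: A_def)
  then have "c > 0" using s by (simp add: c_def)
  moreover have "fund_sol x \<ge> c * exp (- (1 + \<eta>) * norm x)" if x: "norm x \<ge> 1" for x :: 'a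
  proof -
    let ?r = "norm x"
    have r: "?r > 0" using x by linarith
    have "exp (- (\<eta> / 2 * ?r)) \<le> a powr a * (\<eta> / 2 * ?r) powr (- a)"
      using \<open>a > 0\<close> assms r by (intro exp_minus_le_powr) auto
    also have "\<dots> = A * ?r powr (- a)"
      using powr_mult[of "\<eta> / 2" ?r "- a"] by (simp add: A_def)
    also have "\<dots> \<le> A * ?r powr (- ?\<nu>)"
      using x \<open>A > 0\<close> by (intro mult_left_mono powr_mono) (auto simp: a_def)
    finally have "exp (- (\<eta> / 2 * ?r)) / A \<le> ?r powr (- ?\<nu>)"
      using \<open>A > 0\<close> by (simp add: pos_divide_le_eq mult.commute)
    moreover have "s * exp (- ?r * cosh s) \<le> bessel_K ?\<nu> ?r"
      using r nu s by (intro bessel_K_ge_exp) auto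
    ultimately have "exp (- (\<eta> / 2 * ?r)) / A * (s * exp (- ?r * cosh s)) \<le>
        ?r powr (- ?\<nu>) * bessel_K ?\<nu> ?r"
      using s by (intro mult_mono) auto
    moreover have "exp (- (1 + \<eta>) * ?r) = exp (- (\<eta> / 2 * ?r)) * exp (- ?r * cosh s)"
      by (simp add: s algebra_simps flip: exp_add)
    ultimately have "s * exp (- (1 + \<eta>) * ?r) / A \<le> ?r powr (- ?\<nu>) * bessel_K ?\<nu> ?r"
      by (simp add: mult_ac)
    then have "(2 * pi) powr (- (real DIM('a) / 2)) * (s * exp (- (1 + \<eta>) * ?r) / A) \<le>
        (2 * pi) powr (- (real DIM('a) / 2)) * (?r powr (- ?\<nu>) * bessel_K ?\<nu> ?r)"
      by (rule mult_left_mono) simp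
    then show ?thesis
      by (simp add: fund_sol_def c_def mult_ac)
  qed
  ultimately show ?thesis by blast
qed

text \<open>
  Either \<open>x - z\<close> or \<open>z - y\<close> is at least half as long as \<open>x - y\<close>; the exponential factors combine
  by the triangle inequality.
\<close>

lemma fund_sol_three_points:
  assumes "DIM('a::euclidean_space) \<ge> 2"
  shows "\<exists>C\<ge>0. \<forall>x y z :: 'a. x \<noteq> y \<longrightarrow>
    fund_sol (x - z) * fund_sol (z - y) \<le> C * fund_sol (x - y) * (fund_sol_exp (x - z) + fund_sol_exp (z - y))"
proof -
  obtain C where C: "C \<ge> 1"
    "\<And>(x::'a) (y::'a). y \<noteq> 0 \<Longrightarrow> norm y \<le> 2 * norm x \<Longrightarrow> fund_sol_exp x \<le> C * fund_sol_exp y"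
    using fund_sol_exp_comparable[OF assms] by blast
  have nn: "fund_sol_exp x \<ge> 0" for x :: 'a
    by (rule fund_sol_exp_nonneg[OF assms])
  have "fund_sol (x - z) * fund_sol (z - y) \<le>
      C * fund_sol (x - y) * (fund_sol_exp (x - z) + fund_sol_exp (z - y))"
    if "x \<noteq> y" for x y z :: 'a
  proof -
    have tri: "norm (x - y) \<le> norm (x - z) + norm (z - y)"
      using norm_triangle_ineq[of "x - z" "z - y"] by simp
    have "fund_sol_exp (x - z) * fund_sol_exp (z - y) \<le>
        C * fund_sol_exp (x - y) * (fund_sol_exp (x - z) + fund_sol_exp (z - y))"
    proof (cases "norm (x - y) \<le> 2 * norm (x - z)")
      case True
      then have "fund_sol_exp (x - z) * fund_sol_exp (z - y) \<le> C * fund_sol_exp (x - y) * fund_sol_exp (z - y)"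
        using that by (intro mult_right_mono[OF C(2)[where x = "x - z" and y = "x - y"] nn]) auto
      also have "\<dots> \<le> C * fund_sol_exp (x - y) * (fund_sol_exp (x - z) + fund_sol_exp (z - y))"
        using C(1) by (intro mult_left_mono) (auto simp: nn)
      finally show ?thesis .
    next
      case False
      then have "fund_sol_exp (x - z) * fund_sol_exp (z - y) \<le> fund_sol_exp (x - z) * (C * fund_sol_exp (x - y))"
        using that tri by (intro mult_left_mono[OF C(2)[where x = "z - y" and y = "x - y"] nn]) auto
      also have "\<dots> = C * fund_sol_exp (x - y) * fund_sol_exp (x - z)"
        by (simp add: mult_ac)
      also have "\<dots> \<le> C * fund_sol_exp (x - y) * (fund_sol_exp (x - z) + fund_sol_exp (z - y))"
        using C(1) by (intro mult_left_mono) (auto simp: nn)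
      finally show ?thesis .
    qed
    moreover have "exp (- norm (x - z)) * exp (- norm (z - y)) \<le> exp (- norm (x - y))"
      using tri by (simp flip: exp_add)
    ultimately have "(exp (- norm (x - z)) * exp (- norm (z - y))) * (fund_sol_exp (x - z) * fund_sol_exp (z - y)) \<le>
        exp (- norm (x - y)) * (C * fund_sol_exp (x - y) * (fund_sol_exp (x - z) + fund_sol_exp (z - y)))"
      using C(1) by - (rule mult_mono, auto intro!: mult_nonneg_nonneg simp: nn)
    then show ?thesis
      by (simp add: fund_sol_eq[of "x - z"] fund_sol_eq[of "z - y"] fund_sol_eq[of "x - y"] mult_ac)
  qed
  moreover have "C \<ge> 0" using C(1) by simp
  ultimately show ?thesis by blast
qed

text \<open>Since \<open>2 * norm y \<le> norm x\<close> gives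
  \<open>norm x \<le> 2 * norm (x - y)\<close>, the doubling property compares the values of
  \<open>k\<close>, and the exponential loses at most \<open>exp (norm y)\<close>. Hence sources in
  a bounded set produce potentials of order \<open>fund_sol x\<close> far away.\<close>

lemma fund_sol_diff_le:
  assumes "DIM('a::euclidean_space) \<ge> 2"
  shows "\<exists>C\<ge>0. \<forall>x y :: 'a. x \<noteq> 0 \<longrightarrow> 2 * norm y \<le> norm x \<longrightarrow> fund_sol (x - y) \<le> C * exp (norm y) * fund_sol x"
proof -
  obtain C where C: "C \<ge> 1"
    "\<And>(x::'a) (y::'a). y \<noteq> 0 \<Longrightarrow> norm y \<le> 2 * norm x \<Longrightarrow> fund_sol_exp x \<le> C * fund_sol_exp y"
    using fund_sol_exp_comparable[OF assms] by blast
  have "fund_sol (x - y) \<le> C * exp (norm y) * fund_sol x" if "x \<noteq> 0" "2 * norm y \<le> norm x" for x y :: 'a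
  proof -
    have tri: "norm x \<le> norm (x - y) + norm y"
      using norm_triangle_ineq[of "x - y" y] by simp
    have "exp (- norm (x - y)) * fund_sol_exp (x - y) \<le> (exp (norm y) * exp (- norm x)) * (C * fund_sol_exp x)"
    proof (rule mult_mono)
      show "exp (- norm (x - y)) \<le> exp (norm y) * exp (- norm x)"
        using tri by (simp flip: exp_add)
      show "fund_sol_exp (x - y) \<le> C * fund_sol_exp x"
        using that tri by (intro C(2)) auto
    qed (auto simp: fund_sol_exp_nonneg[OF assms])
    then show ?thesis
      by (simp add: fund_sol_eq[of "x - y"] fund_sol_eq[of x] mult_ac)
  qed
  moreover have "C \<ge> 0" using C(1) by simp
  ultimately show ?thesis by blast
qed

section \<open>Integrals over the space\<close>

lemma ball_in_borel [measurable]: "ball (c :: 'a::euclidean_space) r \<in> sets borel"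
  by simp

lemma ennreal_le_suminf: "F k \<le> (\<Sum>k. F k)" for F :: "nat \<Rightarrow> ennreal"
  using sum_le_suminf[of F "{k}"] by simp

lemma nn_integral_lborel_reflect:
  fixes f :: "'a::euclidean_space \<Rightarrow> ennreal"
  assumes [measurable]: "f \<in> borel_measurable borel"
  shows "(\<integral>\<^sup>+y. f (x - y) \<partial>lborel) = (\<integral>\<^sup>+y. f y \<partial>lborel)"
proof -
  have "(lborel :: 'a measure) = density (distr lborel borel (\<lambda>y. x + (- 1) *\<^sub>R y)) (\<lambda>_. 1)"
    by (subst lborel_affine[of "- 1" x]) (auto simp: one_ennreal_def[symmetric])
  then have "(\<integral>\<^sup>+y. f y \<partial>lborel) = (\<integral>\<^sup>+y. f y \<partial>density (distr lborel borel (\<lambda>y. x + (- 1) *\<^sub>R y)) (\<lambda>_. 1))"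
    by (rule arg_cong)
  then show ?thesis
    by (simp add: nn_integral_density nn_integral_distr)
qed

text \<open>A substitute for polar coordinates: \<open>f\<close> is dominated off the origin by a
  sum of multiples of indicators of balls. Shrinking radii handle singularities at 0, growing radii
  handle decay at infinity.\<close>

lemma nn_integral_finite_if_le_balls:
  fixes f :: "'a::euclidean_space \<Rightarrow> real" and a r :: "nat \<Rightarrow> real"
  assumes le: "\<And>x. x \<noteq> 0 \<Longrightarrow> \<exists>k. (x \<in> ball 0 (r k) \<and> f x \<le> a k) \<or> f x \<le> 0"
    and nn: "\<And>k. a k \<ge> 0" "\<And>k. r k \<ge> 0"
    and sm: "summable (\<lambda>k. a k * r k ^ DIM('a))"
  shows "(\<integral>\<^sup>+x. ennreal (f x) \<partial>lborel) < \<infinity>"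
proof -
  let ?c = "unit_ball_vol (real DIM('a))"
  have "(\<integral>\<^sup>+x. ennreal (f x) \<partial>lborel) \<le>
      (\<integral>\<^sup>+x. (\<Sum>k. ennreal (a k) * indicator (ball 0 (r k)) x) \<partial>(lborel :: 'a measure))"
  proof (rule nn_integral_mono_AE)
    have "ennreal (f x) \<le> (\<Sum>k. ennreal (a k) * indicator (ball 0 (r k)) x)" if "x \<noteq> 0" for x
    proof -
      obtain k where k: "(x \<in> ball 0 (r k) \<and> f x \<le> a k) \<or> f x \<le> 0"
        using le[OF \<open>x \<noteq> 0\<close>] by blast
      have "ennreal (f x) \<le> ennreal (a k) * indicator (ball 0 (r k)) x"
        using k by (auto simp: indicator_def ennreal_leI ennreal_neg)
      also have "\<dots> \<le> (\<Sum>k. ennreal (a k) * indicator (ball 0 (r k)) x)"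
        by (rule ennreal_le_suminf)
      finally show ?thesis .
    qed
    then show "AE x in lborel. ennreal (f x) \<le> (\<Sum>k. ennreal (a k) * indicator (ball 0 (r k)) x)"
      using AE_lborel_singleton[of "0::'a"] by auto
  qed
  also have "\<dots> = (\<Sum>k. \<integral>\<^sup>+x. ennreal (a k) * indicator (ball 0 (r k)) x \<partial>(lborel :: 'a measure))"
    by (rule nn_integral_suminf) measurable
  also have "\<dots> = (\<Sum>k. ennreal (?c * (a k * r k ^ DIM('a))))"
    using nn by (intro suminf_cong) (simp add: nn_integral_cmult_indicator emeasure_ball mult_ac flip: ennreal_mult)
  also have "\<dots> < \<infinity>"
  proof -
    have "(\<Sum>k. ennreal (?c * (a k * r k ^ DIM('a)))) \<noteq> top"
      using nn by (intro ennreal_suminf_neq_top summable_mult sm mult_nonneg_nonneg) auto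
    then show ?thesis
      by (simp add: less_top)
  qed
  finally show ?thesis .
qed

lemma ex_half_power_between:
  fixes t :: real
  assumes "0 < t" "t < 1"
  shows "\<exists>k. (1 / 2) ^ Suc k \<le> t \<and> t < (1 / 2) ^ k"
proof -
  obtain n where "(1 / 2) ^ n < t"
    using real_arch_pow_inv[of t "1 / 2"] assms by auto
  then have ex: "\<exists>n. (1 / 2) ^ n \<le> t" by (intro exI[of _ n]) simp
  define m where "m = (LEAST n. (1 / 2) ^ n \<le> t)"
  have m: "(1 / 2) ^ m \<le> t"
    unfolding m_def by (rule LeastI_ex[OF ex])
  have "m \<noteq> 0" using m assms by (intro notI) simp
  then obtain k where k: "m = Suc k" using not0_implies_Suc by blast
  have "\<not> (1 / 2) ^ k \<le> t"
    using not_less_Least[of k "\<lambda>n. (1 / 2) ^ n \<le> t"] k by (simp add: m_def[symmetric])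
  then show ?thesis using m k by auto
qed

text \<open>On dyadic shells the contributions form a geometric series with ratio 2^(\<beta> - N) <
  1.\<close>

lemma nn_integral_ball_powr:
  assumes "0 \<le> \<beta>" "\<beta> < real DIM('a::euclidean_space)"
  shows "(\<integral>\<^sup>+x. ennreal (indicator (ball 0 1) x * norm x powr (- \<beta>)) \<partial>(lborel :: 'a measure)) < \<infinity>"
proof (rule nn_integral_finite_if_le_balls)
  let ?N = "real DIM('a)"
  let ?a = "\<lambda>k::nat. ((1 / 2) ^ Suc k) powr (- \<beta>) :: real" and ?r = "\<lambda>k::nat. (1 / 2) ^ k :: real"
  show "\<exists>k. (x \<in> ball 0 (?r k) \<and> indicator (ball 0 1) x * norm x powr (- \<beta>) \<le> ?a k) \<or>
      indicator (ball 0 1) x * norm x powr (- \<beta>) \<le> 0" if "x \<noteq> 0" for x :: 'a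
  proof (cases "norm x < 1")
    case True
    then obtain k where k: "(1 / 2) ^ Suc k \<le> norm x" "norm x < (1 / 2) ^ k"
      using ex_half_power_between[of "norm x"] \<open>x \<noteq> 0\<close> by auto
    have "norm x powr (- \<beta>) \<le> ?a k"
      using k assms by (intro powr_mono2') auto
    then show ?thesis
      using k True by (intro exI[of _ k]) (auto simp: indicator_def)
  qed (auto simp: indicator_def)
  have "?a k * ?r k ^ DIM('a) = 2 powr \<beta> * (2 powr (\<beta> - ?N)) ^ k" for k
  proof -
    have "?a k = 2 powr ((real k + 1) * \<beta>)"
      by (simp add: powr_powr power_one_over powr_minus powr_divide flip: powr_realpow)
        (simp add: powr_mult powr_powr powr_add algebra_simps flip: powr_realpow)
    moreover have "?r k ^ DIM('a) = 2 powr (- (real k * ?N))"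
      by (simp add: power_one_over powr_minus powr_powr field_simps flip: power_mult powr_realpow)
    moreover have "(2 powr (\<beta> - ?N)) ^ k = 2 powr ((\<beta> - ?N) * real k)"
      by (simp add: powr_powr flip: powr_realpow)
    ultimately show ?thesis
      by (simp add: algebra_simps flip: powr_add)
  qed
  moreover have "summable (\<lambda>k. 2 powr \<beta> * (2 powr (\<beta> - ?N)) ^ k)"
  proof (intro summable_mult summable_geometric)
    have "2 powr (\<beta> - ?N) < 2 powr 0"
      using assms by (intro powr_less_mono) auto
    then show "norm (2 powr (\<beta> - ?N)) < 1" by simp
  qed
  ultimately show "summable (\<lambda>k. ?a k * ?r k ^ DIM('a))"
    by simp
qed auto

lemma nn_integral_exp_norm:
  assumes "\<delta> > 0"
  shows "(\<integral>\<^sup>+x. ennreal (exp (- \<delta> * norm x)) \<partial>(lborel :: 'a::euclidean_space measure)) < \<infinity>"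
proof (rule nn_integral_finite_if_le_balls)
  let ?N = "real DIM('a)"
  let ?a = "\<lambda>k::nat. exp (- \<delta> * real k) :: real" and ?r = "\<lambda>k::nat. real (Suc k)"
  show "\<exists>k. (x \<in> ball 0 (?r k) \<and> exp (- \<delta> * norm x) \<le> ?a k) \<or> exp (- \<delta> * norm x) \<le> 0" for x :: 'a
  proof -
    define k where "k = nat \<lfloor>norm x\<rfloor>"
    have "real k \<le> norm x" "norm x < real k + 1"
      by (auto simp: k_def)
    then show ?thesis
      using assms by (intro exI[of _ k]) auto
  qed
  \<comment> \<open>Half of the exponential absorbs the volume factor (k + 1)^N, the other half
    remains as a geometric series; \<open>exp (\<delta> / 2)\<close> corrects the index shift from k
    to k + 1.\<close>
  define C where "C = exp (\<delta> / 2) * (?N powr ?N * (\<delta> / 2) powr (- ?N))"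
  have "?a k * ?r k ^ DIM('a) \<le> C * exp (- (\<delta> / 2)) ^ k" for k
  proof -
    have pos: "?r k ^ DIM('a) > 0" by simp
    have "exp (- (\<delta> / 2 * ?r k)) \<le> ?N powr ?N * (\<delta> / 2 * ?r k) powr (- ?N)"
      using assms by (intro exp_minus_le_powr) auto
    also have "\<dots> = ?N powr ?N * (\<delta> / 2) powr (- ?N) / ?r k ^ DIM('a)"
      using powr_mult[of "\<delta> / 2" "?r k" "- ?N"] powr_minus_divide[of "?r k" ?N] powr_realpow[of "?r k" "DIM('a)"] by simp
    finally have "exp (- (\<delta> / 2 * ?r k)) * ?r k ^ DIM('a) \<le> ?N powr ?N * (\<delta> / 2) powr (- ?N)"
      by (simp only: pos_le_divide_eq[OF pos])
    then have "exp (\<delta> / 2) * (exp (- (\<delta> / 2 * ?r k)) * ?r k ^ DIM('a)) * exp (- (\<delta> / 2)) ^ k \<le> C * exp (- (\<delta> / 2)) ^ k"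
      unfolding C_def by (intro mult_right_mono mult_left_mono) auto
    moreover have "?a k = exp (\<delta> / 2) * exp (- (\<delta> / 2 * ?r k)) * exp (- (\<delta> / 2)) ^ k"
      by (simp add: algebra_simps flip: exp_add exp_of_nat_mult)
    ultimately show ?thesis
      by (simp add: mult_ac)
  qed
  then have "norm (?a k * ?r k ^ DIM('a)) \<le> C * exp (- (\<delta> / 2)) ^ k" for k
    by (subst real_norm_def, subst abs_of_nonneg) auto
  moreover have "summable (\<lambda>k. C * exp (- (\<delta> / 2)) ^ k)"
    using assms by (intro summable_mult summable_geometric) auto
  ultimately show "summable (\<lambda>k. ?a k * ?r k ^ DIM('a))"
    by (blast intro: summable_comparison_test')
qed auto

lemma nn_integral_fund_sol_exp_powr:
  assumes "DIM('a::euclidean_space) \<ge> 2" "s > 0" "s * (real DIM('a) - 2) < real DIM('a)"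
  shows "(\<integral>\<^sup>+x. ennreal (indicator (ball 0 1) x * fund_sol_exp x powr s) \<partial>(lborel :: 'a measure)) < \<infinity>"
proof -
  let ?N = "real DIM('a)"
  have "?N - 2 < ?N / s"
    using assms by (simp add: field_simps)
  \<comment> \<open>The gap between N - 2 and N / s leaves room for a power slightly worse than the
    true singularity that is still integrable after raising to \<open>s\<close>.\<close>
  then obtain b where b: "?N - 2 < b" "b < ?N / s" using dense by blast
  then have bs: "b * s < ?N" "b \<ge> 0" using assms by (auto simp: field_simps)
  obtain C where C: "C \<ge> 0" "\<And>x :: 'a. norm x \<le> 1 \<Longrightarrow> fund_sol_exp x \<le> C * norm x powr (- b)"
    using fund_sol_exp_le_powr[OF assms(1) b(1)] by blast
  have "(\<integral>\<^sup>+x. ennreal (indicator (ball 0 1) x * fund_sol_exp x powr s) \<partial>(lborel :: 'a measure)) \<le>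
      (\<integral>\<^sup>+x. ennreal (C powr s) * ennreal (indicator (ball 0 1) x * norm x powr (- (b * s))) \<partial>(lborel :: 'a measure))"
  proof (rule nn_integral_mono)
    fix x :: 'a
    show "ennreal (indicator (ball 0 1) x * fund_sol_exp x powr s) \<le>
        ennreal (C powr s) * ennreal (indicator (ball 0 1) x * norm x powr (- (b * s)))"
    proof (cases "norm x < 1")
      case True
      have "fund_sol_exp x powr s \<le> (C * norm x powr (- b)) powr s"
        using C(2)[of x] True assms(1,2) fund_sol_exp_nonneg[of x] by (intro powr_mono2) auto
      also have "\<dots> = C powr s * norm x powr (- (b * s))"
        using C(1) by (simp add: powr_mult powr_powr)
      finally show ?thesis
        using True by (simp flip: ennreal_mult)
    qed simp
  qed
  also have "\<dots> = ennreal (C powr s) * (\<integral>\<^sup>+x. ennreal (indicator (ball 0 1) x * norm x powr (- (b * s))) \<partial>(lborel :: 'a measure))"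
    by (rule nn_integral_cmult) simp
  also have "\<dots> < \<infinity>"
    using nn_integral_ball_powr[of "b * s", where 'a = 'a] bs assms by (simp add: ennreal_mult_less_top)
  finally show ?thesis .
qed

lemma nn_integral_fund_sol_exp_weight:
  assumes "DIM('a::euclidean_space) \<ge> 2" "\<delta> > 0"
  shows "(\<integral>\<^sup>+x. ennreal (fund_sol_exp x * exp (- \<delta> * norm x)) \<partial>(lborel :: 'a measure)) < \<infinity>"
proof -
  note [measurable] = fund_sol_exp_measurable[OF assms(1)]
  obtain C where C: "C \<ge> 0" "\<And>x :: 'a. norm x \<ge> 1 \<Longrightarrow> fund_sol_exp x \<le> C"
    using fund_sol_exp_bounded[OF assms(1)] by blast
  have nn: "fund_sol_exp x \<ge> 0" for x :: 'a
    by (rule fund_sol_exp_nonneg[OF assms(1)])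
  have "(\<integral>\<^sup>+x. ennreal (fund_sol_exp x * exp (- \<delta> * norm x)) \<partial>(lborel :: 'a measure)) \<le>
     (\<integral>\<^sup>+x. ennreal (indicator (ball 0 1) x * fund_sol_exp x powr 1) + ennreal C * ennreal (exp (- \<delta> * norm x)) \<partial>(lborel :: 'a measure))"
  proof (rule nn_integral_mono)
    fix x :: 'a
    show "ennreal (fund_sol_exp x * exp (- \<delta> * norm x)) \<le>
       ennreal (indicator (ball 0 1) x * fund_sol_exp x powr 1) + ennreal C * ennreal (exp (- \<delta> * norm x))"
    proof (cases "norm x < 1")
      case True
      have "fund_sol_exp x * exp (- \<delta> * norm x) \<le> fund_sol_exp x * 1"
        using assms nn by (intro mult_left_mono) auto
      then have "ennreal (fund_sol_exp x * exp (- \<delta> * norm x)) \<le> ennreal (indicator (ball 0 1) x * fund_sol_exp x powr 1)"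
        using True nn by (intro ennreal_leI) simp
      then show ?thesis
        by (rule order_trans) simp
    next
      case False
      have "fund_sol_exp x * exp (- \<delta> * norm x) \<le> C * exp (- \<delta> * norm x)"
        using False by (intro mult_right_mono C) auto
      then have "ennreal (fund_sol_exp x * exp (- \<delta> * norm x)) \<le> ennreal C * ennreal (exp (- \<delta> * norm x))"
        using C(1) by (simp add: ennreal_leI flip: ennreal_mult)
      then show ?thesis
        by (rule order_trans) simp
    qed
  qed
  also have "\<dots> = (\<integral>\<^sup>+x. ennreal (indicator (ball 0 1) x * fund_sol_exp x powr 1) \<partial>(lborel :: 'a measure)) +
      ennreal C * (\<integral>\<^sup>+x. ennreal (exp (- \<delta> * norm x)) \<partial>(lborel :: 'a measure))"
    by (simp add: nn_integral_add nn_integral_cmult)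
  also have "\<dots> < \<infinity>"
    using nn_integral_fund_sol_exp_powr[OF assms(1), of 1] nn_integral_exp_norm[OF assms(2), where 'a = 'a]
    by (simp add: ennreal_mult_less_top)
  finally show ?thesis .
qed

text \<open>
  Near the singularity, Young's inequality with exponents \<open>\<sigma>\<close> and \<open>\<sigma> / (\<sigma> - 1) < N / (N - 2)\<close> is used.
\<close>

lemma fund_sol_exp_weight_bounded:
  fixes w :: "'a::euclidean_space \<Rightarrow> real"
  assumes dim: "DIM('a) \<ge> 2"
    and \<sigma>: "\<sigma> > 1" "\<sigma> > real DIM('a) / 2"
    and [measurable]: "w \<in> borel_measurable borel" and w_nonneg: "\<And>x. w x \<ge> 0"
    and fin: "(\<integral>\<^sup>+x. ennreal (w x) \<partial>lborel) < \<infinity>" "(\<integral>\<^sup>+x. ennreal (w x powr \<sigma>) \<partial>lborel) < \<infinity>"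
  shows "\<exists>M\<ge>0. \<forall>x. (\<integral>\<^sup>+z. ennreal (fund_sol_exp (x - z) * w z) \<partial>lborel) \<le> ennreal M"
proof -
  note [measurable] = fund_sol_exp_measurable[OF dim]
  obtain C where C: "C \<ge> 0" "\<And>x :: 'a. norm x \<ge> 1 \<Longrightarrow> fund_sol_exp x \<le> C"
    using fund_sol_exp_bounded[OF dim] by blast
  have nn: "fund_sol_exp x \<ge> 0" for x :: 'a
    by (rule fund_sol_exp_nonneg[OF dim])
  define s where "s = \<sigma> / (\<sigma> - 1)"
  have s: "s > 1" "1 / s + 1 / \<sigma> = 1"
    using \<sigma> by (auto simp: s_def field_simps)
  have "s * (real DIM('a) - 2) < real DIM('a)"
    using \<sigma> by (simp add: s_def field_simps)
  then have I: "(\<integral>\<^sup>+x. ennreal (indicator (ball 0 1) x * fund_sol_exp x powr s) \<partial>(lborel :: 'a measure)) < \<infinity>"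
    using s by (intro nn_integral_fund_sol_exp_powr[OF dim]) auto
  define T where "T = (\<integral>\<^sup>+x. ennreal (indicator (ball 0 1) x * fund_sol_exp x powr s) \<partial>(lborel :: 'a measure)) +
      (\<integral>\<^sup>+x. ennreal (w x powr \<sigma>) \<partial>lborel) + ennreal C * (\<integral>\<^sup>+x. ennreal (w x) \<partial>lborel)"
  have "T < \<infinity>"
    using I fin by (simp add: T_def ennreal_mult_less_top)
  have "(\<integral>\<^sup>+z. ennreal (fund_sol_exp (x - z) * w z) \<partial>lborel) \<le> T" for x
  proof -
    have "(\<integral>\<^sup>+z. ennreal (fund_sol_exp (x - z) * w z) \<partial>lborel) \<le>
      (\<integral>\<^sup>+z. ennreal (indicator (ball 0 1) (x - z) * fund_sol_exp (x - z) powr s) + ennreal (w z powr \<sigma>) +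
         ennreal C * ennreal (w z) \<partial>lborel)"
    proof (rule nn_integral_mono)
      fix z
      show "ennreal (fund_sol_exp (x - z) * w z) \<le>
        ennreal (indicator (ball 0 1) (x - z) * fund_sol_exp (x - z) powr s) + ennreal (w z powr \<sigma>) + ennreal C * ennreal (w z)"
      proof (cases "norm (x - z) < 1")
        case True
        have "fund_sol_exp (x - z) * w z \<le> fund_sol_exp (x - z) powr s / s + w z powr \<sigma> / \<sigma>"
          using s \<sigma> nn w_nonneg by (intro Youngs_inequality) auto
        also have "\<dots> \<le> fund_sol_exp (x - z) powr s + w z powr \<sigma>"
          using s \<sigma> by (intro add_mono) (auto simp: divide_le_eq mult_le_cancel_left1)
        finally have "ennreal (fund_sol_exp (x - z) * w z) \<le>
            ennreal (indicator (ball 0 1) (x - z) * fund_sol_exp (x - z) powr s) + ennreal (w z powr \<sigma>)"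
          using True by (simp add: ennreal_leI flip: ennreal_plus)
        then show ?thesis
          by (rule order_trans) simp
      next
        case False
        have "fund_sol_exp (x - z) * w z \<le> C * w z"
          using False by (intro mult_right_mono C w_nonneg) auto
        then have "ennreal (fund_sol_exp (x - z) * w z) \<le> ennreal C * ennreal (w z)"
          using C(1) by (simp add: ennreal_leI w_nonneg flip: ennreal_mult)
        then show ?thesis
          by (rule order_trans) simp
      qed
    qed
    also have "\<dots> = (\<integral>\<^sup>+z. ennreal (indicator (ball 0 1) (x - z) * fund_sol_exp (x - z) powr s) \<partial>lborel) +
        (\<integral>\<^sup>+z. ennreal (w z powr \<sigma>) \<partial>lborel) + ennreal C * (\<integral>\<^sup>+z. ennreal (w z) \<partial>lborel)"
      by (simp add: nn_integral_add nn_integral_cmult)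
    \<comment> \<open>Translation and reflection remove \<open>x\<close>, so the bound is
      uniform.\<close>
    also have "(\<integral>\<^sup>+z. ennreal (indicator (ball 0 1) (x - z) * fund_sol_exp (x - z) powr s) \<partial>lborel) =
        (\<integral>\<^sup>+z. ennreal (indicator (ball 0 1) z * fund_sol_exp z powr s) \<partial>(lborel :: 'a measure))"
      by (rule nn_integral_lborel_reflect) simp
    finally show ?thesis
      by (simp add: T_def)
  qed
  moreover have "T = ennreal (enn2real T)"
    using \<open>T < \<infinity>\<close> by simp
  ultimately show ?thesis
    by (intro exI[of _ "enn2real T"]) auto
qed

text \<open>The three-point inequality integrated in \<open>z\<close> against the weight: each of
  the two summands contributes at most \<open>M\<close>. The constant depends on neither the weight
  nor the pole \<open>y\<close>, so the result may be integrated in \<open>y\<close> against a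
  measure.\<close>

lemma fund_sol_convolution_le:
  assumes dim: "DIM('a::euclidean_space) \<ge> 2"
  shows "\<exists>C\<ge>0. \<forall>(w :: 'a \<Rightarrow> real) M x y. w \<in> borel_measurable borel \<longrightarrow> (\<forall>x. w x \<ge> 0) \<longrightarrow> M \<ge> 0 \<longrightarrow>
    (\<forall>x. (\<integral>\<^sup>+z. ennreal (fund_sol_exp (x - z) * w z) \<partial>lborel) \<le> ennreal M) \<longrightarrow> x \<noteq> y \<longrightarrow>
    (\<integral>\<^sup>+z. ennreal (fund_sol (x - z) * w z * fund_sol (z - y)) \<partial>lborel) \<le> ennreal (C * M * fund_sol (x - y))"
proof -
  note [measurable] = fund_sol_measurable[OF dim] fund_sol_exp_measurable[OF dim]
  obtain C where C: "C \<ge> 0" "\<And>x y z :: 'a. x \<noteq> y \<Longrightarrow>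
      fund_sol (x - z) * fund_sol (z - y) \<le> C * fund_sol (x - y) * (fund_sol_exp (x - z) + fund_sol_exp (z - y))"
    using fund_sol_three_points[OF dim] by blast
  have nn: "fund_sol x \<ge> 0" "fund_sol_exp x \<ge> 0" for x :: 'a
    by (rule fund_sol_nonneg[OF dim] fund_sol_exp_nonneg[OF dim])+
  have "(\<integral>\<^sup>+z. ennreal (fund_sol (x - z) * w z * fund_sol (z - y)) \<partial>lborel) \<le> ennreal (2 * C * M * fund_sol (x - y))"
    if [measurable]: "w \<in> borel_measurable borel" and w: "\<And>x. w x \<ge> 0" and "M \<ge> 0"
      and M: "\<And>x. (\<integral>\<^sup>+z. ennreal (fund_sol_exp (x - z) * w z) \<partial>lborel) \<le> ennreal M" and "x \<noteq> y"
    for w :: "'a \<Rightarrow> real" and M x y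
  proof -
    let ?D = "C * fund_sol (x - y)"
    have "?D \<ge> 0" using C nn by simp
    have "(\<integral>\<^sup>+z. ennreal (fund_sol (x - z) * w z * fund_sol (z - y)) \<partial>lborel) \<le>
      (\<integral>\<^sup>+z. ennreal ?D * (ennreal (fund_sol_exp (x - z) * w z) + ennreal (fund_sol_exp (y - z) * w z)) \<partial>lborel)"
    proof (rule nn_integral_mono)
      fix z
      have "fund_sol (x - z) * fund_sol (z - y) * w z \<le> ?D * (fund_sol_exp (x - z) + fund_sol_exp (z - y)) * w z"
        using C(2)[OF \<open>x \<noteq> y\<close>] w by (rule mult_right_mono)
      moreover have "fund_sol_exp (z - y) = fund_sol_exp (y - z)"
        by (simp add: fund_sol_exp_def fund_sol_minus_commute[of z y] norm_minus_commute)
      ultimately have "fund_sol (x - z) * w z * fund_sol (z - y) \<le> ?D * (fund_sol_exp (x - z) * w z + fund_sol_exp (y - z) * w z)"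
        by (simp add: algebra_simps)
      then show "ennreal (fund_sol (x - z) * w z * fund_sol (z - y)) \<le>
          ennreal ?D * (ennreal (fund_sol_exp (x - z) * w z) + ennreal (fund_sol_exp (y - z) * w z))"
        using \<open>?D \<ge> 0\<close> w nn by (simp add: ennreal_leI flip: ennreal_mult ennreal_plus)
    qed
    also have "\<dots> = ennreal ?D * ((\<integral>\<^sup>+z. ennreal (fund_sol_exp (x - z) * w z) \<partial>lborel) + (\<integral>\<^sup>+z. ennreal (fund_sol_exp (y - z) * w z) \<partial>lborel))"
      by (simp add: nn_integral_add nn_integral_cmult)
    also have "\<dots> \<le> ennreal ?D * (ennreal M + ennreal M)"
      by (intro mult_left_mono add_mono M) auto
    also have "\<dots> = ennreal (2 * C * M * fund_sol (x - y))"
      using \<open>M \<ge> 0\<close> \<open>?D \<ge> 0\<close> by (simp add: mult_ac flip: ennreal_mult ennreal_plus)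
    finally show ?thesis .
  qed
  then show ?thesis
    using C(1) by (intro exI[of _ "2 * C"]) auto
qed

section \<open>Powers of extended nonnegative reals\<close>

text \<open>The power function on [0, \<infinity>]. Infinity is a separate case because
  \<open>enn2real top = 0\<close>.\<close>

definition epow :: "real \<Rightarrow> ennreal \<Rightarrow> ennreal" where
  "epow p x = (if x = top then top else ennreal (enn2real x powr p))"

lemma epow_top [simp]: "epow p top = top"
  by (simp add: epow_def)

lemma epow_0 [simp]: "epow p 0 = 0"
  by (simp add: epow_def)

lemma epow_ennreal: "a \<ge> 0 \<Longrightarrow> epow p (ennreal a) = ennreal (a powr p)"
  by (simp add: epow_def)

lemma epow_eq_top_iff [simp]: "epow p x = top \<longleftrightarrow> x = top"
  by (simp add: epow_def)

lemma epow_mono: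
  assumes "p > 0" "x \<le> y"
  shows "epow p x \<le> epow p y"
proof (cases "y = top")
  case False
  then have "x \<noteq> top" using assms by (auto simp: top_unique)
  then show ?thesis
    using False assms by (auto simp: epow_def enn2real_mono less_top intro!: ennreal_leI powr_mono2)
qed simp

lemma epow_epow_inverse: "p > 0 \<Longrightarrow> epow p (epow (1 / p) x) = x"
  by (cases x) (auto simp: epow_ennreal powr_powr)

lemma epow_inverse_epow: "p > 0 \<Longrightarrow> epow (1 / p) (epow p x) = x"
  by (cases x) (auto simp: epow_ennreal powr_powr)

text \<open>For positive exponents \<open>epow p\<close> is an increasing bijection with inverse
  \<open>epow (1 / p)\<close>, so it commutes with suprema; this lets monotone convergence pass
  through the nonlinearity.\<close>

lemma epow_SUP:
  assumes "p > 0"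
  shows "epow p (SUP i\<in>I. f i) = (SUP i\<in>I. epow p (f i))"
proof (rule antisym)
  have "f i \<le> epow (1 / p) (SUP i\<in>I. epow p (f i))" if "i \<in> I" for i
    using epow_mono[of "1 / p" "epow p (f i)" "SUP i\<in>I. epow p (f i)"] assms SUP_upper[OF that, of "\<lambda>i. epow p (f i)"]
    by (simp add: epow_inverse_epow)
  then have "epow p (SUP i\<in>I. f i) \<le> epow p (epow (1 / p) (SUP i\<in>I. epow p (f i)))"
    using assms by (intro epow_mono SUP_least) auto
  then show "epow p (SUP i\<in>I. f i) \<le> (SUP i\<in>I. epow p (f i))"
    using assms by (simp add: epow_epow_inverse)
  show "(SUP i\<in>I. epow p (f i)) \<le> epow p (SUP i\<in>I. f i)"
    using assms by (intro SUP_least epow_mono SUP_upper)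
qed

lemma epow_measurable [measurable]: "epow p \<in> borel_measurable borel"
  unfolding epow_def[abs_def] by measurable

lemma epow_mult:
  assumes "p > 0"
  shows "epow p (x * y) = epow p x * epow p y"
proof -
  have z: "epow p z = 0 \<longleftrightarrow> z = 0" for z
    by (cases z) (auto simp: epow_ennreal)
  show ?thesis
    by (cases x; cases y)
      (auto simp: epow_ennreal powr_mult ennreal_mult_top ennreal_top_mult z simp flip: ennreal_mult)
qed

lemma epow_add: "a > 0 \<Longrightarrow> b > 0 \<Longrightarrow> epow (a + b) x = epow a x * epow b x"
  by (cases x) (auto simp: epow_ennreal powr_add ennreal_mult)

lemma epow_1 [simp]: "epow 1 x = x"
  by (cases x) (auto simp: epow_ennreal)

lemma epow_le_one_plus:
  assumes "0 < a" "a \<le> b"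
  shows "epow a x \<le> 1 + epow b x"
proof (cases x)
  case (real r)
  have "r powr a \<le> 1 + r powr b"
  proof (cases "r \<le> 1")
    case True
    then have "r powr a \<le> 1" using real assms by (simp add: powr_le_one_le powr_le1)
    then show ?thesis by (simp add: add_increasing2)
  next
    case False
    then have "r powr a \<le> r powr b" using assms by (intro powr_mono) auto
    then show ?thesis by simp
  qed
  then have "ennreal (r powr a) \<le> ennreal (1 + r powr b)"
    by (rule ennreal_leI)
  then show ?thesis
    using real by (simp add: epow_ennreal)
qed simp

section \<open>The fixed point equation\<close>

text \<open>Unlike \<open>potential_fun\<close>, it accepts infinite values and integrates over
  \<open>lborel\<close>, so that Borel measurability is preserved and Fubini applies.\<close>

definition fund_conv :: "('a::euclidean_space \<Rightarrow> ennreal) \<Rightarrow> 'a \<Rightarrow> ennreal" where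
  "fund_conv f x = (\<integral>\<^sup>+y. ennreal (fund_sol (x - y)) * f y \<partial>lborel)"

lemma fund_conv_mono_AE: "AE y in lborel. f y \<le> g y \<Longrightarrow> fund_conv f x \<le> fund_conv g x"
  unfolding fund_conv_def by (intro nn_integral_mono_AE) (auto intro!: mult_left_mono)

lemma fund_conv_cong_AE: "AE y in lborel. f y = g y \<Longrightarrow> fund_conv f x = fund_conv g x"
  unfolding fund_conv_def by (intro nn_integral_cong_AE) auto

text \<open>Each point off \<open>S\<close> has a null ball around it, and by Lindelof countably
  many of these balls cover the complement of \<open>S\<close>.\<close>

lemma measure_support_compl_null:
  fixes \<mu> :: "'a::euclidean_space measure"
  assumes [measurable_cong]: "sets \<mu> = sets borel" and "measure_support \<mu> \<subseteq> S" and "closed S"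
  shows "AE y in \<mu>. y \<in> S"
proof -
  have "\<exists>r>0. emeasure \<mu> (ball x r) = 0" if "x \<notin> S" for x
    using that assms(2) by (auto simp: measure_support_def zero_less_iff_neq_zero)
  then obtain r where r: "\<And>x. x \<notin> S \<Longrightarrow> r x > 0 \<and> emeasure \<mu> (ball x (r x)) = 0"
    by metis
  define F where "F = (\<lambda>x. ball x (r x)) ` (- S)"
  obtain F' where F': "F' \<subseteq> F" "countable F'" "\<Union>F' = \<Union>F"
    using Lindelof[of F] by (auto simp: F_def)
  have "F' \<subseteq> null_sets \<mu>"
    using F'(1) r by (auto simp: F_def null_sets_def assms(1))
  then have "(\<Union>X\<in>F'. X) \<in> null_sets \<mu>"
    using F'(2) by (intro null_sets_UN') auto
  then have N: "\<Union>F' \<in> null_sets \<mu>" by simp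
  have "{y \<in> space \<mu>. y \<notin> S} \<subseteq> \<Union>F'"
    using r by (auto simp: F'(3) F_def)
  then show ?thesis
    by (rule AE_I'[OF N])
qed

text \<open>The hypotheses in the form in which they are used: \<open>\<mu>\<close> is finite
  because its support is bounded, and the integrability of the potential is stated for
  \<open>lborel\<close> and values in [0, \<infinity>].\<close>

locale radon_problem =
  fixes \<mu> :: "'a::euclidean_space measure" and p q R :: real
  assumes dim: "DIM('a) \<ge> 2"
    and sets_mu [measurable_cong]: "sets \<mu> = sets borel"
    and finite_mu: "emeasure \<mu> UNIV < \<infinity>"
    and nontrivial: "emeasure \<mu> UNIV \<noteq> 0"
    and R_pos: "R > 0"
    and supp: "AE y in \<mu>. norm y \<le> R"
    and p_gt_1: "p > 1"
    and q_gt: "q > p" "q > real DIM('a) * (p - 1) / 2"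
    and h_finite: "AE x in lborel. potential \<mu> x < \<infinity>"
    and h_Lq: "(\<integral>\<^sup>+x. epow q (potential \<mu> x) \<partial>lborel) < \<infinity>"
begin

abbreviation h :: "'a \<Rightarrow> ennreal" where "h \<equiv> potential \<mu>"

lemma space_mu [simp]: "space \<mu> = UNIV"
  using sets_eq_imp_space_eq[OF sets_mu] by simp

sublocale finite_measure \<mu>
  by standard (use finite_mu in auto)

lemma G_measurable [measurable]:
  "(fund_sol :: 'a \<Rightarrow> real) \<in> borel_measurable borel"
  "(fund_sol_exp :: 'a \<Rightarrow> real) \<in> borel_measurable borel"
  by (rule fund_sol_measurable[OF dim] fund_sol_exp_measurable[OF dim])+

lemma G_nonneg [simp]: "fund_sol (x :: 'a) \<ge> 0" "fund_sol_exp x \<ge> 0"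
  by (rule fund_sol_nonneg[OF dim] fund_sol_exp_nonneg[OF dim])+

lemma h_measurable [measurable]: "h \<in> borel_measurable borel"
proof -
  have "(\<lambda>x. \<integral>\<^sup>+ y. ennreal (fund_sol (x - y)) \<partial>\<mu>) \<in> borel_measurable borel"
    by (rule borel_measurable_nn_integral) measurable
  then show ?thesis
    by (simp add: potential_def[abs_def])
qed

lemma fund_conv_measurable [measurable]:
  fixes f :: "'a \<Rightarrow> ennreal"
  assumes [measurable]: "f \<in> borel_measurable borel"
  shows "fund_conv f \<in> borel_measurable borel"
  unfolding fund_conv_def[abs_def] by (rule lborel.borel_measurable_nn_integral) measurable

text \<open>
  As \<open>fund_sol 0 = 0\<close>, bounds from below by \<open>fund_sol (x - y)\<close> fail at \<open>y = x\<close>, hence at the atoms of \<open>\<mu>\<close>.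
\<close>

lemma AE_no_atom: "AE x in lborel. AE y in \<mu>. y \<noteq> x"
proof -
  interpret pair_sigma_finite "lborel :: 'a measure" \<mu> ..
  \<comment> \<open>The indicator of the diagonal, written with the norm so that its measurability
    on the product is evident. Integrated in \<open>x\<close> first it vanishes, as points are
    Lebesgue null.\<close>
  let ?f = "\<lambda>x y. if norm (x - y :: 'a) = 0 then 1 else 0 :: ennreal"
  have "(\<integral>\<^sup>+x. (\<integral>\<^sup>+y. ?f x y \<partial>\<mu>) \<partial>lborel) = (\<integral>\<^sup>+y. (\<integral>\<^sup>+x. ?f x y \<partial>lborel) \<partial>\<mu>)"
    by (rule Fubini'[symmetric]) measurable
  also have "\<dots> = (\<integral>\<^sup>+y. 0 \<partial>\<mu>)"
  proof (rule nn_integral_cong)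
    fix y
    have "(\<integral>\<^sup>+x. ?f x y \<partial>lborel) = (\<integral>\<^sup>+x. 0 \<partial>(lborel :: 'a measure))"
      using AE_lborel_singleton[of y] by (intro nn_integral_cong_AE) auto
    then show "(\<integral>\<^sup>+x. ?f x y \<partial>lborel) = 0" by simp
  qed
  finally have "(\<integral>\<^sup>+x. (\<integral>\<^sup>+y. ?f x y \<partial>\<mu>) \<partial>lborel) = 0"
    by simp
  moreover have "(\<lambda>x. \<integral>\<^sup>+y. ?f x y \<partial>\<mu>) \<in> borel_measurable lborel"
    by measurable
  ultimately have "AE x in lborel. (\<integral>\<^sup>+y. ?f x y \<partial>\<mu>) = 0"
    by (simp only: nn_integral_0_iff_AE)
  then show ?thesis
  proof eventually_elim
    case (elim x)
    then have "AE y in \<mu>. ?f x y = 0"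
      by (subst (asm) nn_integral_0_iff_AE) auto
    then show ?case
      by eventually_elim (auto split: if_splits)
  qed
qed

text \<open>Both factors exp (- |z|) and \<open>k\<close> decrease radially, so the value at any
  point beyond radius \<open>\<rho>\<close> is a lower bound.\<close>

lemma G_lower_bound: "\<exists>c>0. \<forall>z :: 'a. z \<noteq> 0 \<longrightarrow> norm z \<le> \<rho> \<longrightarrow> c \<le> fund_sol z"
proof -
  obtain e :: 'a where e: "e \<in> Basis" using nonempty_Basis by blast
  define y where "y = (\<bar>\<rho>\<bar> + 1) *\<^sub>R e"
  have y: "y \<noteq> 0" "norm y = \<bar>\<rho>\<bar> + 1"
    using e by (auto simp: y_def)
  have "fund_sol y \<le> fund_sol z" if "z \<noteq> 0" "norm z \<le> \<rho>" for z :: 'a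
    unfolding fund_sol_eq using that y
    by (intro mult_mono fund_sol_exp_antimono[OF dim]) auto
  then show ?thesis
    using fund_sol_pos[OF dim y(1)] by blast
qed

lemma h_lower_bound: "\<exists>c>0. AE x in lborel. norm x < 1 \<longrightarrow> ennreal c \<le> h x"
proof -
  obtain c where c: "c > 0" "\<And>z :: 'a. z \<noteq> 0 \<Longrightarrow> norm z \<le> R + 1 \<Longrightarrow> c \<le> fund_sol z"
    using G_lower_bound[of "R + 1"] by blast
  define m where "m = measure \<mu> UNIV"
  have m: "emeasure \<mu> UNIV = ennreal m" "m > 0"
    using nontrivial finite_mu by (auto simp: m_def emeasure_eq_measure zero_less_measure_iff)
  have "AE x in lborel. norm x < 1 \<longrightarrow> ennreal (c * m) \<le> h x"
    using AE_no_atom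
  proof eventually_elim
    case (elim x)
    show ?case
    proof
      assume "norm x < 1"
      have "ennreal (c * m) = (\<integral>\<^sup>+y. ennreal c \<partial>\<mu>)"
        using c m by (simp add: ennreal_mult)
      also have "\<dots> \<le> (\<integral>\<^sup>+y. ennreal (fund_sol (x - y)) \<partial>\<mu>)"
      proof (rule nn_integral_mono_AE)
        show "AE y in \<mu>. ennreal c \<le> ennreal (fund_sol (x - y))"
          using elim supp
        proof eventually_elim
          case (elim y)
          have "norm (x - y) \<le> R + 1"
            using norm_triangle_ineq4[of x y] elim \<open>norm x < 1\<close> by linarith
          then show ?case
            using elim by (intro ennreal_leI c) auto
        qed
      qed
      finally show "ennreal (c * m) \<le> h x"
        by (simp add: potential_def)
    qed
  qed
  then show ?thesis
    using c m by (intro exI[of _ "c * m"]) auto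
qed

lemma h_pos: "AE x in lborel. h x > 0"
  using AE_no_atom
proof eventually_elim
  case (elim x)
  show ?case
  proof (rule ccontr)
    assume "\<not> h x > 0"
    then have "h x = 0" by (simp add: not_gr_zero)
    then have "AE y in \<mu>. ennreal (fund_sol (x - y)) = 0"
      unfolding potential_def by (subst (asm) nn_integral_0_iff_AE) auto
    then have "AE y in \<mu>. False"
      using elim
    proof eventually_elim
      case (elim y)
      then show ?case
        using fund_sol_pos[OF dim, of "x - y"] by (simp add: ennreal_eq_0_iff)
    qed
    then show False
      using nontrivial by (simp add: AE_iff_null null_sets_def)
  qed
qed

lemma h_far: "\<exists>C\<ge>0. \<forall>x. norm x \<ge> 2 * R \<longrightarrow> h x \<le> ennreal (C * fund_sol x)"
proof -
  obtain C where C: "C \<ge> 0"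
    "\<And>x y :: 'a. x \<noteq> 0 \<Longrightarrow> 2 * norm y \<le> norm x \<Longrightarrow> fund_sol (x - y) \<le> C * exp (norm y) * fund_sol x"
    using fund_sol_diff_le[OF dim] by blast
  have "h x \<le> ennreal (C * exp R * measure \<mu> UNIV * fund_sol x)" if x: "norm x \<ge> 2 * R" for x
  proof -
    have "h x \<le> (\<integral>\<^sup>+y. ennreal (C * exp R * fund_sol x) \<partial>\<mu>)"
      unfolding potential_def
    proof (rule nn_integral_mono_AE)
      show "AE y in \<mu>. ennreal (fund_sol (x - y)) \<le> ennreal (C * exp R * fund_sol x)"
        using supp
      proof eventually_elim
        case (elim y)
        have "fund_sol (x - y) \<le> C * exp (norm y) * fund_sol x"
          using elim x R_pos by (intro C(2)) auto
        also have "\<dots> \<le> C * exp R * fund_sol x"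
          using elim C(1) by (intro mult_right_mono mult_left_mono) auto
        finally show ?case by (rule ennreal_leI)
      qed
    qed
    also have "\<dots> = ennreal (C * exp R * measure \<mu> UNIV * fund_sol x)"
      using C(1) by (simp add: emeasure_eq_measure mult_ac flip: ennreal_mult)
    finally show ?thesis .
  qed
  then show ?thesis
    using C(1) by (intro exI[of _ "C * exp R * measure \<mu> UNIV"]) auto
qed

section \<open>Monotone iteration and the least fixed point\<close>

definition step :: "real \<Rightarrow> ('a \<Rightarrow> ennreal) \<Rightarrow> 'a \<Rightarrow> ennreal" where
  "step \<kappa> U x = ennreal \<kappa> * h x + fund_conv (\<lambda>y. epow p (U y)) x"

lemma step_measurable [measurable]: "U \<in> borel_measurable borel \<Longrightarrow> step \<kappa> U \<in> borel_measurable borel"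
  unfolding step_def[abs_def] by measurable

lemma step_mono_AE: "\<kappa> \<le> \<kappa>' \<Longrightarrow> AE y in lborel. U y \<le> V y \<Longrightarrow> step \<kappa> U x \<le> step \<kappa>' V x"
  unfolding step_def using p_gt_1
  by (intro add_mono mult_right_mono fund_conv_mono_AE ennreal_leI) (auto intro!: epow_mono)

primrec picard :: "real \<Rightarrow> nat \<Rightarrow> 'a \<Rightarrow> ennreal" where
  "picard \<kappa> 0 = (\<lambda>_. 0)"
| "picard \<kappa> (Suc n) = step \<kappa> (picard \<kappa> n)"

text \<open>Defined for every \<open>\<kappa>\<close>, with value \<infinity> allowed; whether a
  solution exists becomes a question about the finiteness of this function.\<close>

definition usol :: "real \<Rightarrow> 'a \<Rightarrow> ennreal" where
  "usol \<kappa> x = (SUP n. picard \<kappa> n x)"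

lemma picard_measurable [measurable]: "picard \<kappa> n \<in> borel_measurable borel"
  by (induction n) auto

lemma usol_measurable [measurable]: "usol \<kappa> \<in> borel_measurable borel"
  unfolding usol_def[abs_def] by measurable

lemma picard_mono: "picard \<kappa> n x \<le> picard \<kappa> (Suc n) x"
proof (induction n arbitrary: x)
  case (Suc n)
  then show ?case by (simp only: picard.simps) (intro step_mono_AE AE_I2, auto)
qed simp

text \<open>Monotone convergence under the integral. The equation holds at every point and not only
  almost everywhere, which later yields pointwise decay and continuity.\<close>

lemma usol_eq: "usol \<kappa> x = step \<kappa> (usol \<kappa>) x"
proof -
  have mono: "incseq (\<lambda>n. picard \<kappa> n y)" for y
    by (rule incseq_SucI) (rule picard_mono)
  let ?F = "\<lambda>n y. ennreal (fund_sol (x - y)) * epow p (picard \<kappa> n y)"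
  have incF: "incseq ?F"
    using p_gt_1 picard_mono by (intro incseq_SucI le_funI mult_left_mono epow_mono) auto
  have "usol \<kappa> x = (SUP n. picard \<kappa> (Suc n) x)"
  proof -
    have "(\<lambda>n. picard \<kappa> n x) \<longlonglongrightarrow> usol \<kappa> x"
      unfolding usol_def by (rule LIMSEQ_SUP[OF mono])
    then have "(\<lambda>n. picard \<kappa> (Suc n) x) \<longlonglongrightarrow> usol \<kappa> x"
      by (rule LIMSEQ_Suc)
    moreover have "(\<lambda>n. picard \<kappa> (Suc n) x) \<longlonglongrightarrow> (SUP n. picard \<kappa> (Suc n) x)"
      by (rule LIMSEQ_SUP) (rule incseq_SucI, rule picard_mono)
    ultimately show ?thesis by (rule LIMSEQ_unique)
  qed
  also have "\<dots> = (SUP n. ennreal \<kappa> * h x + integral\<^sup>N lborel (?F n))"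
    by (simp add: step_def fund_conv_def)
  also have "\<dots> = ennreal \<kappa> * h x + (SUP n. integral\<^sup>N lborel (?F n))"
    by (rule ennreal_SUP_add_right[symmetric]) simp
  also have "(SUP n. integral\<^sup>N lborel (?F n)) = (\<integral>\<^sup>+y. (SUP n. ?F n y) \<partial>lborel)"
    by (rule nn_integral_monotone_convergence_SUP[symmetric, OF incF]) measurable
  also have "\<dots> = fund_conv (\<lambda>y. epow p (usol \<kappa> y)) x"
    unfolding fund_conv_def usol_def using p_gt_1 by (simp add: epow_SUP SUP_mult_left_ennreal)
  finally show ?thesis
    by (simp add: step_def)
qed

text \<open>Induction along the iteration: \<open>step\<close> is monotone and sees its argument
  only up to null sets, so an almost everywhere supersolution suffices. Admitting
  \<open>\<kappa> \<le> \<kappa>'\<close> makes solutions for larger parameters usable as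
  barriers.\<close>

lemma usol_le:
  assumes "\<kappa> \<le> \<kappa>'" and super: "AE x in lborel. step \<kappa>' V x \<le> V x"
  shows "AE x in lborel. usol \<kappa> x \<le> V x"
proof -
  have "AE x in lborel. picard \<kappa> n x \<le> V x" for n
  proof (induction n)
    case (Suc n)
    have "picard \<kappa> (Suc n) x \<le> step \<kappa>' V x" for x
      unfolding picard.simps by (rule step_mono_AE[OF assms(1) Suc])
    with super show ?case
      by (auto elim!: eventually_mono intro: order_trans)
  qed simp
  then have "AE x in lborel. \<forall>n. picard \<kappa> n x \<le> V x"
    by (simp add: AE_all_countable)
  then show ?thesis
    unfolding usol_def by eventually_elim (auto intro: SUP_least)
qed

text \<open>Nonnegativity matters: at a negative value \<open>ennreal\<close> gives 0 while
  \<open>powr\<close> does not vanish.\<close>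

lemma potential_fun_eq:
  assumes "AE y in lebesgue. v y \<ge> 0"
  shows "potential_fun (\<lambda>y. v y powr p) x = fund_conv (\<lambda>y. epow p (ennreal (v y))) (x :: 'a)"
proof -
  have "AE y in lborel. v y \<ge> 0"
    using assms by (simp add: AE_completion_iff)
  then show ?thesis
    unfolding potential_fun_def fund_conv_def nn_integral_completion
    by (intro nn_integral_cong_AE) (auto simp: epow_ennreal ennreal_mult elim!: eventually_mono)
qed

lemma is_solution_iff:
  "is_solution p q \<kappa> \<mu> u \<longleftrightarrow> u \<in> C0_plus_Lqc q \<and>
    (AE x in lborel. ennreal (u x) = step \<kappa> (\<lambda>y. ennreal (u y)) x \<and> u x > 0)"
proof -
  have "(AE x in lborel. ennreal (u x) = potential_fun (\<lambda>y. u y powr p) x + ennreal \<kappa> * h x \<and> u x > 0) \<longleftrightarrow>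
      (AE x in lborel. ennreal (u x) = step \<kappa> (\<lambda>y. ennreal (u y)) x \<and> u x > 0)"
    (is "?A \<longleftrightarrow> ?B")
  proof -
    have "?A = ?B" if "AE x in lborel. u x > 0"
    proof -
      have "potential_fun (\<lambda>y. u y powr p) x = fund_conv (\<lambda>y. epow p (ennreal (u y))) x" for x
        using that by (intro potential_fun_eq) (auto simp: AE_completion_iff elim!: eventually_mono)
      then show ?thesis by (simp add: step_def add.commute)
    qed
    then show ?thesis by (metis (mono_tags, lifting) eventually_mono)
  qed
  then show ?thesis
    by (simp add: is_solution_def AE_completion_iff)
qed

subsection \<open>Large parameters\<close>

text \<open>Let I be the integral of u^p over the unit ball, u = \<open>usol \<kappa>\<close>. There
  u \<ge> d I, which feeds back into I \<ge> b (d I)^p and bounds I from above because p > 1; u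
  \<ge> \<kappa> c bounds I from below by a power of \<kappa>.\<close>

lemma kappa_bounded_if_usol_finite:
  "\<exists>K. \<forall>\<kappa>>0. (AE x in lborel. usol \<kappa> x < \<infinity>) \<longrightarrow> \<kappa> \<le> K"
proof -
  obtain c where c: "c > 0" "AE x in lborel. norm x < 1 \<longrightarrow> ennreal c \<le> h x"
    using h_lower_bound by blast
  obtain d where d: "d > 0" "\<And>z :: 'a. z \<noteq> 0 \<Longrightarrow> norm z \<le> 2 \<Longrightarrow> d \<le> fund_sol z"
    using G_lower_bound[of 2] by blast
  let ?B = "ball 0 1 :: 'a set"
  define b where "b = unit_ball_vol (real DIM('a))"
  have b: "emeasure lborel ?B = ennreal b" "b > 0"
    by (auto simp: b_def emeasure_ball)
  \<comment> \<open>The largest i with \<open>(d * i) powr p * b \<le> i\<close>.\<close>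
  define J where "J = (1 / (d powr p * b)) powr (1 / (p - 1))"
  have "\<kappa> \<le> (J / b) powr (1 / p) / c" if "\<kappa> > 0" and fin: "AE x in lborel. usol \<kappa> x < \<infinity>" for \<kappa>
  proof -
    define I where "I = (\<integral>\<^sup>+y. epow p (usol \<kappa> y) * indicator ?B y \<partial>lborel)"
    have ge_I: "ennreal d * I \<le> usol \<kappa> x" if "x \<in> ?B" for x
    proof -
      have "ennreal d * I = (\<integral>\<^sup>+y. ennreal d * (epow p (usol \<kappa> y) * indicator ?B y) \<partial>lborel)"
        unfolding I_def by (rule nn_integral_cmult[symmetric]) measurable
      also have "\<dots> \<le> (\<integral>\<^sup>+y. ennreal (fund_sol (x - y)) * epow p (usol \<kappa> y) \<partial>lborel)"
      proof (rule nn_integral_mono_AE)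
        show "AE y in lborel. ennreal d * (epow p (usol \<kappa> y) * indicator ?B y) \<le> ennreal (fund_sol (x - y)) * epow p (usol \<kappa> y)"
          using AE_lborel_singleton[of x]
        proof eventually_elim
          case (elim y)
          show ?case
          proof (cases "y \<in> ?B")
            case True
            have "norm (x - y) \<le> 2"
              using norm_triangle_ineq4[of x y] True \<open>x \<in> ?B\<close> by simp
            then have "ennreal d \<le> ennreal (fund_sol (x - y))"
              using elim by (intro ennreal_leI d(2)) auto
            then show ?thesis
              using True by (simp add: mult_right_mono)
          qed simp
        qed
      qed
      also have "\<dots> \<le> usol \<kappa> x"
        by (subst (2) usol_eq) (simp add: step_def fund_conv_def)
      finally show ?thesis .
    qed
    \<comment> \<open>The feedback inequality alone would allow I = \<infinity>; one point of the
      ball where \<open>usol \<kappa>\<close> is finite excludes this.\<close>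
    have "\<exists>x\<in>?B. usol \<kappa> x < \<infinity>"
    proof (rule ccontr)
      assume "\<not> ?thesis"
      with fin have "AE x in lborel. x \<notin> ?B"
        by (auto elim!: eventually_mono)
      then have "emeasure lborel ?B = 0"
        by (subst (asm) AE_iff_measurable[of ?B]) auto
      then show False using b by simp
    qed
    then obtain x where x: "x \<in> ?B" "usol \<kappa> x < \<infinity>" by blast
    have "ennreal d * I < \<infinity>"
      by (rule le_less_trans[OF ge_I[OF x(1)] x(2)])
    then have "I < \<infinity>"
      using d(1) by (auto simp: ennreal_mult_less_top)
    define i where "i = enn2real I"
    have i: "I = ennreal i" "i \<ge> 0"
      using \<open>I < \<infinity>\<close> by (auto simp: i_def)
    have lower: "ennreal (a powr p * b) \<le> I" if "a \<ge> 0" "AE y in lborel. y \<in> ?B \<longrightarrow> ennreal a \<le> usol \<kappa> y" for a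
    proof -
      have "ennreal (a powr p * b) = (\<integral>\<^sup>+y. ennreal (a powr p) * indicator ?B y \<partial>lborel)"
        using b by (simp add: nn_integral_cmult_indicator ennreal_mult)
      also have "\<dots> \<le> I"
        unfolding I_def
      proof (rule nn_integral_mono_AE)
        show "AE y in lborel. ennreal (a powr p) * indicator ?B y \<le> epow p (usol \<kappa> y) * indicator ?B y"
          using that(2)
        proof eventually_elim
          case (elim y)
          then show ?case
            using epow_mono[of p "ennreal a" "usol \<kappa> y"] p_gt_1 \<open>a \<ge> 0\<close>
            by (auto simp: epow_ennreal indicator_def)
        qed
      qed
      finally show ?thesis .
    qed
    have "ennreal ((d * i) powr p * b) \<le> I"
      using d(1) i ge_I by (intro lower AE_I2) (auto simp: ennreal_mult)
    then have i1: "(d * i) powr p * b \<le> i"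
      using i by simp
    have "ennreal ((\<kappa> * c) powr p * b) \<le> I"
    proof (rule lower)
      show "AE y in lborel. y \<in> ?B \<longrightarrow> ennreal (\<kappa> * c) \<le> usol \<kappa> y"
        using c(2)
      proof eventually_elim
        case (elim y)
        show ?case
        proof
          assume "y \<in> ?B"
          then have "ennreal \<kappa> * ennreal c \<le> ennreal \<kappa> * h y"
            using elim by (intro mult_left_mono) auto
          also have "\<dots> \<le> usol \<kappa> y"
            by (subst usol_eq) (simp add: step_def)
          finally show "ennreal (\<kappa> * c) \<le> usol \<kappa> y"
            using \<open>\<kappa> > 0\<close> c(1) by (simp add: ennreal_mult)
        qed
      qed
    qed (use \<open>\<kappa> > 0\<close> c(1) in auto)
    then have i2: "(\<kappa> * c) powr p * b \<le> i"
      using i by simp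
    moreover have "(\<kappa> * c) powr p * b > 0"
      using \<open>\<kappa> > 0\<close> c(1) b by simp
    ultimately have "i > 0" by linarith
    have "d powr p * b * i powr (p - 1) * i \<le> 1 * i"
      using i1 \<open>i > 0\<close> d(1) by (simp add: powr_mult powr_diff mult_ac)
    then have "d powr p * b * i powr (p - 1) \<le> 1"
      using \<open>i > 0\<close> by (rule mult_right_le_imp_le)
    then have "i powr (p - 1) \<le> 1 / (d powr p * b)"
      using d(1) b(2) by (simp add: field_simps)
    then have "(i powr (p - 1)) powr (1 / (p - 1)) \<le> J"
      unfolding J_def using p_gt_1 by (intro powr_mono2) auto
    then have "i \<le> J"
      using p_gt_1 \<open>i > 0\<close> by (simp add: powr_powr)
    then have "(\<kappa> * c) powr p \<le> J / b"
      using i2 b(2) by (simp add: field_simps)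
    then have "((\<kappa> * c) powr p) powr (1 / p) \<le> (J / b) powr (1 / p)"
      using p_gt_1 by (intro powr_mono2) auto
    then show ?thesis
      using p_gt_1 \<open>\<kappa> > 0\<close> c(1) by (simp add: powr_powr field_simps)
  qed
  then show ?thesis by blast
qed

subsection \<open>Small parameters\<close>

text \<open>By Fubini the left-hand side is an integral over \<open>\<mu>\<close> of weighted
  two-step kernels, each bounded by the kernel from \<open>y\<close> to \<open>x\<close>. That bound
  requires \<open>x \<noteq> y\<close>, hence the exceptional null set caused by atoms.\<close>

lemma fund_conv_weight_h_le:
  fixes w :: "'a \<Rightarrow> real"
  assumes [measurable]: "w \<in> borel_measurable borel" and w: "\<And>x. w x \<ge> 0"
    and M: "M \<ge> 0" "\<And>x. (\<integral>\<^sup>+z. ennreal (fund_sol_exp (x - z) * w z) \<partial>lborel) \<le> ennreal M"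
  shows "\<exists>D\<ge>0. AE x in lborel. fund_conv (\<lambda>z. ennreal (w z) * h z) x \<le> ennreal D * h x"
proof -
  interpret pair_sigma_finite "lborel :: 'a measure" \<mu> ..
  obtain C where C: "C \<ge> 0" "\<And>x y. x \<noteq> y \<Longrightarrow>
    (\<integral>\<^sup>+z. ennreal (fund_sol (x - z) * w z * fund_sol (z - y)) \<partial>lborel) \<le> ennreal (C * M * fund_sol (x - y))"
    using fund_sol_convolution_le[OF dim] assms by blast
  have "AE x in lborel. fund_conv (\<lambda>z. ennreal (w z) * h z) x \<le> ennreal (C * M) * h x"
    using AE_no_atom
  proof eventually_elim
    case (elim x)
    have "fund_conv (\<lambda>z. ennreal (w z) * h z) x =
        (\<integral>\<^sup>+z. (\<integral>\<^sup>+y. ennreal (fund_sol (x - z) * w z * fund_sol (z - y)) \<partial>\<mu>) \<partial>lborel)"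
      unfolding fund_conv_def
    proof (rule nn_integral_cong)
      fix z
      have "ennreal (fund_sol (x - z)) * (ennreal (w z) * h z) = ennreal (fund_sol (x - z) * w z) * h z"
        using w by (simp add: ennreal_mult mult.assoc)
      also have "\<dots> = (\<integral>\<^sup>+y. ennreal (fund_sol (x - z) * w z) * ennreal (fund_sol (z - y)) \<partial>\<mu>)"
        unfolding potential_def by (rule nn_integral_cmult[symmetric]) measurable
      also have "\<dots> = (\<integral>\<^sup>+y. ennreal (fund_sol (x - z) * w z * fund_sol (z - y)) \<partial>\<mu>)"
        using w by (intro nn_integral_cong) (simp add: ennreal_mult)
      finally show "ennreal (fund_sol (x - z)) * (ennreal (w z) * h z) =
        (\<integral>\<^sup>+y. ennreal (fund_sol (x - z) * w z * fund_sol (z - y)) \<partial>\<mu>)" .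
    qed
    also have "\<dots> = (\<integral>\<^sup>+y. (\<integral>\<^sup>+z. ennreal (fund_sol (x - z) * w z * fund_sol (z - y)) \<partial>lborel) \<partial>\<mu>)"
      by (rule Fubini'[symmetric]) measurable
    also have "\<dots> \<le> (\<integral>\<^sup>+y. ennreal (C * M) * ennreal (fund_sol (x - y)) \<partial>\<mu>)"
    proof (rule nn_integral_mono_AE)
      show "AE y in \<mu>. (\<integral>\<^sup>+z. ennreal (fund_sol (x - z) * w z * fund_sol (z - y)) \<partial>lborel) \<le> ennreal (C * M) * ennreal (fund_sol (x - y))"
        using elim
      proof eventually_elim
        case (elim y)
        then show ?case
          using C(2)[of x y] C(1) M(1) by (simp add: ennreal_mult)
      qed
    qed
    also have "\<dots> = ennreal (C * M) * h x"
      unfolding potential_def by (rule nn_integral_cmult) measurable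
    finally show ?case .
  qed
  then show ?thesis
    using C(1) M(1) by (intro exI[of _ "C * M"]) auto
qed

lemma h_far_exp: "\<exists>C\<ge>0. \<exists>\<rho>. \<forall>x. norm x \<ge> \<rho> \<longrightarrow> h x \<le> ennreal (C * exp (- norm x))"
proof -
  obtain C where C: "C \<ge> 0" "\<And>x. norm x \<ge> 2 * R \<Longrightarrow> h x \<le> ennreal (C * fund_sol x)"
    using h_far by blast
  obtain D where D: "D \<ge> 0" "\<And>x :: 'a. norm x \<ge> 1 \<Longrightarrow> fund_sol_exp x \<le> D"
    using fund_sol_exp_bounded[OF dim] by blast
  have "h x \<le> ennreal (C * D * exp (- norm x))" if "norm x \<ge> max 1 (2 * R)" for x
  proof -
    have "h x \<le> ennreal (C * fund_sol x)"
      using that by (intro C(2)) auto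
    also have "C * fund_sol x \<le> C * (exp (- norm x) * D)"
      unfolding fund_sol_eq using that C(1) by (intro mult_left_mono D(2)) auto
    then have "ennreal (C * fund_sol x) \<le> ennreal (C * D * exp (- norm x))"
      by (intro ennreal_leI) (simp add: mult_ac)
    finally show ?thesis .
  qed
  then show ?thesis
    using C(1) D(1) by (intro exI[of _ "C * D"] conjI exI[of _ "max 1 (2 * R)"]) auto
qed

text \<open>
  With the weight \<open>h\<^sup>p\<^sup>-\<^sup>1\<close> the three-point estimate gives \<open>G * h\<^sup>p \<le> D h\<close>, so that
  \<open>2 \<kappa> h\<close> is a supersolution for small \<open>\<kappa>\<close>.
\<close>

lemma ex_supersolution: "\<exists>\<kappa>>0. AE x in lborel. step \<kappa> (\<lambda>y. ennreal (2 * \<kappa>) * h y) x \<le> ennreal (2 * \<kappa>) * h x"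
proof -
  define w where "w z = enn2real (h z) powr (p - 1)" for z
  have [measurable]: "w \<in> borel_measurable borel"
    unfolding w_def[abs_def] by measurable
  have w_nonneg: "w x \<ge> 0" for x by (simp add: w_def)
  \<comment> \<open>Chosen so that w^\<sigma> = h^q; the two lower bounds on \<open>q\<close> become
    \<sigma> > 1 and \<sigma> > N / 2.\<close>
  define \<sigma> where "\<sigma> = q / (p - 1)"
  have \<sigma>: "\<sigma> > 1" "\<sigma> > real DIM('a) / 2"
    using p_gt_1 q_gt by (auto simp: \<sigma>_def field_simps)
  have w\<sigma>: "(\<integral>\<^sup>+x. ennreal (w x powr \<sigma>) \<partial>lborel) < \<infinity>"
  proof -
    have "(\<integral>\<^sup>+x. ennreal (w x powr \<sigma>) \<partial>lborel) \<le> (\<integral>\<^sup>+x. epow q (h x) \<partial>lborel)"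
      using p_gt_1 by (intro nn_integral_mono) (auto simp: w_def \<sigma>_def powr_powr epow_def)
    then show ?thesis using h_Lq by (rule le_less_trans)
  qed
  obtain C \<rho> where C: "C \<ge> 0" "\<And>x. norm x \<ge> \<rho> \<Longrightarrow> h x \<le> ennreal (C * exp (- norm x))"
    using h_far_exp by blast
  \<comment> \<open>Near the origin w \<le> 1 + h^q; far out \<open>h\<close> decays exponentially,
    hence so does \<open>w\<close>.\<close>
  have w1: "(\<integral>\<^sup>+x. ennreal (w x) \<partial>lborel) < \<infinity>"
  proof -
    have "(\<integral>\<^sup>+x. ennreal (w x) \<partial>lborel) \<le> (\<integral>\<^sup>+x. indicator (ball 0 \<rho>) x + epow q (h x) +
        ennreal (C powr (p - 1)) * ennreal (exp (- (p - 1) * norm x)) \<partial>lborel)"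
    proof (rule nn_integral_mono)
      fix x :: 'a
      show "ennreal (w x) \<le> indicator (ball 0 \<rho>) x + epow q (h x) + ennreal (C powr (p - 1)) * ennreal (exp (- (p - 1) * norm x))"
      proof (cases "norm x < \<rho>")
        case True
        have "ennreal (w x) \<le> epow (p - 1) (h x)"
          by (auto simp: w_def epow_def)
        also have "\<dots> \<le> 1 + epow q (h x)"
          using p_gt_1 q_gt by (intro epow_le_one_plus) auto
        finally show ?thesis
          using True by (simp add: add_increasing2)
      next
        case False
        have "enn2real (h x) \<le> C * exp (- norm x)"
          using C False by (intro enn2real_leI) auto
        then have "w x \<le> (C * exp (- norm x)) powr (p - 1)"
          unfolding w_def using p_gt_1 by (intro powr_mono2) auto
        also have "\<dots> = C powr (p - 1) * exp (- (p - 1) * norm x)"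
          using C(1) by (simp add: powr_mult exp_powr_real algebra_simps)
        finally have "ennreal (w x) \<le> ennreal (C powr (p - 1)) * ennreal (exp (- (p - 1) * norm x))"
          by (simp add: ennreal_leI flip: ennreal_mult)
        then show ?thesis
          by (rule order_trans) simp
      qed
    qed
    also have "\<dots> = emeasure lborel (ball 0 \<rho> :: 'a set) + (\<integral>\<^sup>+x. epow q (h x) \<partial>lborel) +
        ennreal (C powr (p - 1)) * (\<integral>\<^sup>+x. ennreal (exp (- (p - 1) * norm x)) \<partial>(lborel :: 'a measure))"
      by (simp add: nn_integral_add nn_integral_cmult)
    also have "\<dots> < \<infinity>"
      using nn_integral_exp_norm[of "p - 1", where 'a = 'a] p_gt_1 h_Lq emeasure_lborel_ball_finite[of 0 \<rho>]
      by (simp add: ennreal_mult_less_top)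
    finally show ?thesis .
  qed
  obtain M where M: "M \<ge> 0" "\<And>x. (\<integral>\<^sup>+z. ennreal (fund_sol_exp (x - z) * w z) \<partial>lborel) \<le> ennreal M"
    using fund_sol_exp_weight_bounded[OF dim \<sigma> _ w_nonneg w1 w\<sigma>] by auto
  obtain D where D: "D \<ge> 0" "AE x in lborel. fund_conv (\<lambda>z. ennreal (w z) * h z) x \<le> ennreal D * h x"
    using fund_conv_weight_h_le[OF _ w_nonneg M] by auto
  \<comment> \<open>The parameter is the positive root of (2 \<kappa>)^p (D + 1) = \<kappa>, which
    exists because p > 1; using D + 1 instead of D avoids dividing by 0.\<close>
  define A where "A = 2 powr p * (D + 1)"
  have "A > 0" using D(1) by (simp add: A_def)
  define \<kappa> where "\<kappa> = (1 / A) powr (1 / (p - 1))"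
  have "\<kappa> > 0" using \<open>A > 0\<close> by (simp add: \<kappa>_def)
  have "\<kappa> powr (p - 1) = 1 / A"
    using p_gt_1 \<open>A > 0\<close> by (simp add: \<kappa>_def powr_powr)
  then have "A * \<kappa> powr (p - 1) = 1"
    using \<open>A > 0\<close> by simp
  moreover have "(2 * \<kappa>) powr p * (D + 1) = A * \<kappa> powr (p - 1) * \<kappa>"
    using \<open>\<kappa> > 0\<close> by (simp add: A_def powr_mult powr_diff)
  ultimately have "(2 * \<kappa>) powr p * (D + 1) = \<kappa>"
    by simp
  then have small: "(2 * \<kappa>) powr p * D \<le> \<kappa>"
    by (simp add: distrib_left) (smt (verit) powr_ge_zero)
  have "AE x in lborel. step \<kappa> (\<lambda>y. ennreal (2 * \<kappa>) * h y) x \<le> ennreal (2 * \<kappa>) * h x"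
    using D(2)
  proof eventually_elim
    case (elim x)
    have "fund_conv (\<lambda>y. epow p (ennreal (2 * \<kappa>) * h y)) x =
        fund_conv (\<lambda>y. ennreal ((2 * \<kappa>) powr p) * (ennreal (w y) * h y)) x"
    proof (rule fund_conv_cong_AE)
      show "AE y in lborel. epow p (ennreal (2 * \<kappa>) * h y) = ennreal ((2 * \<kappa>) powr p) * (ennreal (w y) * h y)"
        using h_finite
      proof eventually_elim
        case (elim y)
        \<comment> \<open>This factorisation h^p = w h needs \<open>h\<close> finite: where
          \<open>h\<close> is infinite, \<open>w\<close> is 0 by the default of
          \<open>enn2real\<close>.\<close>
        have "epow p (h y) = epow (p - 1) (h y) * h y"
          using epow_add[of "p - 1" 1 "h y"] p_gt_1 by simp
        moreover have "epow (p - 1) (h y) = ennreal (w y)"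
          using elim by (simp add: epow_def w_def)
        ultimately show ?case
          using p_gt_1 \<open>\<kappa> > 0\<close> by (simp add: epow_mult epow_ennreal)
      qed
    qed
    also have "\<dots> = ennreal ((2 * \<kappa>) powr p) * fund_conv (\<lambda>y. ennreal (w y) * h y) x"
      unfolding fund_conv_def mult.left_commute[of "ennreal (fund_sol _)" "ennreal ((2 * \<kappa>) powr p)"]
      by (rule nn_integral_cmult) measurable
    also have "\<dots> \<le> ennreal ((2 * \<kappa>) powr p) * (ennreal D * h x)"
      using elim by (rule mult_left_mono) simp
    also have "\<dots> = ennreal ((2 * \<kappa>) powr p * D) * h x"
      using D(1) by (simp add: ennreal_mult mult.assoc)
    also have "\<dots> \<le> ennreal \<kappa> * h x"
      using small by (intro mult_right_mono ennreal_leI) auto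
    finally have "step \<kappa> (\<lambda>y. ennreal (2 * \<kappa>) * h y) x \<le> ennreal \<kappa> * h x + ennreal \<kappa> * h x"
      unfolding step_def by (rule add_left_mono)
    also have "\<dots> = (ennreal \<kappa> + ennreal \<kappa>) * h x"
      by (rule distrib_right[symmetric])
    also have "ennreal \<kappa> + ennreal \<kappa> = ennreal (2 * \<kappa>)"
      using \<open>\<kappa> > 0\<close> by (subst ennreal_plus[symmetric]) auto
    finally show ?case .
  qed
  with \<open>\<kappa> > 0\<close> show ?thesis by blast
qed

subsection \<open>Decay\<close>

text \<open>The part of membership in C_0 + L^q_c that involves no continuity and therefore passes
  to smaller functions; it carries information from a supersolution to the fixed point below
  it.\<close>

definition Lq_loc_vanishing :: "('a \<Rightarrow> ennreal) \<Rightarrow> bool" where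
  "Lq_loc_vanishing U \<longleftrightarrow>
     (\<forall>\<rho>. (\<integral>\<^sup>+x. epow q (U x) * indicator (ball 0 \<rho>) x \<partial>lborel) < \<infinity>) \<and>
     (\<forall>\<epsilon>>0. \<exists>\<rho>. AE x in lborel. norm x \<ge> \<rho> \<longrightarrow> U x \<le> ennreal \<epsilon>)"

lemma Lq_loc_vanishing_mono:
  assumes "Lq_loc_vanishing V" and le: "AE x in lborel. U x \<le> V x"
  shows "Lq_loc_vanishing U"
  unfolding Lq_loc_vanishing_def
proof (intro conjI allI impI)
  fix \<rho> :: real
  have "(\<integral>\<^sup>+x. epow q (U x) * indicator (ball 0 \<rho>) x \<partial>lborel) \<le> (\<integral>\<^sup>+x. epow q (V x) * indicator (ball 0 \<rho>) x \<partial>lborel)"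
    using le p_gt_1 q_gt by (intro nn_integral_mono_AE) (auto elim!: eventually_mono intro!: mult_right_mono epow_mono)
  also have "\<dots> < \<infinity>"
    using assms(1) by (simp add: Lq_loc_vanishing_def)
  finally show "(\<integral>\<^sup>+x. epow q (U x) * indicator (ball 0 \<rho>) x \<partial>lborel) < \<infinity>" .
next
  fix \<epsilon> :: real assume "\<epsilon> > 0"
  then obtain \<rho> where \<rho>: "AE x in lborel. norm x \<ge> \<rho> \<longrightarrow> V x \<le> ennreal \<epsilon>"
    using assms(1) unfolding Lq_loc_vanishing_def by blast
  have "AE x in lborel. norm x \<ge> \<rho> \<longrightarrow> U x \<le> ennreal \<epsilon>"
    using \<rho> le by eventually_elim (auto intro: order_trans)
  then show "\<exists>\<rho>. AE x in lborel. norm x \<ge> \<rho> \<longrightarrow> U x \<le> ennreal \<epsilon>" by blast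
qed

lemma Lq_loc_vanishing_Lp:
  assumes "Lq_loc_vanishing U" and [measurable]: "U \<in> borel_measurable borel"
  shows "(\<integral>\<^sup>+x. epow p (U x) * indicator (ball 0 \<rho>) x \<partial>lborel) < \<infinity>"
proof -
  have "(\<integral>\<^sup>+x. epow p (U x) * indicator (ball 0 \<rho>) x \<partial>lborel) \<le>
      (\<integral>\<^sup>+x. indicator (ball 0 \<rho>) x + epow q (U x) * indicator (ball 0 \<rho>) x \<partial>lborel)"
  proof (rule nn_integral_mono)
    fix x
    have "epow p (U x) * indicator (ball 0 \<rho>) x \<le> (1 + epow q (U x)) * indicator (ball 0 \<rho>) x"
      using p_gt_1 q_gt by (intro mult_right_mono epow_le_one_plus) auto
    then show "epow p (U x) * indicator (ball 0 \<rho>) x \<le> indicator (ball 0 \<rho>) x + epow q (U x) * indicator (ball 0 \<rho>) x"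
      by (simp add: distrib_right)
  qed
  also have "\<dots> = emeasure lborel (ball 0 \<rho> :: 'a set) + (\<integral>\<^sup>+x. epow q (U x) * indicator (ball 0 \<rho>) x \<partial>lborel)"
    by (simp add: nn_integral_add)
  also have "\<dots> < \<infinity>"
    using assms(1) emeasure_lborel_ball_finite[of "0::'a" \<rho>] by (simp add: Lq_loc_vanishing_def)
  finally show ?thesis .
qed

lemma fund_conv_add:
  assumes [measurable]: "f \<in> borel_measurable borel" "g \<in> borel_measurable borel"
  shows "fund_conv (\<lambda>y. f y + g y) (x :: 'a) = fund_conv f x + fund_conv g x"
  unfolding fund_conv_def by (simp add: distrib_left nn_integral_add)

lemma fund_conv_cmult:
  assumes [measurable]: "f \<in> borel_measurable borel"
  shows "fund_conv (\<lambda>y. c * f y) (x :: 'a) = c * fund_conv f x"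
  unfolding fund_conv_def by (simp add: mult.left_commute[of _ c] nn_integral_cmult)

lemma step_split:
  assumes [measurable]: "U \<in> borel_measurable borel"
  shows "step \<kappa> U x = ennreal \<kappa> * h x + fund_conv (\<lambda>y. epow p (U y) * indicator (ball 0 \<rho>) y) x +
    fund_conv (\<lambda>y. epow p (U y) * indicator (- ball 0 \<rho>) y) x"
proof -
  have "fund_conv (\<lambda>y. epow p (U y)) x =
    fund_conv (\<lambda>y. epow p (U y) * indicator (ball 0 \<rho>) y + epow p (U y) * indicator (- ball 0 \<rho>) y) x"
    by (rule fund_conv_cong_AE) (auto simp: indicator_def)
  also have "\<dots> = fund_conv (\<lambda>y. epow p (U y) * indicator (ball 0 \<rho>) y) x +
      fund_conv (\<lambda>y. epow p (U y) * indicator (- ball 0 \<rho>) y) x"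
    by (rule fund_conv_add) measurable
  finally show ?thesis
    by (simp add: step_def add.assoc)
qed

lemma fund_conv_ball_le:
  assumes [measurable]: "f \<in> borel_measurable borel"
    and fin: "(\<integral>\<^sup>+y. f y * indicator (ball 0 \<rho>) y \<partial>lborel) < \<infinity>" and "\<rho> > 0"
  shows "\<exists>A\<ge>0. \<forall>x :: 'a. norm x \<ge> 2 * \<rho> \<longrightarrow> fund_conv (\<lambda>y. f y * indicator (ball 0 \<rho>) y) x \<le> ennreal (A * fund_sol x)"
proof -
  obtain C where C: "C \<ge> 0"
    "\<And>x y :: 'a. x \<noteq> 0 \<Longrightarrow> 2 * norm y \<le> norm x \<Longrightarrow> fund_sol (x - y) \<le> C * exp (norm y) * fund_sol x"
    using fund_sol_diff_le[OF dim] by blast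
  define i where "i = enn2real (\<integral>\<^sup>+y. f y * indicator (ball 0 \<rho>) y \<partial>lborel)"
  have i: "(\<integral>\<^sup>+y. f y * indicator (ball 0 \<rho>) y \<partial>lborel) = ennreal i" "i \<ge> 0"
    using fin by (auto simp: i_def)
  have "fund_conv (\<lambda>y. f y * indicator (ball 0 \<rho>) y) x \<le> ennreal (C * exp \<rho> * i * fund_sol x)"
    if x: "norm x \<ge> 2 * \<rho>" for x :: 'a
  proof -
    have "fund_conv (\<lambda>y. f y * indicator (ball 0 \<rho>) y) x \<le>
        (\<integral>\<^sup>+y. ennreal (C * exp \<rho> * fund_sol x) * (f y * indicator (ball 0 \<rho>) y) \<partial>lborel)"
      unfolding fund_conv_def
    proof (rule nn_integral_mono)
      fix y :: 'a
      show "ennreal (fund_sol (x - y)) * (f y * indicator (ball 0 \<rho>) y) \<le>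
          ennreal (C * exp \<rho> * fund_sol x) * (f y * indicator (ball 0 \<rho>) y)"
      proof (cases "y \<in> ball 0 \<rho>")
        case True
        have "fund_sol (x - y) \<le> C * exp (norm y) * fund_sol x"
          using True x \<open>\<rho> > 0\<close> by (intro C(2)) auto
        also have "\<dots> \<le> C * exp \<rho> * fund_sol x"
          using True C(1) by (intro mult_right_mono mult_left_mono) auto
        finally show ?thesis
          by (intro mult_right_mono ennreal_leI) auto
      qed simp
    qed
    also have "\<dots> = ennreal (C * exp \<rho> * fund_sol x) * ennreal i"
      by (subst i(1)[symmetric], rule nn_integral_cmult) measurable
    also have "\<dots> = ennreal (C * exp \<rho> * i * fund_sol x)"
      using C(1) i(2) by (simp add: mult_ac flip: ennreal_mult)
    finally show ?thesis .
  qed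
  then show ?thesis
    using C(1) i(2) by (intro exI[of _ "C * exp \<rho> * i"]) auto
qed

text \<open>All sources inside radius \<open>\<rho>\<close>, including \<open>\<mu>\<close> since
  \<open>\<rho> \<ge> R\<close>, act from distance \<open>2 * \<rho>\<close> on like a point source.
  Finite total mass comes from U^q being locally integrable and p < q.\<close>

lemma near_part_le:
  assumes "Lq_loc_vanishing U" and [measurable]: "U \<in> borel_measurable borel" and "\<kappa> \<ge> 0" "\<rho> \<ge> R"
  shows "\<exists>A\<ge>0. \<forall>x. norm x \<ge> 2 * \<rho> \<longrightarrow>
    ennreal \<kappa> * h x + fund_conv (\<lambda>y. epow p (U y) * indicator (ball 0 \<rho>) y) x \<le> ennreal (A * fund_sol x)"
proof -
  have "\<rho> > 0" using assms R_pos by simp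
  obtain C where C: "C \<ge> 0" "\<And>x. norm x \<ge> 2 * R \<Longrightarrow> h x \<le> ennreal (C * fund_sol x)"
    using h_far by blast
  obtain A where A: "A \<ge> 0" "\<And>x. norm x \<ge> 2 * \<rho> \<Longrightarrow>
      fund_conv (\<lambda>y. epow p (U y) * indicator (ball 0 \<rho>) y) x \<le> ennreal (A * fund_sol x)"
    using fund_conv_ball_le[of "\<lambda>y. epow p (U y)" \<rho>] Lq_loc_vanishing_Lp[OF assms(1,2)] \<open>\<rho> > 0\<close> by auto
  have "ennreal \<kappa> * h x + fund_conv (\<lambda>y. epow p (U y) * indicator (ball 0 \<rho>) y) x \<le> ennreal ((\<kappa> * C + A) * fund_sol x)"
    if "norm x \<ge> 2 * \<rho>" for x
  proof -
    have "ennreal \<kappa> * h x + fund_conv (\<lambda>y. epow p (U y) * indicator (ball 0 \<rho>) y) x \<le>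
        ennreal \<kappa> * ennreal (C * fund_sol x) + ennreal (A * fund_sol x)"
      using that assms(4) by (intro add_mono mult_left_mono C(2) A(2)) auto
    also have "\<dots> = ennreal ((\<kappa> * C + A) * fund_sol x)"
      using C(1) A(1) \<open>\<kappa> \<ge> 0\<close> by (simp add: distrib_right mult.assoc ennreal_mult)
    finally show ?thesis .
  qed
  then show ?thesis
    using A(1) C(1) \<open>\<kappa> \<ge> 0\<close> by (intro exI[of _ "\<kappa> * C + A"]) auto
qed

text \<open>The triangle inequality moves the exponential from \<open>y\<close> to \<open>x\<close>
  at the cost of exp (\<theta> |x - y|), against which the kernel is integrable since \<theta> < 1.
  A constant uniform in \<open>\<tau>\<close> serves both the decaying part
  (\<open>\<tau> = \<theta>\<close>) and constants (\<open>\<tau> = 0\<close>).\<close>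

lemma fund_conv_exp_le:
  assumes "\<theta> < 1"
  shows "\<exists>c\<ge>0. \<forall>\<tau> x. 0 \<le> \<tau> \<longrightarrow> \<tau> \<le> \<theta> \<longrightarrow>
    fund_conv (\<lambda>y. ennreal (exp (- \<tau> * norm y))) (x :: 'a) \<le> ennreal (c * exp (- \<tau> * norm x))"
proof -
  define T where "T = (\<integral>\<^sup>+z. ennreal (fund_sol z * exp (\<theta> * norm z)) \<partial>(lborel :: 'a measure))"
  have "fund_sol z * exp (\<theta> * norm z) = fund_sol_exp z * exp (- (1 - \<theta>) * norm z)" for z :: 'a
    by (simp add: fund_sol_eq algebra_simps flip: exp_add)
  then have "T < \<infinity>"
    unfolding T_def using nn_integral_fund_sol_exp_weight[OF dim, of "1 - \<theta>"] assms by simp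
  then have T: "T = ennreal (enn2real T)" by simp
  have "fund_conv (\<lambda>y. ennreal (exp (- \<tau> * norm y))) x \<le> ennreal (enn2real T * exp (- \<tau> * norm x))"
    if \<tau>: "0 \<le> \<tau>" "\<tau> \<le> \<theta>" for \<tau> and x :: 'a
  proof -
    have "fund_conv (\<lambda>y. ennreal (exp (- \<tau> * norm y))) x \<le>
        (\<integral>\<^sup>+y. ennreal (exp (- \<tau> * norm x)) * ennreal (fund_sol (x - y) * exp (\<theta> * norm (x - y))) \<partial>lborel)"
      unfolding fund_conv_def
    proof (rule nn_integral_mono)
      fix y :: 'a
      have "\<tau> * norm x \<le> \<tau> * (norm (x - y) + norm y)"
        using norm_triangle_ineq[of "x - y" y] \<tau> by (intro mult_left_mono) auto
      also have "\<dots> \<le> \<theta> * norm (x - y) + \<tau> * norm y"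
        using \<tau> by (simp add: distrib_left mult_right_mono)
      finally have "exp (- \<tau> * norm y) \<le> exp (- \<tau> * norm x) * exp (\<theta> * norm (x - y))"
        by (simp flip: exp_add)
      then have "fund_sol (x - y) * exp (- \<tau> * norm y) \<le> fund_sol (x - y) * (exp (- \<tau> * norm x) * exp (\<theta> * norm (x - y)))"
        by (rule mult_left_mono) simp
      then have "ennreal (fund_sol (x - y) * exp (- \<tau> * norm y)) \<le>
          ennreal (exp (- \<tau> * norm x) * (fund_sol (x - y) * exp (\<theta> * norm (x - y))))"
        by (intro ennreal_leI) (simp add: mult_ac)
      then show "ennreal (fund_sol (x - y)) * ennreal (exp (- \<tau> * norm y)) \<le>
          ennreal (exp (- \<tau> * norm x)) * ennreal (fund_sol (x - y) * exp (\<theta> * norm (x - y)))"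
        by (simp add: ennreal_mult)
    qed
    also have "\<dots> = ennreal (exp (- \<tau> * norm x)) * (\<integral>\<^sup>+y. ennreal (fund_sol (x - y) * exp (\<theta> * norm (x - y))) \<partial>lborel)"
      by (rule nn_integral_cmult) measurable
    also have "(\<integral>\<^sup>+y. ennreal (fund_sol (x - y) * exp (\<theta> * norm (x - y))) \<partial>lborel) = T"
      unfolding T_def by (rule nn_integral_lborel_reflect) measurable
    also have "ennreal (exp (- \<tau> * norm x)) * T = ennreal (enn2real T * exp (- \<tau> * norm x))"
      by (subst T) (simp add: mult.commute flip: ennreal_mult)
    finally show ?thesis .
  qed
  then show ?thesis
    by (intro exI[of _ "enn2real T"]) auto
qed

text \<open>The nonlinearity treated as a linear term with small coefficient: p - 1 of the powers
  use the bound \<open>\<epsilon>\<close>, the remaining one uses the bound \<open>b\<close> to be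
  improved.\<close>

lemma epow_le_mult:
  assumes "U \<le> ennreal \<epsilon>" "U \<le> ennreal b" "\<epsilon> \<ge> 0" "b \<ge> 0"
  shows "epow p U \<le> ennreal (\<epsilon> powr (p - 1) * b)"
proof -
  obtain r where r: "U = ennreal r" "r \<ge> 0"
    using assms(1) by (cases U) (auto simp: top_unique)
  then have le: "r \<le> \<epsilon>" "r \<le> b" using assms by auto
  have "r powr p = r powr (p - 1) * r"
    using r by (cases "r = 0") (auto simp: powr_diff)
  also have "\<dots> \<le> \<epsilon> powr (p - 1) * b"
    using le r p_gt_1 by (intro mult_mono powr_mono2) auto
  finally show ?thesis
    using r by (simp add: epow_ennreal ennreal_leI)
qed

text \<open>
  Far out, \<open>u\<^sup>p \<le> \<epsilon>\<^sup>p\<^sup>-\<^sup>1 u\<close> with \<open>\<epsilon>\<close> small, and iterating the integral equation halves the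
  constant part of the bound \<open>2 A exp (- \<theta> \<bar>x\<bar>) + \<epsilon> / 2\<^sup>k\<close>.
\<close>

lemma exponential_decay:
  assumes tame: "Lq_loc_vanishing U" and [measurable]: "U \<in> borel_measurable borel" and "\<kappa> \<ge> 0"
    and eq: "\<And>x. U x = step \<kappa> U x" and \<theta>: "0 < \<theta>" "\<theta> < 1"
  shows "\<exists>A\<ge>0. \<exists>\<rho>. AE x in lborel. norm x \<ge> \<rho> \<longrightarrow> U x \<le> ennreal (A * exp (- \<theta> * norm x))"
proof -
  obtain c where c: "c \<ge> 0" "\<And>\<tau> x. 0 \<le> \<tau> \<Longrightarrow> \<tau> \<le> \<theta> \<Longrightarrow>
      fund_conv (\<lambda>y. ennreal (exp (- \<tau> * norm y))) (x :: 'a) \<le> ennreal (c * exp (- \<tau> * norm x))"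
    using fund_conv_exp_le[OF \<theta>(2)] by blast
  \<comment> \<open>This makes \<open>\<epsilon> powr (p - 1) * c\<close> at most 1 / 2, so one
    application of the far part of the integral halves the current bound.\<close>
  define \<epsilon> where "\<epsilon> = (1 / (2 * (c + 1))) powr (1 / (p - 1))"
  have "\<epsilon> > 0" using c(1) by (simp add: \<epsilon>_def)
  have \<epsilon>c: "\<epsilon> powr (p - 1) * c \<le> 1 / 2"
    using c(1) p_gt_1 by (simp add: \<epsilon>_def powr_powr field_simps)
  obtain \<rho>0 where \<rho>0: "AE x in lborel. norm x \<ge> \<rho>0 \<longrightarrow> U x \<le> ennreal \<epsilon>"
    using tame \<open>\<epsilon> > 0\<close> unfolding Lq_loc_vanishing_def by blast
  define \<rho> where "\<rho> = max \<rho>0 (max 1 R)"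
  have \<rho>: "\<rho> \<ge> \<rho>0" "\<rho> \<ge> 1" "\<rho> \<ge> R" by (auto simp: \<rho>_def)
  obtain A0 where A0: "A0 \<ge> 0" "\<And>x. norm x \<ge> 2 * \<rho> \<Longrightarrow>
      ennreal \<kappa> * h x + fund_conv (\<lambda>y. epow p (U y) * indicator (ball 0 \<rho>) y) x \<le> ennreal (A0 * fund_sol x)"
    using near_part_le[OF tame assms(2,3) \<rho>(3)] by blast
  obtain D where D: "D \<ge> 0" "\<And>x :: 'a. norm x \<ge> 1 \<Longrightarrow> fund_sol_exp x \<le> D"
    using fund_sol_exp_bounded[OF dim] by blast
  define A where "A = max (A0 * D) (\<epsilon> * exp (\<theta> * (2 * \<rho>)))"
  have A: "A \<ge> A0 * D" "A \<ge> \<epsilon> * exp (\<theta> * (2 * \<rho>))" by (auto simp: A_def)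
  have "A \<ge> 0" using A(1) A0(1) D(1) by (smt (verit) mult_nonneg_nonneg)
  \<comment> \<open>The factor 2 makes the exponential part stationary: near part A plus half of 2 A
    is again 2 A.\<close>
  let ?b = "\<lambda>k x. 2 * A * exp (- \<theta> * norm x) + \<epsilon> / 2 ^ k"
  have bpos: "?b k x \<ge> 0" for k and x :: 'a
    using \<open>A \<ge> 0\<close> \<open>\<epsilon> > 0\<close> by simp
  have P: "AE x in lborel. norm x \<ge> \<rho> \<longrightarrow> U x \<le> ennreal (?b k x)" for k
  proof (induction k)
    case 0
    show ?case
      using \<rho>0
    proof eventually_elim
      case (elim x)
      have "ennreal \<epsilon> \<le> ennreal (?b 0 x)"
        using \<open>A \<ge> 0\<close> by (intro ennreal_leI) simp
      then show ?case using elim \<rho>(1) by (auto intro: order_trans)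
    qed
  next
    case (Suc k)
    have far: "fund_conv (\<lambda>y. epow p (U y) * indicator (- ball 0 \<rho>) y) x \<le> ennreal (?b k x / 2)" for x
    proof -
      let ?e = "\<epsilon> powr (p - 1)"
      have "fund_conv (\<lambda>y. epow p (U y) * indicator (- ball 0 \<rho>) y) x \<le>
        fund_conv (\<lambda>y. ennreal (?e * (2 * A)) * ennreal (exp (- \<theta> * norm y)) + ennreal (?e * (\<epsilon> / 2 ^ k)) * ennreal (exp (- 0 * norm y))) x"
      proof (rule fund_conv_mono_AE)
        show "AE y in lborel. epow p (U y) * indicator (- ball 0 \<rho>) y \<le>
            ennreal (?e * (2 * A)) * ennreal (exp (- \<theta> * norm y)) + ennreal (?e * (\<epsilon> / 2 ^ k)) * ennreal (exp (- 0 * norm y))"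
          using \<rho>0 Suc
        proof eventually_elim
          case (elim y)
          show ?case
          proof (cases "norm y \<ge> \<rho>")
            case True
            have "epow p (U y) \<le> ennreal (?e * ?b k y)"
              using elim True \<rho>(1) \<open>\<epsilon> > 0\<close> bpos by (intro epow_le_mult) auto
            also have "\<dots> = ennreal (?e * (2 * A)) * ennreal (exp (- \<theta> * norm y)) + ennreal (?e * (\<epsilon> / 2 ^ k)) * ennreal (exp (- 0 * norm y))"
              using \<open>A \<ge> 0\<close> \<open>\<epsilon> > 0\<close> by (simp add: distrib_left mult.assoc flip: ennreal_mult ennreal_plus)
            finally show ?thesis
              using True by (simp add: indicator_def)
          qed simp
        qed
      qed
      also have "\<dots> = fund_conv (\<lambda>y. ennreal (?e * (2 * A)) * ennreal (exp (- \<theta> * norm y))) x +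
          fund_conv (\<lambda>y. ennreal (?e * (\<epsilon> / 2 ^ k)) * ennreal (exp (- 0 * norm y))) x"
        by (rule fund_conv_add) measurable
      also have "\<dots> = ennreal (?e * (2 * A)) * fund_conv (\<lambda>y. ennreal (exp (- \<theta> * norm y))) x +
          ennreal (?e * (\<epsilon> / 2 ^ k)) * fund_conv (\<lambda>y. ennreal (exp (- 0 * norm y))) x"
        by (intro arg_cong2[where f = "(+)"] fund_conv_cmult) measurable
      also have "\<dots> \<le> ennreal (?e * (2 * A)) * ennreal (c * exp (- \<theta> * norm x)) +
          ennreal (?e * (\<epsilon> / 2 ^ k)) * ennreal (c * exp (- 0 * norm x))"
        using \<theta> by (intro add_mono mult_left_mono c(2)) auto
      also have "\<dots> = ennreal ((?e * c) * ?b k x)"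
        using \<open>A \<ge> 0\<close> \<open>\<epsilon> > 0\<close> c(1)
        by (simp add: algebra_simps flip: ennreal_mult ennreal_plus)
      also have "(?e * c) * ?b k x \<le> 1 / 2 * ?b k x"
        using \<epsilon>c bpos by (rule mult_right_mono)
      then have "ennreal ((?e * c) * ?b k x) \<le> ennreal (?b k x / 2)"
        by (intro ennreal_leI) simp
      finally show ?thesis .
    qed
    show ?case
      using \<rho>0
    proof eventually_elim
      case (elim x)
      show ?case
      proof
        assume "norm x \<ge> \<rho>"
        show "U x \<le> ennreal (?b (Suc k) x)"
        proof (cases "norm x \<ge> 2 * \<rho>")
          case True
          have "A0 * fund_sol x \<le> A0 * (exp (- norm x) * D)"
            unfolding fund_sol_eq using True \<rho>(2) A0(1) by (intro mult_left_mono D(2)) auto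
          also have "\<dots> \<le> A * exp (- norm x)"
            using mult_right_mono[OF A(1), of "exp (- norm x)"] by (simp add: mult_ac)
          also have "\<dots> \<le> A * exp (- \<theta> * norm x)"
            using \<theta> \<open>A \<ge> 0\<close> mult_right_mono[of \<theta> 1 "norm x"] by (intro mult_left_mono) auto
          finally have near: "A0 * fund_sol x \<le> A * exp (- \<theta> * norm x)" .
          have "U x \<le> ennreal (A0 * fund_sol x) + ennreal (?b k x / 2)"
            by (subst eq, subst step_split[where \<rho> = \<rho>], measurable) (intro add_mono A0(2) True far)
          also have "\<dots> = ennreal (A0 * fund_sol x + ?b k x / 2)"
            using A0(1) bpos[of x k] by (subst ennreal_plus) auto
          also have "\<dots> \<le> ennreal (?b (Suc k) x)"
            using near by (intro ennreal_leI) (simp add: field_simps)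
          finally show ?thesis .
        next
          case False
          have "\<epsilon> * exp (\<theta> * (2 * \<rho>)) * exp (- \<theta> * norm x) \<le> A * exp (- \<theta> * norm x)"
            by (intro mult_right_mono A) simp
          moreover have "1 \<le> exp (\<theta> * (2 * \<rho>)) * exp (- \<theta> * norm x)"
            using False \<theta> mult_left_mono[of "norm x" "2 * \<rho>" \<theta>] by (simp flip: exp_add)
          then have "\<epsilon> * 1 \<le> \<epsilon> * (exp (\<theta> * (2 * \<rho>)) * exp (- \<theta> * norm x))"
            using \<open>\<epsilon> > 0\<close> by (intro mult_left_mono) auto
          moreover have "0 \<le> A * exp (- \<theta> * norm x)" "0 \<le> \<epsilon> / 2 ^ Suc k"
            using \<open>A \<ge> 0\<close> \<open>\<epsilon> > 0\<close> by auto
          ultimately have "\<epsilon> \<le> ?b (Suc k) x"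
            unfolding mult.assoc by linarith
          then have "ennreal \<epsilon> \<le> ennreal (?b (Suc k) x)"
            by (rule ennreal_leI)
          then show ?thesis
            using elim \<open>norm x \<ge> \<rho>\<close> \<rho>(1) by (auto intro: order_trans)
        qed
      qed
    qed
  qed
  \<comment> \<open>A single null set serves for all k, so the limit can be taken pointwise.\<close>
  then have "AE x in lborel. \<forall>k. norm x \<ge> \<rho> \<longrightarrow> U x \<le> ennreal (?b k x)"
    by (subst AE_all_countable) blast
  then have "AE x in lborel. norm x \<ge> \<rho> \<longrightarrow> U x \<le> ennreal (2 * A * exp (- \<theta> * norm x))"
  proof eventually_elim
    case (elim x)
    have "(\<lambda>k. ?b k x) \<longlonglongrightarrow> 2 * A * exp (- \<theta> * norm x) + 0"
      by (intro tendsto_add tendsto_const LIMSEQ_divide_realpow_zero) auto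
    then have "(\<lambda>k. ennreal (?b k x)) \<longlonglongrightarrow> ennreal (2 * A * exp (- \<theta> * norm x))"
      by (intro tendsto_ennrealI) simp
    then show ?case
      using elim by (auto intro: LIMSEQ_le_const)
  qed
  then show ?thesis
    using \<open>A \<ge> 0\<close> by (intro exI[of _ "2 * A"] conjI exI[of _ \<rho>]) auto
qed

text \<open>With \<theta> p = 1 + 2 \<delta>, the source u^p is far out at most a multiple of exp (-
  (1 + 2 \<delta>) |y|), hence of exp (- \<delta> |y|) G(y) by the lower bound for \<open>G\<close>
  with loss \<delta>. The weighted convolution estimate with pole 0 then returns
  \<open>G\<close>.\<close>

lemma fund_sol_decay:
  assumes tame: "Lq_loc_vanishing U" and [measurable]: "U \<in> borel_measurable borel" and "\<kappa> \<ge> 0"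
    and eq: "\<And>x. U x = step \<kappa> U x"
  shows "\<exists>C\<ge>0. \<exists>\<rho>\<ge>1. \<forall>x. norm x \<ge> \<rho> \<longrightarrow> U x \<le> ennreal (C * fund_sol x)"
proof -
  \<comment> \<open>The midpoint between 1 / p and 1, so that \<theta> p = (p + 1) / 2.\<close>
  define \<theta> where "\<theta> = (1 + 1 / p) / 2"
  define \<delta> where "\<delta> = (p - 1) / 4"
  have "\<theta> > 0" "\<theta> < 1" and \<delta>: "\<delta> > 0" "\<theta> * p = 1 + \<delta> + \<delta>"
    using p_gt_1 by (auto simp: \<theta>_def \<delta>_def field_simps)
  then obtain A \<rho>1 where A: "A \<ge> 0" "AE x in lborel. norm x \<ge> \<rho>1 \<longrightarrow> U x \<le> ennreal (A * exp (- \<theta> * norm x))"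
    using exponential_decay[OF tame assms(2,3) eq] by blast
  define \<rho> where "\<rho> = max \<rho>1 (max 1 R)"
  have \<rho>: "\<rho> \<ge> \<rho>1" "\<rho> \<ge> 1" "\<rho> \<ge> R" by (auto simp: \<rho>_def)
  obtain c where c: "c > 0" "\<And>x :: 'a. norm x \<ge> 1 \<Longrightarrow> fund_sol x \<ge> c * exp (- (1 + \<delta>) * norm x)"
    using fund_sol_ge_exp[OF dim \<delta>(1)] by blast
  obtain A0 where A0: "A0 \<ge> 0" "\<And>x. norm x \<ge> 2 * \<rho> \<Longrightarrow>
      ennreal \<kappa> * h x + fund_conv (\<lambda>y. epow p (U y) * indicator (ball 0 \<rho>) y) x \<le> ennreal (A0 * fund_sol x)"
    using near_part_le[OF tame assms(2,3) \<rho>(3)] by blast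
  let ?w = "\<lambda>z :: 'a. exp (- \<delta> * norm z)"
  \<comment> \<open>Every positive power of the weight is integrable; N is a convenient exponent
    exceeding both 1 and N / 2.\<close>
  let ?\<sigma> = "real DIM('a)"
  have "(\<integral>\<^sup>+x. ennreal (?w x powr ?\<sigma>) \<partial>lborel) < \<infinity>"
    using nn_integral_exp_norm[of "\<delta> * ?\<sigma>", where 'a = 'a] \<delta>(1) dim by (simp add: exp_powr_real mult_ac)
  then obtain M where M: "M \<ge> 0" "\<And>x. (\<integral>\<^sup>+z. ennreal (fund_sol_exp (x - z) * ?w z) \<partial>lborel) \<le> ennreal M"
    using fund_sol_exp_weight_bounded[OF dim, of ?\<sigma> ?w] nn_integral_exp_norm[OF \<delta>(1), where 'a = 'a] dim by auto
  obtain C where C: "C \<ge> 0" "\<And>x y. x \<noteq> y \<Longrightarrow>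
    (\<integral>\<^sup>+z. ennreal (fund_sol (x - z) * ?w z * fund_sol (z - y)) \<partial>lborel) \<le> ennreal (C * M * fund_sol (x - y))"
    using fund_sol_convolution_le[OF dim] M by fastforce
  define K where "K = A powr p / c"
  have "K \<ge> 0" using c by (simp add: K_def)
  have far: "fund_conv (\<lambda>y. epow p (U y) * indicator (- ball 0 \<rho>) y) x \<le> ennreal (K * (C * M) * fund_sol x)"
    if "x \<noteq> 0" for x
  proof -
    have "fund_conv (\<lambda>y. epow p (U y) * indicator (- ball 0 \<rho>) y) x \<le>
        fund_conv (\<lambda>y. ennreal (K * ?w y * fund_sol y)) x"
    proof (rule fund_conv_mono_AE)
      show "AE y in lborel. epow p (U y) * indicator (- ball 0 \<rho>) y \<le> ennreal (K * ?w y * fund_sol y)"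
        using A(2)
      proof eventually_elim
        case (elim y)
        show ?case
        proof (cases "norm y \<ge> \<rho>")
          case True
          have "epow p (U y) \<le> epow p (ennreal (A * exp (- \<theta> * norm y)))"
            using elim True \<rho>(1) p_gt_1 by (intro epow_mono) auto
          also have "\<dots> = ennreal (A powr p * exp (- (\<theta> * p) * norm y))"
            using A(1) by (simp add: epow_ennreal powr_mult exp_powr_real mult_ac)
          also have "A powr p * exp (- (\<theta> * p) * norm y) = K * ?w y * (c * exp (- (1 + \<delta>) * norm y))"
            using c(1) unfolding \<delta>(2) by (simp add: K_def algebra_simps flip: exp_add)
          also have "ennreal \<dots> \<le> ennreal (K * ?w y * fund_sol y)"
            using True \<rho>(2) \<open>K \<ge> 0\<close> by (intro ennreal_leI mult_left_mono c(2)) auto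
          finally show ?thesis
            using True by (simp add: indicator_def)
        qed simp
      qed
    qed
    also have "\<dots> = ennreal K * (\<integral>\<^sup>+z. ennreal (fund_sol (x - z) * ?w z * fund_sol (z - 0)) \<partial>lborel)"
    proof -
      have "ennreal (fund_sol (x - y)) * ennreal (K * ?w y * fund_sol y) =
          ennreal K * ennreal (fund_sol (x - y) * ?w y * fund_sol (y - 0))" for y
        using \<open>K \<ge> 0\<close> by (simp add: mult_ac flip: ennreal_mult)
      then show ?thesis
        unfolding fund_conv_def by (simp only:) (rule nn_integral_cmult, measurable)
    qed
    also have "\<dots> \<le> ennreal K * ennreal (C * M * fund_sol (x - 0))"
      using that by (intro mult_left_mono C(2)) auto
    also have "\<dots> = ennreal (K * (C * M) * fund_sol x)"
      using \<open>K \<ge> 0\<close> C(1) M(1) by (simp add: mult_ac flip: ennreal_mult)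
    finally show ?thesis .
  qed
  have "U x \<le> ennreal ((A0 + K * (C * M)) * fund_sol x)" if "norm x \<ge> 2 * \<rho>" for x
  proof -
    have "x \<noteq> 0" using that \<rho>(2) by auto
    have "U x \<le> ennreal (A0 * fund_sol x) + ennreal (K * (C * M) * fund_sol x)"
      by (subst eq, subst step_split[where \<rho> = \<rho>], measurable) (intro add_mono A0(2) that far \<open>x \<noteq> 0\<close>)
    also have "\<dots> = ennreal ((A0 + K * (C * M)) * fund_sol x)"
      using A0(1) \<open>K \<ge> 0\<close> C(1) M(1) by (simp add: distrib_right)
    finally show ?thesis .
  qed
  moreover have "A0 + K * (C * M) \<ge> 0"
    using A0(1) \<open>K \<ge> 0\<close> C(1) M(1) by simp
  moreover have "2 * \<rho> \<ge> 1" using \<rho>(2) by simp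
  ultimately show ?thesis by blast
qed

end

section \<open>Regularity\<close>

lemma continuous_on_cutoff_mult:
  fixes f \<phi> :: "'a::real_normed_vector \<Rightarrow> real"
  assumes "continuous_on {x. r \<le> norm x} f" "continuous_on UNIV \<phi>" "\<And>x. norm x \<le> r \<Longrightarrow> \<phi> x = 0"
  shows "continuous_on UNIV (\<lambda>x. \<phi> x * f x)"
proof -
  have "continuous_on {x. r \<le> norm x} (\<lambda>x. \<phi> x * f x)"
    using assms(1) continuous_on_subset[OF assms(2)] by (intro continuous_on_mult) auto
  moreover have "continuous_on {x. norm x \<le> r} (\<lambda>x. \<phi> x * f x) \<longleftrightarrow> continuous_on {x::'a. norm x \<le> r} (\<lambda>_. 0 :: real)"
    using assms(3) by (intro continuous_on_cong) auto
  then have "continuous_on {x. norm x \<le> r} (\<lambda>x. \<phi> x * f x)"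
    by simp
  moreover have "closed {x::'a. r \<le> norm x}" "closed {x::'a. norm x \<le> r}"
    by (intro closed_Collect_le continuous_intros)+
  ultimately have "continuous_on ({x. r \<le> norm x} \<union> {x. norm x \<le> r}) (\<lambda>x. \<phi> x * f x)"
    by (intro continuous_on_closed_Un)
  moreover have "{x. r \<le> norm x} \<union> {x. norm x \<le> r} = (UNIV :: 'a set)"
    by auto
  ultimately show ?thesis by simp
qed

text \<open>A cutoff that vanishes up to radius \<open>r\<close> and equals 1 from
  \<open>r + 1\<close> on splits \<open>u\<close>: the outer part is continuous and vanishes at
  infinity, the inner part is in L^q with compact support.\<close>

lemma C0_plus_LqcI:
  fixes u :: "'a::euclidean_space \<Rightarrow> real"
  assumes [measurable]: "u \<in> borel_measurable borel" and "q > 0"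
    and cont: "continuous_on {x. r \<le> norm x} u" and lim: "(u \<longlongrightarrow> 0) at_infinity"
    and fin: "\<And>\<rho>. (\<integral>\<^sup>+x. ennreal (\<bar>u x\<bar> powr q) * indicator (ball 0 \<rho>) x \<partial>lborel) < \<infinity>"
  shows "u \<in> C0_plus_Lqc q"
proof -
  define \<phi> where "\<phi> x = max 0 (min 1 (norm x - r))" for x :: 'a
  have \<phi>: "0 \<le> \<phi> x" "\<phi> x \<le> 1" "norm x \<le> r \<Longrightarrow> \<phi> x = 0" "norm x \<ge> r + 1 \<Longrightarrow> \<phi> x = 1" for x
    by (auto simp: \<phi>_def)
  have \<phi>_cont: "continuous_on UNIV \<phi>"
    unfolding \<phi>_def by (intro continuous_intros)
  have [measurable]: "\<phi> \<in> borel_measurable borel"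
    by (rule borel_measurable_continuous_onI[OF \<phi>_cont])
  let ?f = "\<lambda>x. \<phi> x * u x" and ?g = "\<lambda>x. (1 - \<phi> x) * u x"
  have "?f \<in> C0_space"
    unfolding C0_space_def
  proof (intro CollectI conjI)
    show "continuous_on UNIV ?f"
      by (rule continuous_on_cutoff_mult[OF cont \<phi>_cont \<phi>(3)])
    show "(?f \<longlongrightarrow> 0) at_infinity"
    proof (rule tendsto_0_le[OF lim])
      show "\<forall>\<^sub>F x in at_infinity. norm (?f x) \<le> norm (u x) * 1"
        using \<phi> by (intro always_eventually) (auto simp: abs_mult mult_left_le_one_le)
    qed
  qed
  moreover have "?g \<in> Lqc_space q"
    unfolding Lqc_space_def Lq_space_def
  proof (intro CollectI conjI bexI exI)
    show "?g \<in> borel_measurable lebesgue"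
      by (intro measurable_completion) measurable
    have "(\<integral>\<^sup>+x. ennreal (\<bar>?g x\<bar> powr q) \<partial>lborel) \<le> (\<integral>\<^sup>+x. ennreal (\<bar>u x\<bar> powr q) * indicator (ball 0 (\<bar>r\<bar> + 2)) x \<partial>lborel)"
    proof (rule nn_integral_mono)
      fix x
      show "ennreal (\<bar>?g x\<bar> powr q) \<le> ennreal (\<bar>u x\<bar> powr q) * indicator (ball 0 (\<bar>r\<bar> + 2)) x"
      proof (cases "norm x < \<bar>r\<bar> + 2")
        case True
        have "\<bar>?g x\<bar> \<le> \<bar>u x\<bar>"
          using \<phi>[of x] by (simp add: abs_mult mult_left_le_one_le)
        then show ?thesis
          using True \<open>q > 0\<close> by (auto intro!: ennreal_leI powr_mono2)
      next
        case False
        then show ?thesis using \<phi>(4)[of x] by simp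
      qed
    qed
    also have "\<dots> < \<infinity>" by (rule fin)
    finally have "integrable lborel (\<lambda>x. \<bar>?g x\<bar> powr q)"
      by (intro integrableI_nonneg) auto
    then show "integrable lebesgue (\<lambda>x. \<bar>?g x\<bar> powr q)"
      by (subst integrable_completion) auto
    show "compact (cball (0::'a) (r + 1))" by simp
    show "AE x in lebesgue. x \<notin> cball 0 (r + 1) \<longrightarrow> ?g x = 0"
      using \<phi>(4) by (intro AE_I2) auto
  qed
  moreover have "AE x in lebesgue. u x = ?f x + ?g x"
    by (simp add: algebra_simps)
  ultimately show ?thesis
    unfolding C0_plus_Lqc_def by (intro CollectI bexI[of _ ?f] bexI[of _ ?g])
qed

section \<open>Continuity of the fixed point far from the origin\<close>

context radon_problem
begin

text \<open>
  The kernels cut off at radius \<open>1 / n\<close> have continuous potentials, and the error on \<open>S\<close> is at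
  most \<open>M\<close> times the integral of the kernel over \<open>B(0, 1 / n)\<close>.
\<close>

lemma continuous_on_potential:
  fixes \<nu> :: "'a measure"
  assumes sets_nu [measurable_cong]: "sets \<nu> = sets borel" and fin_nu: "emeasure \<nu> UNIV < \<infinity>" and "M \<ge> 0"
    and bound: "\<And>x F. x \<in> S \<Longrightarrow> F \<in> borel_measurable borel \<Longrightarrow>
      (\<integral>\<^sup>+y. F y * indicator (ball x 1) y \<partial>\<nu>) \<le> ennreal M * (\<integral>\<^sup>+y. F y * indicator (ball x 1) y \<partial>lborel)"
    and fin: "\<And>x. x \<in> S \<Longrightarrow> potential \<nu> x < \<infinity>"
  shows "continuous_on S (\<lambda>x. enn2real (potential \<nu> x))"
proof -
  have [simp]: "space \<nu> = UNIV"
    using sets_eq_imp_space_eq[OF sets_nu] by simp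
  interpret nu: finite_measure \<nu>
    by standard (use fin_nu in auto)
  define r where "r n = 1 / real (Suc n)" for n
  have r: "0 < r n" "r n \<le> 1" for n by (auto simp: r_def)
  \<comment> \<open>A ramp from 0 at radius r n / 2 to 1 at radius r n: it removes the singularity
    continuously and changes the kernel only inside the ball of radius r n.\<close>
  define \<phi> where "\<phi> n z = max 0 (min 1 (2 * norm z / r n - 1))" for n and z :: 'a
  have \<phi>: "0 \<le> \<phi> n z" "\<phi> n z \<le> 1" for n z by (auto simp: \<phi>_def)
  have \<phi>0: "norm z \<le> r n / 2 \<Longrightarrow> \<phi> n z = 0" for n z
    using r(1)[of n] by (simp add: \<phi>_def field_simps)
  have \<phi>1: "norm z \<ge> r n \<Longrightarrow> \<phi> n z = 1" for n z
    using r(1)[of n] by (simp add: \<phi>_def field_simps)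
  define G where "G n z = \<phi> n z * fund_sol z" for n and z :: 'a
  have G_cont: "continuous_on UNIV (G n)" for n
    unfolding G_def
  proof (rule continuous_on_cutoff_mult[where r = "r n / 2"])
    show "continuous_on {z::'a. r n / 2 \<le> norm z} fund_sol"
      using r(1)[of n] by (intro continuous_on_subset[OF continuous_on_fund_sol[OF dim]]) auto
    show "continuous_on UNIV (\<phi> n)"
      unfolding \<phi>_def using r(1)[of n] by (intro continuous_intros) auto
  qed (rule \<phi>0)
  have [measurable]: "G n \<in> borel_measurable borel" for n
    by (rule borel_measurable_continuous_onI[OF G_cont])
  have G_nonneg: "0 \<le> G n z" and G_le: "G n z \<le> fund_sol z" for n z
    using \<phi>[of n z] by (auto simp: G_def mult_left_le_one_le)
  have G_bounded: "\<exists>B. \<forall>z. G n z \<le> B" for n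
  proof -
    obtain e :: 'a where e: "e \<in> Basis" using nonempty_Basis by blast
    define z0 where "z0 = (r n / 2) *\<^sub>R e"
    have z0: "z0 \<noteq> 0" "norm z0 = r n / 2"
      using e r(1)[of n] by (auto simp: z0_def)
    have "G n z \<le> fund_sol_exp z0" for z
    proof (cases "norm z \<le> r n / 2")
      case True
      then show ?thesis by (simp add: G_def \<phi>0)
    next
      case False
      have "G n z \<le> exp (- norm z) * fund_sol_exp z"
        using G_le by (simp flip: fund_sol_eq)
      also have "\<dots> \<le> 1 * fund_sol_exp z"
        by (intro mult_right_mono) auto
      also have "\<dots> \<le> fund_sol_exp z0"
        using False z0 fund_sol_exp_antimono[OF dim, of z0 z] by simp
      finally show ?thesis .
    qed
    then show ?thesis by blast
  qed
  define F where "F n x = (\<integral>y. G n (x - y) \<partial>\<nu>)" for n x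
  have G_int: "integrable \<nu> (\<lambda>y. G n (x - y))" for n x
  proof -
    obtain B where B: "\<And>z. G n z \<le> B" using G_bounded by blast
    show ?thesis
      by (rule nu.integrable_const_bound[where B = B]) (auto simp: G_nonneg B)
  qed
  have F_cont: "continuous_on UNIV (F n)" for n
  proof (rule continuous_on_sequentiallyI)
    fix X :: "nat \<Rightarrow> 'a" and x assume X: "X \<longlonglongrightarrow> x"
    obtain B where B: "\<And>z. G n z \<le> B" using G_bounded by blast
    show "(\<lambda>k. F n (X k)) \<longlonglongrightarrow> F n x"
      unfolding F_def
    proof (rule integral_dominated_convergence[where w = "\<lambda>_. B"])
      show "integrable \<nu> (\<lambda>_. B)" by simp
      show "AE y in \<nu>. (\<lambda>k. G n (X k - y)) \<longlonglongrightarrow> G n (x - y)"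
      proof (rule AE_I2)
        fix y
        have "isCont (G n) (x - y)"
          using G_cont by (simp add: continuous_on_eq_continuous_at)
        then show "(\<lambda>k. G n (X k - y)) \<longlonglongrightarrow> G n (x - y)"
          by (rule isCont_tendsto_compose) (intro tendsto_intros X)
      qed
    qed (auto simp: G_nonneg B)
  qed
  define e where "e n = (\<integral>\<^sup>+z. ennreal (fund_sol z) * indicator (ball 0 (r n)) z \<partial>(lborel :: 'a measure))" for n
  have e1: "(\<integral>\<^sup>+z. ennreal (fund_sol z) * indicator (ball 0 1) z \<partial>(lborel :: 'a measure)) < \<infinity>"
  proof -
    have "(\<integral>\<^sup>+z. ennreal (fund_sol z) * indicator (ball 0 1) z \<partial>(lborel :: 'a measure)) \<le>
        (\<integral>\<^sup>+z. ennreal (indicator (ball 0 1) z * fund_sol_exp z powr 1) \<partial>(lborel :: 'a measure))"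
    proof (rule nn_integral_mono)
      fix z :: 'a
      have "fund_sol z \<le> 1 * fund_sol_exp z"
        unfolding fund_sol_eq by (intro mult_right_mono) auto
      then show "ennreal (fund_sol z) * indicator (ball 0 1) z \<le> ennreal (indicator (ball 0 1) z * fund_sol_exp z powr 1)"
        by (auto simp: indicator_def ennreal_leI)
    qed
    also have "\<dots> < \<infinity>"
      using nn_integral_fund_sol_exp_powr[OF dim, of 1] by simp
    finally show ?thesis .
  qed
  have "e \<longlonglongrightarrow> (\<integral>\<^sup>+z. 0 \<partial>(lborel :: 'a measure))"
    unfolding e_def[abs_def]
  proof (rule nn_integral_dominated_convergence[where w = "\<lambda>z. ennreal (fund_sol z) * indicator (ball 0 1) z"])
    show "AE z in (lborel :: 'a measure). (\<lambda>n. ennreal (fund_sol z) * indicator (ball 0 (r n)) z) \<longlonglongrightarrow> 0"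
    proof (rule AE_I2)
      fix z :: 'a
      show "(\<lambda>n. ennreal (fund_sol z) * indicator (ball 0 (r n)) z) \<longlonglongrightarrow> 0"
      proof (cases "z = 0")
        case False
        have "r \<longlonglongrightarrow> 0"
          unfolding r_def by (rule LIMSEQ_Suc[OF lim_1_over_n])
        then have "eventually (\<lambda>n. r n < norm z) sequentially"
          using False by (intro order_tendstoD) auto
        then have "eventually (\<lambda>n. ennreal (fund_sol z) * indicator (ball 0 (r n)) z = 0) sequentially"
          by eventually_elim simp
        then show ?thesis by (rule tendsto_eventually)
      qed simp
    qed
    show "AE z in (lborel :: 'a measure). ennreal (fund_sol z) * indicator (ball 0 (r n)) z \<le> ennreal (fund_sol z) * indicator (ball 0 1) z" for n
      using r(2)[of n] by (intro AE_I2 mult_left_mono) (auto simp: indicator_def)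
  qed (use e1 in auto)
  then have e_lim: "e \<longlonglongrightarrow> 0" by simp
  have e_fin: "e n < \<infinity>" for n
  proof -
    have "e n \<le> (\<integral>\<^sup>+z. ennreal (fund_sol z) * indicator (ball 0 1) z \<partial>(lborel :: 'a measure))"
      unfolding e_def using r(2)[of n] by (intro nn_integral_mono mult_left_mono) (auto simp: indicator_def)
    then show ?thesis using e1 by (rule le_less_trans)
  qed
  have approx: "dist (F n x) (enn2real (potential \<nu> x)) \<le> M * enn2real (e n)" if "x \<in> S" for n x
  proof -
    have Fn: "(\<integral>\<^sup>+y. ennreal (G n (x - y)) \<partial>\<nu>) = ennreal (F n x)"
      unfolding F_def by (rule nn_integral_eq_integral[OF G_int]) (simp add: G_nonneg)
    have F_nonneg: "F n x \<ge> 0"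
      unfolding F_def by (intro integral_nonneg_AE) (simp add: G_nonneg)
    have pot: "potential \<nu> x = ennreal (enn2real (potential \<nu> x))"
      using fin[OF that] by simp
    have "ennreal (F n x) \<le> potential \<nu> x"
      unfolding Fn[symmetric] potential_def by (intro nn_integral_mono ennreal_leI G_le)
    then have lower: "F n x \<le> enn2real (potential \<nu> x)"
      by (subst (asm) pot) simp
    \<comment> \<open>The cut-off part lives in the ball of radius r n \<le> 1, so the extra
      indicator of the unit ball changes nothing; it only gives the integrand the shape required by
      \<open>bound\<close>.\<close>
    have "potential \<nu> x \<le> (\<integral>\<^sup>+y. ennreal (G n (x - y)) + (ennreal (fund_sol (x - y)) * indicator (ball x (r n)) y) * indicator (ball x 1) y \<partial>\<nu>)"
      unfolding potential_def
    proof (rule nn_integral_mono)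
      fix y
      show "ennreal (fund_sol (x - y)) \<le> ennreal (G n (x - y)) + (ennreal (fund_sol (x - y)) * indicator (ball x (r n)) y) * indicator (ball x 1) y"
      proof (cases "norm (x - y) < r n")
        case True
        then show ?thesis using r(2)[of n] by (simp add: dist_norm)
      next
        case False
        then show ?thesis using \<phi>1[of n "x - y"] by (simp add: G_def)
      qed
    qed
    also have "\<dots> = ennreal (F n x) + (\<integral>\<^sup>+y. (ennreal (fund_sol (x - y)) * indicator (ball x (r n)) y) * indicator (ball x 1) y \<partial>\<nu>)"
      by (subst nn_integral_add) (auto simp: Fn)
    also have "\<dots> \<le> ennreal (F n x) + ennreal M * (\<integral>\<^sup>+y. (ennreal (fund_sol (x - y)) * indicator (ball x (r n)) y) * indicator (ball x 1) y \<partial>lborel)"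
      by (intro add_left_mono bound that) measurable
    also have "(\<integral>\<^sup>+y. (ennreal (fund_sol (x - y)) * indicator (ball x (r n)) y) * indicator (ball x 1) y \<partial>lborel) =
        (\<integral>\<^sup>+y. ennreal (fund_sol (x - y)) * indicator (ball 0 (r n)) (x - y) \<partial>lborel)"
      using r(2)[of n] by (intro nn_integral_cong) (auto simp: indicator_def dist_norm norm_minus_commute)
    also have "\<dots> = e n"
      unfolding e_def by (rule nn_integral_lborel_reflect) measurable
    also have "ennreal (F n x) + ennreal M * e n = ennreal (F n x + M * enn2real (e n))"
      using F_nonneg \<open>M \<ge> 0\<close> e_fin[of n] by (simp add: ennreal_mult)
    finally have "enn2real (potential \<nu> x) \<le> F n x + M * enn2real (e n)"
      using F_nonneg \<open>M \<ge> 0\<close> by (intro enn2real_leI) auto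
    with lower show ?thesis
      by (simp add: dist_real_def)
  qed
  have "(\<lambda>n. enn2real (e n)) \<longlonglongrightarrow> 0"
    using e_lim by (intro tendsto_enn2real) auto
  then have lim: "(\<lambda>n. M * enn2real (e n)) \<longlonglongrightarrow> 0"
    by (rule tendsto_mult_right_zero)
  have "uniform_limit S F (\<lambda>x. enn2real (potential \<nu> x)) sequentially"
  proof (rule uniform_limitI)
    fix \<epsilon> :: real assume "\<epsilon> > 0"
    with lim have "eventually (\<lambda>n. M * enn2real (e n) < \<epsilon>) sequentially"
      by (rule order_tendstoD)
    then show "\<forall>\<^sub>F n in sequentially. \<forall>x\<in>S. dist (F n x) (enn2real (potential \<nu> x)) < \<epsilon>"
      by eventually_elim (auto intro: le_less_trans[OF approx])
  qed
  then show ?thesis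
    by (rule uniform_limit_theorem[rotated])
      (auto intro!: always_eventually continuous_on_subset[OF F_cont])
qed

text \<open>The fixed point is a combination of two potentials. Unit balls centred far out do not
  meet the support of \<open>\<mu>\<close>, so the local density bound holds for
  \<open>\<mu>\<close> with constant 0; for the measure with density U^p it holds with
  \<open>K\<close>, by the decay.\<close>

lemma fixed_point_continuous:
  assumes tame: "Lq_loc_vanishing U" and [measurable]: "U \<in> borel_measurable borel" and "\<kappa> \<ge> 0"
    and eq: "\<And>x. U x = step \<kappa> U x" and "C \<ge> 0" "\<rho> \<ge> 1"
    and U_le: "\<And>x. norm x \<ge> \<rho> \<Longrightarrow> U x \<le> ennreal (C * fund_sol x)"
  shows "\<exists>r. continuous_on {x. r \<le> norm x} (\<lambda>x. enn2real (U x))"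
proof -
  obtain D where D: "D \<ge> 0" "\<And>x :: 'a. norm x \<ge> 1 \<Longrightarrow> fund_sol_exp x \<le> D"
    using fund_sol_exp_bounded[OF dim] by blast
  have U_le_exp: "U x \<le> ennreal (C * D * exp (- norm x))" if "norm x \<ge> \<rho>" for x
  proof -
    have "C * fund_sol x \<le> C * (exp (- norm x) * D)"
      unfolding fund_sol_eq using that \<open>\<rho> \<ge> 1\<close> \<open>C \<ge> 0\<close> by (intro mult_left_mono D(2)) auto
    then have "ennreal (C * fund_sol x) \<le> ennreal (C * D * exp (- norm x))"
      by (intro ennreal_leI) (simp add: mult_ac)
    with U_le[OF that] show ?thesis by (rule order_trans)
  qed
  define K where "K = (C * D) powr p"
  have K: "epow p (U x) \<le> ennreal (K * exp (- p * norm x))" if "norm x \<ge> \<rho>" for x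
  proof -
    have "epow p (U x) \<le> epow p (ennreal (C * D * exp (- norm x)))"
      using p_gt_1 U_le_exp[OF that] by (intro epow_mono) auto
    also have "\<dots> = ennreal (K * exp (- p * norm x))"
      using \<open>C \<ge> 0\<close> D(1) by (simp add: epow_ennreal powr_mult exp_powr_real K_def mult_ac)
    finally show ?thesis .
  qed
  \<comment> \<open>One unit beyond both \<rho> and R, so that unit balls centred in
    \<open>S\<close> keep the decay bound and avoid the measure; 2 R is where the far bound for
    \<open>h\<close> begins.\<close>
  define r where "r = max (\<rho> + 1) (max (R + 1) (2 * R))"
  have r: "r \<ge> \<rho> + 1" "r \<ge> R + 1" by (auto simp: r_def)
  define S where "S = {x :: 'a. r \<le> norm x}"
  have near: "norm y > norm x - 1" if "y \<in> ball x 1" for x y :: 'a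
    using that norm_triangle_ineq2[of x y] by (simp add: dist_norm)
  have U_fin: "U x < \<infinity>" if "x \<in> S" for x
    using U_le[of x] that r(1) by (auto simp: S_def intro: le_less_trans)
  have U_eq: "U x = ennreal \<kappa> * h x + fund_conv (\<lambda>y. epow p (U y)) x" for x
    by (subst eq) (simp add: step_def)
  define \<nu> where "\<nu> = density lborel (\<lambda>y. epow p (U y))"
  have pot_nu: "potential \<nu> x = fund_conv (\<lambda>y. epow p (U y)) x" for x
    unfolding potential_def \<nu>_def fund_conv_def by (simp add: nn_integral_density mult.commute)
  have "continuous_on S (\<lambda>x. enn2real (h x))"
  proof (rule continuous_on_potential[OF sets_mu finite_mu order_refl])
    fix x and F :: "'a \<Rightarrow> ennreal" assume "x \<in> S" and [measurable]: "F \<in> borel_measurable borel"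
    have "(\<integral>\<^sup>+y. F y * indicator (ball x 1) y \<partial>\<mu>) = (\<integral>\<^sup>+y. 0 \<partial>\<mu>)"
    proof (rule nn_integral_cong_AE)
      show "AE y in \<mu>. F y * indicator (ball x 1) y = 0"
        using supp
      proof eventually_elim
        case (elim y)
        then show ?case
          using near[of y x] \<open>x \<in> S\<close> r(2) by (cases "y \<in> ball x 1") (auto simp: S_def)
      qed
    qed
    then show "(\<integral>\<^sup>+y. F y * indicator (ball x 1) y \<partial>\<mu>) \<le> ennreal 0 * (\<integral>\<^sup>+y. F y * indicator (ball x 1) y \<partial>lborel)"
      by simp
  next
    obtain C' where C': "C' \<ge> 0" "\<And>x. norm x \<ge> 2 * R \<Longrightarrow> h x \<le> ennreal (C' * fund_sol x)"
      using h_far by blast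
    fix x assume "x \<in> S"
    then have "h x \<le> ennreal (C' * fund_sol x)"
      by (intro C'(2)) (auto simp: S_def r_def)
    then show "h x < \<infinity>" by (auto intro: le_less_trans)
  qed
  moreover have "continuous_on S (\<lambda>x. enn2real (potential \<nu> x))"
  proof (rule continuous_on_potential[where M = K])
    show "sets \<nu> = sets borel" by (simp add: \<nu>_def)
    show "K \<ge> 0" by (simp add: K_def)
    have "emeasure \<nu> UNIV = (\<integral>\<^sup>+y. epow p (U y) \<partial>lborel)"
      by (simp add: \<nu>_def emeasure_density)
    also have "\<dots> \<le> (\<integral>\<^sup>+y. epow p (U y) * indicator (ball 0 \<rho>) y + ennreal K * ennreal (exp (- p * norm y)) \<partial>lborel)"
    proof (rule nn_integral_mono)
      fix y
      show "epow p (U y) \<le> epow p (U y) * indicator (ball 0 \<rho>) y + ennreal K * ennreal (exp (- p * norm y))"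
        using K[of y] by (cases "norm y < \<rho>") (auto simp: K_def ennreal_mult)
    qed
    also have "\<dots> = (\<integral>\<^sup>+y. epow p (U y) * indicator (ball 0 \<rho>) y \<partial>lborel) + ennreal K * (\<integral>\<^sup>+y. ennreal (exp (- p * norm y)) \<partial>(lborel :: 'a measure))"
      by (simp add: nn_integral_add nn_integral_cmult)
    also have "\<dots> < \<infinity>"
      using Lq_loc_vanishing_Lp[OF tame] nn_integral_exp_norm[of p, where 'a = 'a] p_gt_1
      by (simp add: ennreal_mult_less_top)
    finally show "emeasure \<nu> UNIV < \<infinity>" .
    show "potential \<nu> x < \<infinity>" if "x \<in> S" for x
      using U_fin[OF that] unfolding pot_nu by (subst (asm) U_eq) (auto simp: less_top)
    fix x and F :: "'a \<Rightarrow> ennreal" assume "x \<in> S" and [measurable]: "F \<in> borel_measurable borel"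
    have "(\<integral>\<^sup>+y. F y * indicator (ball x 1) y \<partial>\<nu>) = (\<integral>\<^sup>+y. epow p (U y) * (F y * indicator (ball x 1) y) \<partial>lborel)"
      unfolding \<nu>_def by (rule nn_integral_density) measurable
    also have "\<dots> \<le> (\<integral>\<^sup>+y. ennreal K * (F y * indicator (ball x 1) y) \<partial>lborel)"
    proof (rule nn_integral_mono)
      fix y
      show "epow p (U y) * (F y * indicator (ball x 1) y) \<le> ennreal K * (F y * indicator (ball x 1) y)"
      proof (cases "y \<in> ball x 1")
        case True
        have "epow p (U y) \<le> ennreal (K * exp (- p * norm y))"
          using near[OF True] \<open>x \<in> S\<close> r(1) by (intro K) (auto simp: S_def)
        also have "\<dots> \<le> ennreal (K * 1)"
          using p_gt_1 by (intro ennreal_leI mult_left_mono) (auto simp: K_def)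
        finally show ?thesis by (intro mult_right_mono) auto
      qed simp
    qed
    also have "\<dots> = ennreal K * (\<integral>\<^sup>+y. F y * indicator (ball x 1) y \<partial>lborel)"
      by (rule nn_integral_cmult) measurable
    finally show "(\<integral>\<^sup>+y. F y * indicator (ball x 1) y \<partial>\<nu>) \<le> ennreal K * (\<integral>\<^sup>+y. F y * indicator (ball x 1) y \<partial>lborel)" .
  qed
  ultimately have "continuous_on S (\<lambda>x. \<kappa> * enn2real (h x) + enn2real (potential \<nu> x))"
    by (intro continuous_intros)
  moreover have "enn2real (U x) = \<kappa> * enn2real (h x) + enn2real (potential \<nu> x)" if "x \<in> S" for x
  proof -
    have "ennreal \<kappa> * h x < \<infinity>" "potential \<nu> x < \<infinity>"
      using U_fin[OF that] unfolding pot_nu by (subst (asm) U_eq, simp add: less_top)+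
    then show ?thesis
      unfolding pot_nu using \<open>\<kappa> \<ge> 0\<close> by (subst U_eq) (simp add: enn2real_plus enn2real_mult)
  qed
  ultimately have "continuous_on S (\<lambda>x. enn2real (U x))"
    by (simp cong: continuous_on_cong)
  then show ?thesis
    unfolding S_def by blast
qed

section \<open>Minimal solutions\<close>

lemma fund_sol_vanishes: "((fund_sol :: 'a \<Rightarrow> real) \<longlongrightarrow> 0) at_infinity"
proof -
  obtain D where D: "D \<ge> 0" "\<And>x :: 'a. norm x \<ge> 1 \<Longrightarrow> fund_sol_exp x \<le> D"
    using fund_sol_exp_bounded[OF dim] by blast
  have "((\<lambda>x :: 'a. exp (- norm x)) \<longlongrightarrow> 0) at_infinity"
    by (intro filterlim_compose[OF exp_at_bot] filterlim_compose[OF filterlim_uminus_at_bot_at_top] filterlim_norm_at_top)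
  then show ?thesis
  proof (rule tendsto_0_le)
    have "norm (fund_sol x) \<le> norm (exp (- norm x)) * D" if "norm x \<ge> 1" for x :: 'a
      using D(2)[OF that] by (simp add: fund_sol_eq mult_left_mono)
    then show "\<forall>\<^sub>F x :: 'a in at_infinity. norm (fund_sol x) \<le> norm (exp (- norm x)) * D"
      unfolding eventually_at_infinity by blast
  qed
qed

text \<open>Locally the C_0 part is bounded and the rest is in L^q; beyond the compact support only
  the vanishing part remains. Thus every solution can act as a barrier.\<close>

lemma Lq_loc_vanishing_C0_plus_Lqc:
  assumes "u \<in> C0_plus_Lqc q"
  shows "Lq_loc_vanishing (\<lambda>x. ennreal (u x))"
proof -
  have "q > 0" using p_gt_1 q_gt by simp
  obtain f g where f: "continuous_on UNIV f" "(f \<longlongrightarrow> 0) at_infinity"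
    and g: "g \<in> Lqc_space q" and u: "AE x in lebesgue. u x = f x + g x"
    using assms unfolding C0_plus_Lqc_def C0_space_def by blast
  have [measurable]: "g \<in> borel_measurable lebesgue" and g_int: "integrable lebesgue (\<lambda>x. \<bar>g x\<bar> powr q)"
    using g by (auto simp: Lqc_space_def Lq_space_def)
  obtain K where K: "compact K" "AE x in lebesgue. x \<notin> K \<longrightarrow> g x = 0"
    using g unfolding Lqc_space_def by blast
  show ?thesis
    unfolding Lq_loc_vanishing_def
  proof (intro conjI allI impI)
    fix \<rho> :: real
    have "bounded (f ` cball 0 \<rho>)"
      by (intro compact_imp_bounded compact_continuous_image continuous_on_subset[OF f(1)]) auto
    then obtain B where "\<forall>y\<in>f ` cball 0 \<rho>. norm y \<le> B"
      unfolding bounded_iff by blast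
    then have B: "\<bar>f x\<bar> \<le> B" if "x \<in> cball 0 \<rho>" for x
      using that by (metis image_eqI real_norm_def)
    have [measurable]: "(ball 0 \<rho> :: 'a set) \<in> sets lebesgue" by simp
    \<comment> \<open>From u \<le> 2 max (B, |g|): the power of the maximum is at most the sum of
      the two powers.\<close>
    define B' where "B' = (2 * max B 0) powr q"
    have "(\<integral>\<^sup>+x. epow q (ennreal (u x)) * indicator (ball 0 \<rho>) x \<partial>lebesgue) \<le>
        (\<integral>\<^sup>+x. ennreal B' * indicator (ball 0 \<rho>) x + ennreal (2 powr q) * ennreal (\<bar>g x\<bar> powr q) \<partial>lebesgue)"
    proof (rule nn_integral_mono_AE)
      show "AE x in lebesgue. epow q (ennreal (u x)) * indicator (ball 0 \<rho>) x \<le>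
          ennreal B' * indicator (ball 0 \<rho>) x + ennreal (2 powr q) * ennreal (\<bar>g x\<bar> powr q)"
        using u
      proof eventually_elim
        case (elim x)
        show ?case
        proof (cases "x \<in> ball 0 \<rho>")
          case True
          have "u x \<le> 2 * max (max B 0) \<bar>g x\<bar>"
            using elim B[of x] True by auto
          then have "epow q (ennreal (u x)) \<le> epow q (ennreal (2 * max (max B 0) \<bar>g x\<bar>))"
            using \<open>q > 0\<close> by (intro epow_mono ennreal_leI)
          also have "\<dots> = ennreal ((2 * max (max B 0) \<bar>g x\<bar>) powr q)"
            by (rule epow_ennreal) simp
          also have "\<dots> \<le> ennreal (B' + 2 powr q * \<bar>g x\<bar> powr q)"
          proof (rule ennreal_leI)
            show "(2 * max (max B 0) \<bar>g x\<bar>) powr q \<le> B' + 2 powr q * \<bar>g x\<bar> powr q"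
            proof (cases "max B 0 \<le> \<bar>g x\<bar>")
              case True
              then have "max (max B 0) \<bar>g x\<bar> = \<bar>g x\<bar>" by simp
              then show ?thesis by (simp add: powr_mult B'_def)
            next
              case False
              then have "max (max B 0) \<bar>g x\<bar> = max B 0" by simp
              then show ?thesis by (simp add: B'_def)
            qed
          qed
          also have "\<dots> = ennreal B' + ennreal (2 powr q) * ennreal (\<bar>g x\<bar> powr q)"
            by (simp add: B'_def ennreal_mult)
          finally show ?thesis
            using True by simp
        qed simp
      qed
    qed
    also have "\<dots> = ennreal B' * emeasure lebesgue (ball 0 \<rho> :: 'a set) + ennreal (2 powr q) * (\<integral>\<^sup>+x. ennreal (\<bar>g x\<bar> powr q) \<partial>lebesgue)"
      by (subst nn_integral_add) (auto simp: nn_integral_cmult nn_integral_cmult_indicator)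
    also have "\<dots> < \<infinity>"
      using g_int emeasure_lborel_ball_finite[of "0::'a" \<rho>]
      by (simp add: nn_integral_eq_integral ennreal_mult_less_top)
    finally show "(\<integral>\<^sup>+x. epow q (ennreal (u x)) * indicator (ball 0 \<rho>) x \<partial>lborel) < \<infinity>"
      by (simp add: nn_integral_completion)
  next
    fix \<epsilon> :: real assume "\<epsilon> > 0"
    then have "\<forall>\<^sub>F x in at_infinity. f x < \<epsilon>"
      using f(2) by (intro order_tendstoD)
    then obtain b where b: "\<And>x. norm x \<ge> b \<Longrightarrow> f x < \<epsilon>"
      unfolding eventually_at_infinity by blast
    obtain k where k: "\<And>x. x \<in> K \<Longrightarrow> norm x \<le> k"
      using compact_imp_bounded[OF K(1)] unfolding bounded_iff by blast
    have "AE x in lebesgue. norm x \<ge> max b (k + 1) \<longrightarrow> ennreal (u x) \<le> ennreal \<epsilon>"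
      using u K(2)
    proof eventually_elim
      case (elim x)
      then show ?case
        using b[of x] k[of x] by (auto intro!: ennreal_leI)
    qed
    then show "\<exists>\<rho>. AE x in lborel. norm x \<ge> \<rho> \<longrightarrow> ennreal (u x) \<le> ennreal \<epsilon>"
      unfolding AE_completion_iff by blast
  qed
qed

lemma Lq_loc_vanishing_cmult_h:
  assumes "c \<ge> 0"
  shows "Lq_loc_vanishing (\<lambda>x. ennreal c * h x)"
  unfolding Lq_loc_vanishing_def
proof (intro conjI allI impI)
  fix \<rho> :: real
  have "(\<integral>\<^sup>+x. epow q (ennreal c * h x) * indicator (ball 0 \<rho>) x \<partial>lborel) \<le> (\<integral>\<^sup>+x. ennreal (c powr q) * epow q (h x) \<partial>lborel)"
    using p_gt_1 q_gt assms by (intro nn_integral_mono) (auto simp: epow_mult epow_ennreal indicator_def)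
  also have "\<dots> = ennreal (c powr q) * (\<integral>\<^sup>+x. epow q (h x) \<partial>lborel)"
    by (rule nn_integral_cmult) measurable
  also have "\<dots> < \<infinity>"
    using h_Lq by (simp add: ennreal_mult_less_top)
  finally show "(\<integral>\<^sup>+x. epow q (ennreal c * h x) * indicator (ball 0 \<rho>) x \<partial>lborel) < \<infinity>" .
next
  fix \<epsilon> :: real assume "\<epsilon> > 0"
  obtain C where C: "C \<ge> 0" "\<And>x. norm x \<ge> 2 * R \<Longrightarrow> h x \<le> ennreal (C * fund_sol x)"
    using h_far by blast
  have "((\<lambda>x :: 'a. c * C * fund_sol x) \<longlongrightarrow> 0) at_infinity"
    by (rule tendsto_mult_right_zero[OF fund_sol_vanishes])
  then have "\<forall>\<^sub>F x :: 'a in at_infinity. c * C * fund_sol x < \<epsilon>"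
    using \<open>\<epsilon> > 0\<close> by (rule order_tendstoD)
  then obtain b where b: "\<And>x :: 'a. norm x \<ge> b \<Longrightarrow> c * C * fund_sol x < \<epsilon>"
    unfolding eventually_at_infinity by blast
  have "ennreal c * h x \<le> ennreal \<epsilon>" if "norm x \<ge> max b (2 * R)" for x
  proof -
    have "ennreal c * h x \<le> ennreal c * ennreal (C * fund_sol x)"
      using that by (intro mult_left_mono C(2)) auto
    also have "\<dots> = ennreal (c * C * fund_sol x)"
      using assms C(1) by (simp add: mult.assoc flip: ennreal_mult)
    also have "\<dots> \<le> ennreal \<epsilon>"
      using b[of x] that by (intro ennreal_leI) auto
    finally show ?thesis .
  qed
  then show "\<exists>\<rho>. AE x in lborel. norm x \<ge> \<rho> \<longrightarrow> ennreal c * h x \<le> ennreal \<epsilon>"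
    by (intro exI[of _ "max b (2 * R)"] AE_I2) blast
qed

text \<open>The minimal solution is \<open>usol \<kappa>\<close>. The barrier \<open>V\<close> makes
  it finite and tame, decay and continuity then put it into the solution class, and minimality is
  the comparison with any solution taken as its own supersolution.\<close>

lemma minimal_solution:
  assumes "\<kappa> > 0" and super: "AE x in lborel. step \<kappa>' V x \<le> V x" "\<kappa> \<le> \<kappa>'"
    and V: "Lq_loc_vanishing V" "AE x in lborel. V x < \<infinity>"
  shows "\<exists>u. is_minimal_solution p q \<kappa> \<mu> u \<and> ae_bigo_at_infinity u fund_sol"
proof -
  define U where "U = usol \<kappa>"
  have [measurable]: "U \<in> borel_measurable borel" by (simp add: U_def)
  have U_eq: "U x = step \<kappa> U x" for x
    unfolding U_def by (rule usol_eq)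
  have U_le: "AE x in lborel. U x \<le> V x"
    unfolding U_def by (rule usol_le[OF super(2,1)])
  then have tame: "Lq_loc_vanishing U"
    by (rule Lq_loc_vanishing_mono[OF V(1)])
  have U_fin: "AE x in lborel. U x < \<infinity>"
    using U_le V(2) by eventually_elim (auto intro: le_less_trans)
  obtain C \<rho> where C: "C \<ge> 0" "\<rho> \<ge> 1" "\<And>x. norm x \<ge> \<rho> \<Longrightarrow> U x \<le> ennreal (C * fund_sol x)"
    using fund_sol_decay[OF tame _ _ U_eq] \<open>\<kappa> > 0\<close> by auto
  obtain r where r: "continuous_on {x. r \<le> norm x} (\<lambda>x. enn2real (U x))"
    using fixed_point_continuous[OF tame _ _ U_eq C] \<open>\<kappa> > 0\<close> by auto
  define u where "u x = enn2real (U x)" for x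
  have [measurable]: "u \<in> borel_measurable borel"
    unfolding u_def[abs_def] by measurable
  have u_le: "norm (u x) \<le> norm (fund_sol x) * C" if "norm x \<ge> \<rho>" for x
    using C(1) C(3)[OF that] by (auto simp: u_def mult.commute intro!: enn2real_leI)
  have u_U: "AE x in lborel. ennreal (u x) = U x"
    using U_fin by eventually_elim (simp add: u_def)
  have "u \<in> C0_plus_Lqc q"
  proof (rule C0_plus_LqcI)
    show "q > 0" using p_gt_1 q_gt by simp
    show "continuous_on {x. r \<le> norm x} u" using r by (simp add: u_def[abs_def])
    show "(u \<longlongrightarrow> 0) at_infinity"
    proof (rule tendsto_0_le[OF fund_sol_vanishes])
      show "\<forall>\<^sub>F x in at_infinity. norm (u x) \<le> norm (fund_sol x) * C"
        unfolding eventually_at_infinity using u_le by blast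
    qed
    show "(\<integral>\<^sup>+x. ennreal (\<bar>u x\<bar> powr q) * indicator (ball 0 \<rho>) x \<partial>lborel) < \<infinity>" for \<rho>
    proof -
      have "(\<integral>\<^sup>+x. ennreal (\<bar>u x\<bar> powr q) * indicator (ball 0 \<rho>) x \<partial>lborel) \<le>
          (\<integral>\<^sup>+x. epow q (U x) * indicator (ball 0 \<rho>) x \<partial>lborel)"
        by (intro nn_integral_mono mult_right_mono) (auto simp: u_def epow_def)
      also have "\<dots> < \<infinity>" using tame by (simp add: Lq_loc_vanishing_def)
      finally show ?thesis .
    qed
  qed measurable
  moreover have "AE x in lborel. ennreal (u x) = step \<kappa> (\<lambda>y. ennreal (u y)) x \<and> u x > 0"
    using u_U h_pos
  proof eventually_elim
    case (elim x)
    have "step \<kappa> (\<lambda>y. ennreal (u y)) x = step \<kappa> U x"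
      unfolding step_def using u_U by (intro arg_cong2[where f = "(+)"] refl fund_conv_cong_AE) (auto elim!: eventually_mono)
    moreover have "U x > 0"
    proof -
      have "0 < ennreal \<kappa> * h x"
        using elim(2) \<open>\<kappa> > 0\<close> by (simp add: ennreal_zero_less_mult_iff)
      also have "\<dots> \<le> U x"
        by (subst U_eq) (simp add: step_def)
      finally show ?thesis .
    qed
    ultimately show ?case
      using elim(1) U_eq[of x] by (metis ennreal_less_zero_iff)
  qed
  ultimately have "is_solution p q \<kappa> \<mu> u"
    by (simp add: is_solution_iff)
  moreover have "AE x in lebesgue. u x \<le> v x" if "is_solution p q \<kappa> \<mu> v" for v
  proof -
    have v: "AE x in lborel. ennreal (v x) = step \<kappa> (\<lambda>y. ennreal (v y)) x \<and> v x > 0"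
      using that by (simp add: is_solution_iff)
    then have "AE x in lborel. step \<kappa> (\<lambda>y. ennreal (v y)) x \<le> ennreal (v x)"
      by eventually_elim simp
    then have "AE x in lborel. U x \<le> ennreal (v x)"
      unfolding U_def by (rule usol_le[OF order_refl])
    then have "AE x in lborel. u x \<le> v x"
      using v by eventually_elim (auto simp: u_def intro!: enn2real_leI)
    then show ?thesis by (simp add: AE_completion_iff)
  qed
  moreover have "u \<in> O[at_infinity](fund_sol)"
  proof (rule bigoI)
    show "\<forall>\<^sub>F x in at_infinity. norm (u x) \<le> C * norm (fund_sol x)"
      unfolding eventually_at_infinity using u_le by (auto simp: mult.commute)
  qed
  ultimately show ?thesis
    unfolding is_minimal_solution_def ae_bigo_at_infinity_def by (intro exI[of _ u]) auto
qed

section \<open>The threshold\<close>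

lemma solution_supersolution:
  assumes "is_solution p q \<kappa> \<mu> v"
  shows "AE x in lborel. step \<kappa> (\<lambda>y. ennreal (v y)) x \<le> ennreal (v x)" "Lq_loc_vanishing (\<lambda>x. ennreal (v x))"
  using assms Lq_loc_vanishing_C0_plus_Lqc by (auto simp: is_solution_iff elim: eventually_mono)

text \<open>Solvability passes to smaller parameters, because a solution for \<kappa>' is a
  supersolution for every \<kappa> < \<kappa>'. The supremum of the admissible parameters is
  positive by the explicit supersolution and finite by the bound for large parameters.\<close>

lemma ex_threshold:
  "\<exists>\<kappa>s::real. \<kappa>s > 0 \<and>
    (\<forall>\<kappa>. 0 < \<kappa> \<and> \<kappa> < \<kappa>s \<longrightarrow>
       (\<exists>u. is_minimal_solution p q \<kappa> \<mu> u \<and> ae_bigo_at_infinity u fund_sol)) \<and>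
    (\<forall>\<kappa>. \<kappa> > \<kappa>s \<longrightarrow> \<not> (\<exists>u. is_solution p q \<kappa> \<mu> u))"
proof -
  define S where "S = {\<kappa>. \<kappa> > 0 \<and> (\<exists>u. is_solution p q \<kappa> \<mu> u)}"
  obtain \<kappa>0 where \<kappa>0: "\<kappa>0 > 0"
    "AE x in lborel. step \<kappa>0 (\<lambda>y. ennreal (2 * \<kappa>0) * h y) x \<le> ennreal (2 * \<kappa>0) * h x"
    using ex_supersolution by blast
  have "AE x in lborel. ennreal (2 * \<kappa>0) * h x < \<infinity>"
    using h_finite by eventually_elim (simp add: ennreal_mult_less_top)
  moreover have "Lq_loc_vanishing (\<lambda>x. ennreal (2 * \<kappa>0) * h x)"
    using \<kappa>0(1) by (intro Lq_loc_vanishing_cmult_h) simp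
  ultimately have "\<exists>u. is_minimal_solution p q \<kappa>0 \<mu> u \<and> ae_bigo_at_infinity u fund_sol"
    by (intro minimal_solution[OF \<kappa>0 order_refl])
  then have "\<kappa>0 \<in> S"
    using \<kappa>0(1) by (auto simp: S_def is_minimal_solution_def)
  obtain K where K: "\<And>\<kappa>. \<kappa> > 0 \<Longrightarrow> AE x in lborel. usol \<kappa> x < \<infinity> \<Longrightarrow> \<kappa> \<le> K"
    using kappa_bounded_if_usol_finite by blast
  have "\<kappa> \<le> K" if in_S: "\<kappa> \<in> S" for \<kappa>
  proof (rule K)
    show "\<kappa> > 0" using in_S by (simp add: S_def)
    obtain v where "is_solution p q \<kappa> \<mu> v" using in_S by (auto simp: S_def)
    then have "AE x in lborel. usol \<kappa> x \<le> ennreal (v x)"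
      by (intro usol_le[OF order_refl] solution_supersolution)
    then show "AE x in lborel. usol \<kappa> x < \<infinity>"
      by eventually_elim (auto intro: le_less_trans)
  qed
  then have bdd: "bdd_above S" unfolding bdd_above_def by blast
  show ?thesis
  proof (intro exI[of _ "Sup S"] conjI allI impI)
    show "Sup S > 0"
      using cSup_upper[OF \<open>\<kappa>0 \<in> S\<close> bdd] \<kappa>0(1) by linarith
  next
    fix \<kappa> assume \<kappa>: "0 < \<kappa> \<and> \<kappa> < Sup S"
    then obtain \<kappa>' where \<kappa>': "\<kappa>' \<in> S" "\<kappa> < \<kappa>'"
      using less_cSup_iff[OF _ bdd] \<open>\<kappa>0 \<in> S\<close> by blast
    then obtain v where v: "is_solution p q \<kappa>' \<mu> v" by (auto simp: S_def)
    show "\<exists>u. is_minimal_solution p q \<kappa> \<mu> u \<and> ae_bigo_at_infinity u fund_sol"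
      using \<kappa> \<kappa>' solution_supersolution[OF v] by (intro minimal_solution[of \<kappa> \<kappa>' "\<lambda>x. ennreal (v x)"]) auto
  next
    fix \<kappa> assume "\<kappa> > Sup S"
    then have "\<kappa> \<notin> S" using cSup_upper[OF _ bdd] by force
    moreover have "\<kappa> > 0"
      using \<open>\<kappa> > Sup S\<close> cSup_upper[OF \<open>\<kappa>0 \<in> S\<close> bdd] \<kappa>0(1) by linarith
    ultimately show "\<not> (\<exists>u. is_solution p q \<kappa> \<mu> u)"
      by (simp add: S_def)
  qed
qed

end

theorem theorem1p1:
  fixes \<mu> :: "'a::euclidean_space measure" and p q R :: real
  assumes "DIM('a) \<ge> 2"
    and "radon_measure \<mu>"
    and "emeasure \<mu> UNIV \<noteq> 0"
    and "R > 0"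
    and "measure_support \<mu> \<subseteq> ball 0 R"
    and "p > 1"
    and "q > max p (real DIM('a) * (p - 1) / 2)"
    and "ennreal_in_Lq q (potential \<mu>)"
  shows "\<exists>\<kappa>s::real. \<kappa>s > 0 \<and>
    (\<forall>\<kappa>. 0 < \<kappa> \<and> \<kappa> < \<kappa>s \<longrightarrow>
       (\<exists>u. is_minimal_solution p q \<kappa> \<mu> u \<and> ae_bigo_at_infinity u fund_sol)) \<and>
    (\<forall>\<kappa>. \<kappa> > \<kappa>s \<longrightarrow> \<not> (\<exists>u. is_solution p q \<kappa> \<mu> u))"
proof -
  have sets [measurable_cong]: "sets \<mu> = sets borel" and compact: "\<And>K. compact K \<Longrightarrow> emeasure \<mu> K < \<infinity>"
    using assms(2) by (auto simp: radon_measure_def)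
  \<comment> \<open>The covering argument needs a closed set, hence the passage to the closed ball,
    whose compactness also makes \<open>\<mu>\<close> finite.\<close>
  have supp: "AE y in \<mu>. y \<in> cball 0 R"
    using assms(5) ball_subset_cball by (intro measure_support_compl_null[OF sets]) auto
  have "emeasure \<mu> UNIV = emeasure \<mu> (cball 0 R)"
    using supp by (intro emeasure_eq_AE) (auto simp: sets)
  then have fin: "emeasure \<mu> UNIV < \<infinity>"
    using compact[of "cball 0 R"] by simp
  have h: "AE x in lborel. potential \<mu> x < \<infinity>"
    "integrable lebesgue (\<lambda>x. \<bar>enn2real (potential \<mu> x)\<bar> powr q)"
    using assms(8) by (auto simp: ennreal_in_Lq_def Lq_space_def AE_completion_iff)
  have "(\<integral>\<^sup>+x. epow q (potential \<mu> x) \<partial>lborel) = (\<integral>\<^sup>+x. ennreal (\<bar>enn2real (potential \<mu> x)\<bar> powr q) \<partial>lebesgue)"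
    unfolding nn_integral_completion using h(1)
    by (intro nn_integral_cong_AE) (auto simp: epow_def elim!: eventually_mono)
  also have "\<dots> < \<infinity>"
    using h(2) by (simp add: nn_integral_eq_integral)
  finally have hq: "(\<integral>\<^sup>+x. epow q (potential \<mu> x) \<partial>lborel) < \<infinity>" .
  interpret radon_problem \<mu> p q R
    by standard (use assms sets fin supp h(1) hq in auto)
  show ?thesis
    by (rule ex_threshold)
qed

end
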